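(* Let $G$ be an infinite profinite group. The following conditions are equivalent: (1) $\mathcal{L}_c(G)$ has finite width; (2) $\mathcal{L}_o(G)$ has finite width; (3) $G=K\ltimes T$, where $K\simeq\mathbb{Z}_p$ and $T$ is a finite $p'$-group for some prime number $p$.
   Context: For a profinite group $G$: $\mathcal{L}_c(G)$ is the lattice of all closed subgroups of $G$, with meet the intersection and join $\overline{\langle X,Y\rangle}$; $\mathcal{L}_o(G)$ is the lattice of all open subgroups of $G$. A lattice has finite width $w$ if all its antichains (sets of pairwise incomparable elements) are finite and $w$ is the maximum cardinality of an antichain. $\mathbb{Z}_p$ is the additive group of $p$-adic integers with its profinite topology. $G=K\ltimes T$ means that $G$ is the internal semidirect product of a closed normal subgroup $T$ by a closed subgroup $K$ (so $G=KT$ and $K\cap T=\{1\}$). A finite $p'$-group is a finite group of order not divisible by $p$. *)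

theory Defs
  imports "HOL-Algebra.Algebra" "HOL-Analysis.Analysis"
begin

(* makes \<open>closure_of\<close> unambiguously the topological closure *)
no_notation eq_closure_of (\<open>closure'_of\<index>\<close>)

section \<open>Profinite groups\<close>

locale topological_group = group G for G (structure) +
  fixes \<tau> :: "'a topology"
  assumes topspace_eq: "topspace \<tau> = carrier G"
    and continuous_mult: "continuous_map (prod_topology \<tau> \<tau>) \<tau> (\<lambda>(x, y). x \<otimes> y)"
    and continuous_inv: "continuous_map \<tau> \<tau> (\<lambda>x. inv x)"

definition totally_disconnected_space :: "'a topology \<Rightarrow> bool" where
  "totally_disconnected_space \<tau> \<longleftrightarrow> (\<forall>C. connectedin \<tau> C \<longrightarrow> (\<exists>a. C \<subseteq> {a}))"

locale profinite_group = topological_group +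
  assumes compact: "compact_space \<tau>"
    and Hausdorff: "Hausdorff_space \<tau>"
    and totally_disconnected: "totally_disconnected_space \<tau>"

definition topologically_isomorphic ::
  "('a, 'c) monoid_scheme \<Rightarrow> 'a topology \<Rightarrow> ('b, 'd) monoid_scheme \<Rightarrow> 'b topology \<Rightarrow> bool" where
  "topologically_isomorphic G \<tau> H Y \<longleftrightarrow> (\<exists>f. f \<in> iso G H \<and> homeomorphic_map \<tau> Y f)"

definition internal_semidirect_product ::
  "('a, 'b) monoid_scheme \<Rightarrow> 'a topology \<Rightarrow> 'a set \<Rightarrow> 'a set \<Rightarrow> bool" where
  "internal_semidirect_product G \<tau> K N \<longleftrightarrow>
     subgroup K G \<and> closedin \<tau> K \<and> N \<lhd> G \<and> closedin \<tau> N \<and>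
     K <#>\<^bsub>G\<^esub> N = carrier G \<and> K \<inter> N = {\<one>\<^bsub>G\<^esub>}"


section \<open>The additive group of p-adic integers\<close>

text \<open>
  The inverse limit of the discrete groups of integers modulo \<open>p ^ n\<close>, realised inside their
  product: a p-adic integer is the sequence of its residues \<open>x n\<close>, with \<open>x n \<in> {0..<p ^ n}\<close>.
  Meant for \<open>p\<close> prime.
\<close>

definition padic_int_group :: "nat \<Rightarrow> (nat \<Rightarrow> int) monoid" where
  "padic_int_group p =
     (product_group UNIV (\<lambda>n. integer_mod_group (p ^ n)))
       \<lparr>carrier := {x \<in> carrier (product_group UNIV (\<lambda>n. integer_mod_group (p ^ n))).
                     \<forall>n. x (Suc n) mod int (p ^ n) = x n}\<rparr>"

definition padic_int_topology :: "nat \<Rightarrow> (nat \<Rightarrow> int) topology" where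
  "padic_int_topology p =
     subtopology
       (product_topology (\<lambda>n. discrete_topology (carrier (integer_mod_group (p ^ n)))) UNIV)
       (carrier (padic_int_group p))"


section \<open>Width of an ordered set\<close>

definition antichain_in :: "('a, 'b) gorder_scheme \<Rightarrow> 'a set \<Rightarrow> bool" where
  "antichain_in L A \<longleftrightarrow>
     A \<subseteq> carrier L \<and>
     (\<forall>x\<in>A. \<forall>y\<in>A. x \<noteq> y \<longrightarrow> \<not> x \<sqsubseteq>\<^bsub>L\<^esub> y \<and> \<not> y \<sqsubseteq>\<^bsub>L\<^esub> x)"

definition has_width :: "('a, 'b) gorder_scheme \<Rightarrow> nat \<Rightarrow> bool" where
  "has_width L w \<longleftrightarrow>
     (\<forall>A. antichain_in L A \<longrightarrow> finite A \<and> card A \<le> w) \<and> (\<exists>A. antichain_in L A \<and> card A = w)"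

definition finite_width :: "('a, 'b) gorder_scheme \<Rightarrow> bool" where
  "finite_width L \<longleftrightarrow> (\<exists>w. has_width L w)"


section \<open>Lattices of closed and of open subgroups\<close>

definition closed_subgroup_lattice ::
  "('a, 'b) monoid_scheme \<Rightarrow> 'a topology \<Rightarrow> 'a set gorder" where
  "closed_subgroup_lattice G \<tau> =
     \<lparr>carrier = {H. subgroup H G \<and> closedin \<tau> H}, eq = (=), le = (\<subseteq>)\<rparr>"

definition open_subgroup_lattice ::
  "('a, 'b) monoid_scheme \<Rightarrow> 'a topology \<Rightarrow> 'a set gorder" where
  "open_subgroup_lattice G \<tau> =
     \<lparr>carrier = {H. subgroup H G \<and> openin \<tau> H}, eq = (=), le = (\<subseteq>)\<rparr>"

lemma partial_order_set_family:
  "partial_order \<lparr>carrier = F, eq = (=), le = (\<subseteq>)\<rparr>"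
  by unfold_locales auto

lemma set_family_lattice:
  fixes F :: "'a set set"
  defines "L \<equiv> \<lparr>carrier = F, eq = (=), le = (\<subseteq>)\<rparr>"
  assumes inter: "\<forall>A\<in>F. \<forall>B\<in>F. A \<inter> B \<in> F"
    and join: "\<forall>A\<in>F. \<forall>B\<in>F. j A B \<in> F"
    and upper: "\<forall>A\<in>F. \<forall>B\<in>F. A \<union> B \<subseteq> j A B"
    and least: "\<forall>A\<in>F. \<forall>B\<in>F. \<forall>C\<in>F. A \<union> B \<subseteq> C \<longrightarrow> j A B \<subseteq> C"
  shows "Lattice.lattice L"
    and "\<And>A B. A \<in> F \<Longrightarrow> B \<in> F \<Longrightarrow> A \<sqinter>\<^bsub>L\<^esub> B = A \<inter> B"
    and "\<And>A B. A \<in> F \<Longrightarrow> B \<in> F \<Longrightarrow> A \<squnion>\<^bsub>L\<^esub> B = j A B"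
proof -
  interpret partial_order L unfolding L_def by (rule partial_order_set_family)
  have lub: "least L (j A B) (Upper L {A, B})" if "A \<in> F" "B \<in> F" for A B
    using that join upper least by (simp add: L_def least_def Upper_def)
  have glb: "greatest L (A \<inter> B) (Lower L {A, B})" if "A \<in> F" "B \<in> F" for A B
    using that inter by (auto simp: L_def greatest_def Lower_def)
  show "Lattice.lattice L"
  proof unfold_locales
    fix A B assume "A \<in> carrier L" "B \<in> carrier L"
    then have "A \<in> F" "B \<in> F" by (simp_all add: L_def)
    then show "\<exists>S. least L S (Upper L {A, B})" "\<exists>S. greatest L S (Lower L {A, B})"
      using lub glb by blast+
  qed
  show "A \<sqinter>\<^bsub>L\<^esub> B = A \<inter> B" if "A \<in> F" "B \<in> F" for A B
    unfolding Lattice.meet_def Lattice.inf_def 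
    by (rule some_equality[where P = "\<lambda>x. greatest L x (Lower L {A, B})"])
      (use glb[OF that] greatest_unique in blast)+
  show "A \<squnion>\<^bsub>L\<^esub> B = j A B" if "A \<in> F" "B \<in> F" for A B
    unfolding Lattice.join_def Lattice.sup_def 
    by (rule some_equality[where P = "\<lambda>x. least L x (Upper L {A, B})"])
      (use lub[OF that] least_unique in blast)+
qed

context topological_group
begin

lemma continuous_left_translation:
  assumes "g \<in> carrier G"
  shows "continuous_map \<tau> \<tau> (\<lambda>x. g \<otimes> x)"
proof -
  have "continuous_map \<tau> (prod_topology \<tau> \<tau>) (\<lambda>x. (g, x))"
    using assms by (intro continuous_map_pairedI) (auto simp: topspace_eq)
  from continuous_map_compose[OF this continuous_mult] show ?thesis
    by (simp add: o_def)
qed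

lemma subgroup_closure_of:
  assumes "subgroup H G"
  shows "subgroup (\<tau> closure_of H) G"
proof -
  have sub: "H \<subseteq> carrier G" using assms by (rule subgroup.subset)
  have m: "x \<otimes> y \<in> \<tau> closure_of H" if "x \<in> \<tau> closure_of H" "y \<in> \<tau> closure_of H" for x y
  proof -
    have "(x, y) \<in> prod_topology \<tau> \<tau> closure_of (H \<times> H)"
      using that by (simp add: closure_of_Times)
    then have "x \<otimes> y \<in> \<tau> closure_of ((\<lambda>(x, y). x \<otimes> y) ` (H \<times> H))"
      using continuous_map_image_closure_subset[OF continuous_mult, of "H \<times> H"] by force
    moreover have "(\<lambda>(x, y). x \<otimes> y) ` (H \<times> H) \<subseteq> H"
      using assms by (auto intro: subgroup.m_closed)
    ultimately show ?thesis by (meson closure_of_mono subsetD)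
  qed
  have i: "inv x \<in> \<tau> closure_of H" if "x \<in> \<tau> closure_of H" for x
  proof -
    have "inv x \<in> \<tau> closure_of ((\<lambda>x. inv x) ` H)"
      using continuous_map_image_closure_subset[OF continuous_inv, of H] that by force
    moreover have "(\<lambda>x. inv x) ` H \<subseteq> H"
      using assms by (auto intro: subgroup.m_inv_closed)
    ultimately show ?thesis by (meson closure_of_mono subsetD)
  qed
  have "H \<subseteq> \<tau> closure_of H"
    using sub by (simp add: closure_of_subset topspace_eq)
  then have "\<one> \<in> \<tau> closure_of H" using assms subgroup.one_closed by blast
  moreover have "\<tau> closure_of H \<subseteq> carrier G"
    using closure_of_subset_topspace topspace_eq by metis
  ultimately show ?thesis by (intro subgroupI) (use m i in auto)
qed

lemma openin_subgroup_superset: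
  assumes "subgroup U G" "openin \<tau> U" "subgroup H G" "U \<subseteq> H"
  shows "openin \<tau> H"
proof -
  have "\<exists>V. openin \<tau> V \<and> h \<in> V \<and> V \<subseteq> H" if h: "h \<in> H" for h
  proof -
    have hG: "h \<in> carrier G" by (rule subgroup.mem_carrier[OF assms(3) h])
    let ?V = "{x \<in> topspace \<tau>. inv h \<otimes> x \<in> U}"
    have "openin \<tau> ?V"
      using openin_continuous_map_preimage[OF continuous_left_translation assms(2)] hG by simp
    moreover have "h \<in> ?V"
      using hG assms(1) by (simp add: topspace_eq subgroup.one_closed)
    moreover have "?V \<subseteq> H"
    proof
      fix x assume x: "x \<in> ?V"
      then have xG: "x \<in> carrier G" and "inv h \<otimes> x \<in> H"
        using assms(4) by (auto simp: topspace_eq)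
      then have "h \<otimes> (inv h \<otimes> x) \<in> H"
        by (intro subgroup.m_closed[OF assms(3) h])
      also have "h \<otimes> (inv h \<otimes> x) = x"
        using m_assoc[OF hG inv_closed[OF hG] xG] hG xG by (simp only: r_inv l_one)
      finally show "x \<in> H" .
    qed
    ultimately show ?thesis by blast
  qed
  then show ?thesis by (intro openin_subopen[THEN iffD2] ballI)
qed

lemma closed_subgroup_lattice:
  shows "Lattice.lattice (closed_subgroup_lattice G \<tau>)"
    and "\<And>A B. A \<in> carrier (closed_subgroup_lattice G \<tau>) \<Longrightarrow>
      B \<in> carrier (closed_subgroup_lattice G \<tau>) \<Longrightarrow>
      A \<sqinter>\<^bsub>closed_subgroup_lattice G \<tau>\<^esub> B = A \<inter> B"
    and "\<And>A B. A \<in> carrier (closed_subgroup_lattice G \<tau>) \<Longrightarrow>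
      B \<in> carrier (closed_subgroup_lattice G \<tau>) \<Longrightarrow>
      A \<squnion>\<^bsub>closed_subgroup_lattice G \<tau>\<^esub> B = \<tau> closure_of (generate G (A \<union> B))"
proof -
  let ?F = "{H. subgroup H G \<and> closedin \<tau> H}"
  let ?j = "\<lambda>A B. \<tau> closure_of (generate G (A \<union> B))"
  have gen: "subgroup (generate G (A \<union> B)) G" if "A \<in> ?F" "B \<in> ?F" for A B
    using that by (intro generate_is_subgroup) (auto dest: subgroup.subset)
  have 1: "A \<inter> B \<in> ?F" if "A \<in> ?F" "B \<in> ?F" for A B
    using that subgroups_Inter_pair by auto
  have 2: "?j A B \<in> ?F" if "A \<in> ?F" "B \<in> ?F" for A B
    using subgroup_closure_of[OF gen[OF that]] by simp
  have 3: "A \<union> B \<subseteq> ?j A B" if "A \<in> ?F" "B \<in> ?F" for A B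
  proof -
    have "A \<union> B \<subseteq> generate G (A \<union> B)" by (auto intro: generate.incl)
    also have "\<dots> \<subseteq> ?j A B"
      using subgroup.subset[OF gen[OF that]] by (simp add: closure_of_subset topspace_eq)
    finally show ?thesis .
  qed
  have 4: "?j A B \<subseteq> C" if "A \<in> ?F" "B \<in> ?F" "C \<in> ?F" "A \<union> B \<subseteq> C" for A B C
    using that by (intro closure_of_minimal generate_subgroup_incl) auto
  have "\<forall>A\<in>?F. \<forall>B\<in>?F. A \<inter> B \<in> ?F" "\<forall>A\<in>?F. \<forall>B\<in>?F. ?j A B \<in> ?F"
    "\<forall>A\<in>?F. \<forall>B\<in>?F. A \<union> B \<subseteq> ?j A B"
    "\<forall>A\<in>?F. \<forall>B\<in>?F. \<forall>C\<in>?F. A \<union> B \<subseteq> C \<longrightarrow> ?j A B \<subseteq> C"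
    by (intro ballI impI; rule 1 2 3 4; assumption)+
  note * = set_family_lattice[of ?F ?j, OF this, folded closed_subgroup_lattice_def]
  show "Lattice.lattice (closed_subgroup_lattice G \<tau>)" by (rule *(1))
  fix A B
  assume "A \<in> carrier (closed_subgroup_lattice G \<tau>)" "B \<in> carrier (closed_subgroup_lattice G \<tau>)"
  then have AB: "A \<in> ?F" "B \<in> ?F" by (simp_all add: closed_subgroup_lattice_def)
  show "A \<sqinter>\<^bsub>closed_subgroup_lattice G \<tau>\<^esub> B = A \<inter> B" by (rule *(2)[OF AB])
  show "A \<squnion>\<^bsub>closed_subgroup_lattice G \<tau>\<^esub> B = ?j A B" by (rule *(3)[OF AB])
qed

lemma open_subgroup_lattice:
  shows "Lattice.lattice (open_subgroup_lattice G \<tau>)"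
    and "\<And>A B. A \<in> carrier (open_subgroup_lattice G \<tau>) \<Longrightarrow>
      B \<in> carrier (open_subgroup_lattice G \<tau>) \<Longrightarrow>
      A \<sqinter>\<^bsub>open_subgroup_lattice G \<tau>\<^esub> B = A \<inter> B"
    and "\<And>A B. A \<in> carrier (open_subgroup_lattice G \<tau>) \<Longrightarrow>
      B \<in> carrier (open_subgroup_lattice G \<tau>) \<Longrightarrow>
      A \<squnion>\<^bsub>open_subgroup_lattice G \<tau>\<^esub> B = generate G (A \<union> B)"
proof -
  let ?F = "{H. subgroup H G \<and> openin \<tau> H}"
  let ?j = "\<lambda>A B. generate G (A \<union> B)"
  have gen: "subgroup (?j A B) G" if "A \<in> ?F" "B \<in> ?F" for A B
    using that by (intro generate_is_subgroup) (auto dest: subgroup.subset)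
  have 1: "A \<inter> B \<in> ?F" if "A \<in> ?F" "B \<in> ?F" for A B
    using that subgroups_Inter_pair by auto
  have 3: "A \<union> B \<subseteq> ?j A B" for A B
    by (auto intro: generate.incl)
  have 2: "?j A B \<in> ?F" if "A \<in> ?F" "B \<in> ?F" for A B
    using openin_subgroup_superset[of A, OF _ _ gen[OF that]] gen[OF that] that 3[of A B] by auto
  have 4: "?j A B \<subseteq> C" if "A \<in> ?F" "B \<in> ?F" "C \<in> ?F" "A \<union> B \<subseteq> C" for A B C
    using that by (intro generate_subgroup_incl) auto
  have "\<forall>A\<in>?F. \<forall>B\<in>?F. A \<inter> B \<in> ?F" "\<forall>A\<in>?F. \<forall>B\<in>?F. ?j A B \<in> ?F"
    "\<forall>A\<in>?F. \<forall>B\<in>?F. A \<union> B \<subseteq> ?j A B"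
    "\<forall>A\<in>?F. \<forall>B\<in>?F. \<forall>C\<in>?F. A \<union> B \<subseteq> C \<longrightarrow> ?j A B \<subseteq> C"
    by (intro ballI impI; rule 1 2 3 4; assumption)+
  note * = set_family_lattice[of ?F ?j, OF this, folded open_subgroup_lattice_def]
  show "Lattice.lattice (open_subgroup_lattice G \<tau>)" by (rule *(1))
  fix A B
  assume "A \<in> carrier (open_subgroup_lattice G \<tau>)" "B \<in> carrier (open_subgroup_lattice G \<tau>)"
  then have AB: "A \<in> ?F" "B \<in> ?F" by (simp_all add: open_subgroup_lattice_def)
  show "A \<sqinter>\<^bsub>open_subgroup_lattice G \<tau>\<^esub> B = A \<inter> B" by (rule *(2)[OF AB])
  show "A \<squnion>\<^bsub>open_subgroup_lattice G \<tau>\<^esub> B = ?j A B" by (rule *(3)[OF AB])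
qed

end

end

theory Submission
  imports Defs
begin

text \<open>
  Closed subgroups are intersections of open ones, so finite antichains of closed subgroups can be
  enlarged to antichains of open subgroups; hence both lattices have finite width simultaneously.

  Suppose now that the closed subgroups have finite width. Subgroups of prime order modulo a closed
  subgroup \<open>C\<close> are pairwise incomparable, so elements of prime order modulo \<open>C\<close> avoid a
  neighbourhood of the identity; likewise the conjugates of a closed subgroup are pairwise
  incomparable, so its normalizer is open. With \<open>C\<close> trivial this gives an open torsion-free subgroup.
  The closed subgroup generated by a nontrivial element \<open>x\<close> of it is a copy of the p-adic integers,
  since two primes would yield the antichains generated by the powers \<open>x ^ (p ^ i * q ^ (n - i))\<close>.
  It meets the closure of every other cyclic subgroup normalizing it, again by width, and is
  therefore open. Some power of \<open>x\<close> generates an open central subgroup \<open>Z\<close>. The transfer into \<open>Z\<close>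
  has finite kernel \<open>T\<close> and procyclic image. The order of \<open>T\<close> is prime to \<open>p\<close> because the p-adic
  integers times a group of order \<open>p\<close> have infinite width, and the \<open>|T|\<close>-th power of a preimage of
  a generator of the image generates the complement \<open>K\<close>.

  Conversely, let \<open>U\<close> be the centralizer of \<open>T\<close> in \<open>K\<close>. A closed subgroup \<open>H\<close> either contains the
  finite index subgroup \<open>U\<close> or is the product of its intersections with \<open>K\<close>, whose closed
  subgroups form a chain, and with the finite group \<open>T\<close>.
\<close>

section \<open>Cosets and powers\<close>

text \<open>The width hypothesis enters in two strengths. Finiteness of single antichains settles
  conjugates and subgroups of prime order modulo \<open>C\<close>; the uniform bound is needed
  against families that contain, for each \<open>n\<close>, an antichain of length
  \<open>n + 1\<close>. Powers with p-adic exponents are never introduced: elements of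
  \<open>pcyc x\<close> are handled through integer powers, finitely many cosets and closedness, and
  divisibility of exponents plays the part of the valuation. The obstacle at the end is that an open
  central copy of the p-adic integers does not split off by itself. The transfer repairs this: it is
  a homomorphism into a torsion-free group that on \<open>Z\<close> is the power map with the index
  as exponent. So its kernel is normal, meets \<open>Z\<close> trivially and embeds in the set of
  cosets of \<open>Z\<close>. Raising to the power \<open>|T|\<close> then kills the part in
  \<open>T\<close>, while the generator of the image changes only by a unit, because
  \<open>p\<close> does not divide \<open>|T|\<close>.\<close>

lemma nat_prime_factor_induct:
  assumes "m > 0"
    and "\<And>a q. P a \<Longrightarrow> Factorial_Ring.prime q \<Longrightarrow> q dvd m \<Longrightarrow> P (a * q)" and "P (1::nat)"
  shows "P m"
  using assms
proof (induction m rule: less_induct)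
  case (less m)
  show ?case
  proof (cases "m = 1")
    case False
    then obtain q where q: "Factorial_Ring.prime q" "q dvd m"
      using prime_factor_nat by blast
    then obtain k where k: "m = k * q" by (metis dvd_def mult.commute)
    have "P k"
    proof (rule less.IH)
      show "k < m" "0 < k" using k less.prems(1) prime_gt_1_nat[OF q(1)] by auto
      show "P 1" by (rule less.prems)
      show "P (a * r)" if "P a" "Factorial_Ring.prime r" "r dvd k" for a r
        using that k less.prems(2) by (metis dvd_mult2)
    qed
    then show ?thesis using less.prems(2) q k by blast
  qed (use less.prems in simp)
qed

context group
begin

lemma coprime_pow_mem:
  assumes S: "subgroup S G" and x: "x \<in> carrier G"
    and i: "x [^] (i::int) \<in> S" and j: "x [^] (j::int) \<in> S" and "coprime i j"
  shows "x \<in> S"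
proof -
  obtain u v where uv: "u * i + v * j = 1"
    using \<open>coprime i j\<close> by (metis coprime_imp_gcd_eq_1 bezout_int)
  have "x [^] (i * u) \<in> S" "x [^] (j * v) \<in> S"
    using subgroup_int_pow_closed[OF S i, of u] subgroup_int_pow_closed[OF S j, of v] x
    by (simp_all add: int_pow_pow)
  then have "x [^] (i * u + j * v) \<in> S"
    using S x by (simp add: int_pow_mult subgroup.m_closed)
  moreover have "i * u + j * v = 1" using uv by (simp add: mult.commute)
  ultimately show ?thesis using x by simp
qed

lemma coprime_nat_pow_mem:
  assumes "subgroup S G" "x \<in> carrier G"
    and "x [^] (i::nat) \<in> S" "x [^] (j::nat) \<in> S" and "coprime i j"
  shows "x \<in> S"
  using assms coprime_pow_mem[of S x "int i" "int j"] by (simp add: int_pow_int)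

lemma mem_r_coset_iff:
  assumes "subgroup H G" "a \<in> carrier G"
  shows "x \<in> H #> a \<longleftrightarrow> x \<in> carrier G \<and> x \<otimes> inv a \<in> H"
proof
  assume "x \<in> H #> a"
  then obtain h where "h \<in> H" "x = h \<otimes> a" by (auto simp: r_coset_def)
  then show "x \<in> carrier G \<and> x \<otimes> inv a \<in> H"
    using assms subgroup.mem_carrier[OF assms(1)] by (auto simp: m_assoc)
next
  assume "x \<in> carrier G \<and> x \<otimes> inv a \<in> H"
  moreover from this have "x = (x \<otimes> inv a) \<otimes> a" using assms by (simp add: m_assoc)
  ultimately show "x \<in> H #> a" unfolding r_coset_def by blast
qed

lemma r_coset_eq_iff:
  assumes "subgroup H G" "a \<in> carrier G" "b \<in> carrier G"
  shows "H #> a = H #> b \<longleftrightarrow> a \<otimes> inv b \<in> H"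
  using assms by (metis mem_r_coset_iff rcos_self repr_independence)

text \<open>Pigeonhole on the cosets of the powers of \<open>x\<close>. \<open>H\<close> need not be
  normal, so this also serves for normalizers and procyclic subgroups, where no quotient group is
  available.\<close>

lemma finite_rcosets_pow:
  assumes H: "subgroup H G" and fin: "finite (rcosets H)" and x: "x \<in> carrier G"
  shows "\<exists>n>0::nat. x [^] n \<in> H"
proof -
  have "range (\<lambda>n::nat. H #> x [^] n) \<subseteq> rcosets H"
    using x by (auto simp: RCOSETS_def)
  then have "\<not> inj (\<lambda>n::nat. H #> x [^] n)"
    using fin finite_subset finite_imageD by blast
  then obtain i j :: nat where "i < j" and eq: "H #> x [^] j = H #> x [^] i"
    unfolding inj_def by (metis linorder_neqE_nat)
  have "x [^] j \<otimes> inv (x [^] i) = x [^] (j - i)"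
    using x \<open>i < j\<close> nat_pow_mult[OF x, of "j - i" i]
    by (metis inv_solve_right' le_add_diff_inverse2 less_imp_le nat_pow_closed)
  then have "x [^] (j - i) \<in> H" using eq H x r_coset_eq_iff by (metis nat_pow_closed)
  then show ?thesis using \<open>i < j\<close> by (intro exI[of _ "j - i"]) simp
qed

lemma finite_rcosets_repr:
  assumes H: "subgroup H G" and fin: "finite (rcosets H)"
  shows "\<exists>R. finite R \<and> R \<subseteq> carrier G \<and> carrier G = (\<Union>r\<in>R. H #> r)"
proof -
  have "rcosets H = (\<lambda>a. H #> a) ` carrier G" by (auto simp: RCOSETS_def)
  with fin obtain R where "R \<subseteq> carrier G" "finite R" "rcosets H = (\<lambda>a. H #> a) ` R"
    by (metis finite_subset_image subset_refl)
  then show ?thesis using rcosets_part_G[OF H] by metis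
qed

lemma finite_rcosetsI:
  assumes H: "subgroup H G" and "finite (f ` carrier G)"
    and "\<And>a b. a \<in> carrier G \<Longrightarrow> b \<in> carrier G \<Longrightarrow> f a = f b \<Longrightarrow> a \<otimes> inv b \<in> H"
  shows "finite (rcosets H)"
proof -
  obtain R where R: "R \<subseteq> carrier G" "finite R" "f ` carrier G = f ` R"
    by (metis assms(2) finite_subset_image subset_refl)
  have "rcosets H \<subseteq> (\<lambda>a. H #> a) ` R"
  proof
    fix c assume "c \<in> rcosets H"
    then obtain a where a: "a \<in> carrier G" "c = H #> a" by (auto simp: RCOSETS_def)
    then obtain r where "r \<in> R" "f a = f r" using R(3) by blast
    then show "c \<in> (\<lambda>a. H #> a) ` R"
      using a R(1) assms(3)[of a r] r_coset_eq_iff[OF H, of a r] by auto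
  qed
  then show ?thesis using R(2) finite_surj by blast
qed

text \<open>An overgroup is a union of cosets of \<open>U\<close>, hence is determined by a subset
  of a finite set.\<close>

lemma finite_overgroups:
  assumes U: "subgroup U G" and fin: "finite (rcosets U)"
  shows "finite {H. subgroup H G \<and> U \<subseteq> H}"
proof -
  have "{H. subgroup H G \<and> U \<subseteq> H} \<subseteq> Union ` Pow (rcosets U)"
  proof
    fix H assume "H \<in> {H. subgroup H G \<and> U \<subseteq> H}"
    then have H: "subgroup H G" "U \<subseteq> H" by auto
    have "H = \<Union> ((\<lambda>h. U #> h) ` H)"
    proof
      show "H \<subseteq> \<Union> ((\<lambda>h. U #> h) ` H)"
        using H U subgroup.mem_carrier[OF H(1)] rcos_self by blast
      show "\<Union> ((\<lambda>h. U #> h) ` H) \<subseteq> H"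
        using H by (auto simp: r_coset_def intro: subgroup.m_closed)
    qed
    moreover have "(\<lambda>h. U #> h) ` H \<subseteq> rcosets U"
      using subgroup.subset[OF H(1)] by (auto simp: RCOSETS_def)
    ultimately show "H \<in> Union ` Pow (rcosets U)" by blast
  qed
  then show ?thesis using fin by (meson finite_Pow_iff finite_surj)
qed

lemma finite_subgroup_pow_card:
  assumes H: "subgroup H G" and "finite H" and t: "t \<in> H"
  shows "t [^] card H = \<one>"
proof -
  interpret H: group "G\<lparr>carrier := H\<rparr>" by (rule subgroup_imp_group[OF H])
  have "t [^]\<^bsub>G\<lparr>carrier := H\<rparr>\<^esub> Coset.order (G\<lparr>carrier := H\<rparr>) = \<one>"
    using H.pow_order_eq_1[of t] t by simp
  then show ?thesis using nat_pow_consistent[of t "card H" H] by (simp add: Coset.order_def)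
qed

text \<open>Cauchy's theorem. \<open>sylow_thm\<close> yields a subgroup of order
  \<open>p ^ a\<close> for every factorization \<open>p ^ a * m\<close> of the order, even if
  \<open>p\<close> divides \<open>m\<close>, so \<open>a = 1\<close> suffices.\<close>

lemma subgroup_cauchy:
  assumes H: "subgroup H G" "finite H" and p: "Factorial_Ring.prime p" "p dvd card H"
  shows "\<exists>t\<in>H. t \<noteq> \<one> \<and> t [^] p = \<one>"
proof -
  interpret H: group "G\<lparr>carrier := H\<rparr>" by (rule subgroup_imp_group[OF H(1)])
  obtain m where m: "card H = p ^ 1 * m" using p(2) by auto
  obtain P where P: "subgroup P (G\<lparr>carrier := H\<rparr>)" "card P = p ^ 1"
    using sylow_thm[OF p(1) H.is_group, of 1 m] H(2) m by (auto simp: Coset.order_def)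
  have PH: "P \<subseteq> H" using subgroup.subset[OF P(1)] by simp
  have PG: "subgroup P G" using incl_subgroup[OF H(1) P(1)] .
  have "finite P" using PH H(2) finite_subset by blast
  have "\<not> P \<subseteq> {\<one>}"
  proof
    assume "P \<subseteq> {\<one>}"
    then have "card P \<le> 1" using card_mono[of "{\<one>}" P] by simp
    then show False using P(2) prime_gt_1_nat[OF p(1)] by simp
  qed
  then obtain t where "t \<in> P" "t \<noteq> \<one>" by blast
  then show ?thesis using finite_subgroup_pow_card[OF PG \<open>finite P\<close>] P(2) PH by auto
qed

lemma conj_nat_pow:
  assumes "g \<in> carrier G" "c \<in> carrier G"
  shows "(g \<otimes> c \<otimes> inv g) [^] (n::nat) = g \<otimes> c [^] n \<otimes> inv g"
proof (induction n)
  case (Suc n)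
  have "inv g \<otimes> (g \<otimes> (c \<otimes> inv g)) = c \<otimes> inv g" using assms by (simp add: m_assoc[symmetric])
  then show ?case using Suc assms by (simp add: m_assoc)
qed (use assms in simp)

text \<open>The transfer into a central subgroup of finite index: multiply the cocycle
  \<open>s c * g / s (c * g)\<close> of a section \<open>s\<close> over all cosets \<open>c\<close>.\<close>

lemma central_transfer:
  assumes Z: "subgroup Z G" and central: "\<And>z g. z \<in> Z \<Longrightarrow> g \<in> carrier G \<Longrightarrow> z \<otimes> g = g \<otimes> z"
    and fin: "finite (rcosets Z)"
  shows "\<exists>V. V \<in> carrier G \<rightarrow> Z \<and>
    (\<forall>g\<in>carrier G. \<forall>h\<in>carrier G. V (g \<otimes> h) = V g \<otimes> V h) \<and>
    (\<forall>z\<in>Z. V z = z [^] card (rcosets Z))"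
proof -
  let ?Z = "G\<lparr>carrier := Z\<rparr>"
  have ZG: "z \<in> carrier G" if "z \<in> Z" for z using that Z subgroup.mem_carrier by metis
  interpret Z: comm_group ?Z
    using subgroup_imp_group[OF Z] central ZG by (intro group.group_comm_groupI) auto
  define s where "s c = (SOME a. a \<in> c)" for c :: "'a set"
  have s: "s c \<in> c" if "c \<in> rcosets Z" for c
  proof -
    obtain a where "a \<in> carrier G" "c = Z #> a" using \<open>c \<in> rcosets Z\<close> by (auto simp: RCOSETS_def)
    then have "a \<in> c" using rcos_self Z by blast
    then show ?thesis unfolding s_def by (rule someI)
  qed
  have sG: "s c \<in> carrier G" if "c \<in> rcosets Z" for c
    using s[OF that] that rcosets_part_G[OF Z] by blast
  have coset: "c = Z #> s c" if c: "c \<in> rcosets Z" for c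
  proof -
    obtain a where "a \<in> carrier G" "c = Z #> a" using c by (auto simp: RCOSETS_def)
    then show ?thesis using repr_independence[of "s c" Z a] s[OF c] Z by simp
  qed
  have mult_coset: "c #> g \<in> rcosets Z" if "c \<in> rcosets Z" "g \<in> carrier G" for c g
    using that subgroup.subset[OF Z] by (auto simp: RCOSETS_def coset_mult_assoc)
  define z where "z c g = s c \<otimes> g \<otimes> inv (s (c #> g))" for c g
  have zZ: "z c g \<in> Z" if c: "c \<in> rcosets Z" and g: "g \<in> carrier G" for c g
  proof -
    have "Z #> (s c \<otimes> g) = c #> g"
      using coset[OF c] g sG[OF c] subgroup.subset[OF Z] by (metis coset_mult_assoc)
    also have "\<dots> = Z #> s (c #> g)" using coset[OF mult_coset[OF c g]] .
    finally show ?thesis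
      unfolding z_def using r_coset_eq_iff[OF Z] sG[OF c] sG[OF mult_coset[OF c g]] g by simp
  qed
  have bij: "bij_betw (\<lambda>c. c #> g) (rcosets Z) (rcosets Z)" if g: "g \<in> carrier G" for g
  proof (rule bij_betw_byWitness[where f' = "\<lambda>c. c #> inv g"])
    have *: "c #> a #> inv a = c" if "c \<in> rcosets Z" "a \<in> carrier G" for c a
      using that subgroup.subset[OF Z]
      by (auto simp: RCOSETS_def coset_mult_assoc m_assoc)
    show "\<forall>c\<in>rcosets Z. c #> g #> inv g = c" using * g by blast
    show "\<forall>c\<in>rcosets Z. c #> inv g #> g = c" using *[of _ "inv g"] g by simp
  qed (use mult_coset g in auto)
  define V where "V g = finprod ?Z (\<lambda>c. z c g) (rcosets Z)" for g
  have "V (g \<otimes> h) = V g \<otimes> V h" if g: "g \<in> carrier G" and h: "h \<in> carrier G" for g h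
  proof -
    \<comment> \<open>The chosen representative of the intermediate coset cancels. Since
      \<open>c #> g\<close> runs through all cosets along with \<open>c\<close>, the product of
      these identities is the multiplicativity of \<open>V\<close>.\<close>
    have cocycle: "z c (g \<otimes> h) = z c g \<otimes> z (c #> g) h" if c: "c \<in> rcosets Z" for c
    proof -
      note c2 = mult_coset[OF c g] and c3 = mult_coset[OF mult_coset[OF c g] h]
      have assoc: "c #> (g \<otimes> h) = c #> g #> h"
        using c g h rcosets_part_G[OF Z] coset_mult_assoc[of c g h] by blast
      have "inv (s (c #> g)) \<otimes> (s (c #> g) \<otimes> (h \<otimes> inv (s (c #> g #> h)))) = h \<otimes> inv (s (c #> g #> h))"
        using sG[OF c2] sG[OF c3] h by (simp add: m_assoc[symmetric])
      then show ?thesis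
        unfolding z_def assoc using sG[OF c] sG[OF c2] sG[OF c3] g h by (simp add: m_assoc)
    qed
    have "V (g \<otimes> h) = finprod ?Z (\<lambda>c. z c g \<otimes>\<^bsub>?Z\<^esub> z (c #> g) h) (rcosets Z)"
      unfolding V_def using cocycle zZ mult_coset g h subgroup.m_closed[OF Z] by (intro Z.finprod_cong') auto
    also have "\<dots> = V g \<otimes> finprod ?Z (\<lambda>c. z (c #> g) h) (rcosets Z)"
      unfolding V_def using zZ mult_coset g h by (subst Z.finprod_multf) auto
    also have "finprod ?Z (\<lambda>c. z (c #> g) h) (rcosets Z) = finprod ?Z (\<lambda>c. z c h) ((\<lambda>c. c #> g) ` (rcosets Z))"
      using bij[OF g] zZ h mult_coset[OF _ g]
      by (intro Z.finprod_reindex[symmetric]) (auto simp: bij_betw_def)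
    also have "(\<lambda>c. c #> g) ` (rcosets Z) = rcosets Z" using bij[OF g] by (simp add: bij_betw_def)
    finally show ?thesis unfolding V_def .
  qed
  moreover have "V a = a [^] card (rcosets Z)" if a: "a \<in> Z" for a
  proof -
    \<comment> \<open>Multiplication by a central element of \<open>Z\<close> fixes every coset, so
      each factor of the transfer is \<open>a\<close> conjugated by a representative, that is
      \<open>a\<close> itself.\<close>
    have "z c a = a" if c: "c \<in> rcosets Z" for c
    proof -
      have "c #> a = c"
      proof -
        have "Z #> (s c \<otimes> a) = Z #> s c"
        proof -
          have "s c \<otimes> a \<otimes> inv (s c) = a"
            using central[OF a sG[OF c]] ZG[OF a] sG[OF c] by (metis inv_solve_right' m_closed)
          then show ?thesis using r_coset_eq_iff[OF Z] sG[OF c] ZG[OF a] a by simp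
        qed
        then show ?thesis using coset[OF c] coset_mult_assoc[OF subgroup.subset[OF Z] sG[OF c] ZG[OF a]] by metis
      qed
      moreover have "s c \<otimes> a \<otimes> inv (s c) = a"
        using central[OF a sG[OF c]] ZG[OF a] sG[OF c] by (metis inv_solve_right' m_closed)
      ultimately show ?thesis unfolding z_def by simp
    qed
    then have "V a = finprod ?Z (\<lambda>c. a) (rcosets Z)"
      unfolding V_def using a by (intro Z.finprod_cong') auto
    also have "\<dots> = a [^]\<^bsub>?Z\<^esub> card (rcosets Z)" using a by (intro Z.finprod_const) simp
    finally show ?thesis using nat_pow_consistent by metis
  qed
  moreover have "V \<in> carrier G \<rightarrow> Z"
  proof
    fix g assume g: "g \<in> carrier G"
    have "V g \<in> carrier ?Z" unfolding V_def using zZ g by (intro Z.finprod_closed) auto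
    then show "V g \<in> Z" by simp
  qed
  ultimately show ?thesis by blast
qed

end

section \<open>Topological preliminaries\<close>

text \<open>Membership and non-membership in a clopen set are both open conditions. This makes the
  set of insertions that preserve \<open>W\<close> accessible to the tube lemma below.\<close>

lemma openin_clopen_agree:
  assumes f: "continuous_map Z Y f" and g: "continuous_map Z Y g" and W: "openin Y W" "closedin Y W"
  shows "openin Z {z \<in> topspace Z. f z \<in> W \<longleftrightarrow> g z \<in> W}"
proof -
  let ?p = "\<lambda>h S. {z \<in> topspace Z. h z \<in> S}"
  have nW: "openin Y (topspace Y - W)" using W(2) by blast
  have "f z \<in> topspace Y" "g z \<in> topspace Y" if "z \<in> topspace Z" for z
    using that continuous_map_funspace[OF f] continuous_map_funspace[OF g] by auto
  then have "{z \<in> topspace Z. f z \<in> W \<longleftrightarrow> g z \<in> W} =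
      (?p f W \<inter> ?p g W) \<union> (?p f (topspace Y - W) \<inter> ?p g (topspace Y - W))"
    by blast
  moreover have "openin Z \<dots>"
    by (intro openin_Un openin_Int openin_continuous_map_preimage[OF f] openin_continuous_map_preimage[OF g] W(1) nW)
  ultimately show ?thesis by simp
qed

section \<open>Continuity, cosets and open subgroups in topological groups\<close>

context topological_group
begin

lemma continuous_map_mult:
  assumes "continuous_map Z \<tau> f" "continuous_map Z \<tau> g"
  shows "continuous_map Z \<tau> (\<lambda>x. f x \<otimes> g x)"
  using continuous_map_compose[OF continuous_map_pairedI[OF assms] continuous_mult]
  by (simp add: o_def)

lemma continuous_map_inv:
  assumes "continuous_map Z \<tau> f"
  shows "continuous_map Z \<tau> (\<lambda>x. inv (f x))"
  using continuous_map_compose[OF assms continuous_inv] by (simp add: o_def)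

lemma continuous_map_const_carrier:
  assumes "a \<in> carrier G"
  shows "continuous_map Z \<tau> (\<lambda>x. a)"
  using assms by (simp add: topspace_eq)

lemma continuous_map_nat_pow:
  assumes "continuous_map Z \<tau> f"
  shows "continuous_map Z \<tau> (\<lambda>x. f x [^] (n::nat))"
proof (induction n)
  case (Suc n)
  show ?case using continuous_map_mult[OF Suc assms] by simp
qed (simp add: continuous_map_const_carrier del: continuous_map_const)

lemmas group_continuous = continuous_map_mult continuous_map_inv continuous_map_const_carrier
  continuous_map_nat_pow continuous_map_id[of \<tau>, unfolded id_def]

lemma closedin_preimage:
  assumes "continuous_map \<tau> \<tau> f" "closedin \<tau> S"
  shows "closedin \<tau> {x \<in> carrier G. f x \<in> S}"
  using closedin_continuous_map_preimage[OF assms] by (simp add: topspace_eq)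

lemma openin_preimage:
  assumes "continuous_map \<tau> \<tau> f" "openin \<tau> S"
  shows "openin \<tau> {x \<in> carrier G. f x \<in> S}"
  using openin_continuous_map_preimage[OF assms] by (simp add: topspace_eq)

lemma closedin_r_coset:
  assumes "subgroup H G" "closedin \<tau> H" "a \<in> carrier G"
  shows "closedin \<tau> (H #> a)"
proof -
  have "H #> a = {x \<in> carrier G. x \<otimes> inv a \<in> H}"
    using mem_r_coset_iff[OF assms(1,3)] by blast
  then show ?thesis
    using assms by (simp only:) (intro closedin_preimage group_continuous inv_closed)
qed

lemma openin_r_coset:
  assumes "subgroup H G" "openin \<tau> H" "a \<in> carrier G"
  shows "openin \<tau> (H #> a)"
proof -
  have "H #> a = {x \<in> carrier G. x \<otimes> inv a \<in> H}"
    using mem_r_coset_iff[OF assms(1,3)] by blast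
  then show ?thesis
    using assms by (simp only:) (intro openin_preimage group_continuous inv_closed)
qed

lemma open_subgroup_closedin:
  assumes H: "subgroup H G" "openin \<tau> H"
  shows "closedin \<tau> H"
proof -
  have "carrier G - H = (\<Union>a \<in> carrier G - H. H #> a)"
  proof
    show "carrier G - H \<subseteq> (\<Union>a \<in> carrier G - H. H #> a)"
      using rcos_self[OF _ H(1)] by blast
    show "(\<Union>a \<in> carrier G - H. H #> a) \<subseteq> carrier G - H"
    proof
      fix x assume "x \<in> (\<Union>a \<in> carrier G - H. H #> a)"
      then obtain a where a: "a \<in> carrier G" "a \<notin> H" "x \<in> H #> a" by blast
      then have xa: "x \<in> carrier G" "x \<otimes> inv a \<in> H" using mem_r_coset_iff[OF H(1)] by auto
      have "x \<notin> H"
      proof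
        assume "x \<in> H"
        then have "inv (x \<otimes> inv a) \<otimes> x \<in> H"
          using xa(2) H(1) by (meson subgroup.m_closed subgroup.m_inv_closed)
        then show False using a xa(1) by (simp add: inv_mult_group m_assoc)
      qed
      then show "x \<in> carrier G - H" using xa by blast
    qed
  qed
  moreover have "openin \<tau> (\<Union>a \<in> carrier G - H. H #> a)"
    using openin_r_coset[OF H] by (intro openin_Union) auto
  ultimately show ?thesis
    using subgroup.subset[OF H(1)] by (simp add: closedin_def topspace_eq)
qed

text \<open>Removing from \<open>W\<close> the finitely many closed cosets other than
  \<open>H\<close> leaves exactly \<open>H\<close>. Allowing an open \<open>W\<close> in place of
  the whole group lets a subgroup of finite index in an open subgroup be recognized as open.\<close>

lemma closed_subgroup_openin:
  assumes H: "subgroup H G" "closedin \<tau> H" and fin: "finite R" "R \<subseteq> carrier G"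
    and W: "openin \<tau> W" "H \<subseteq> W" "W \<subseteq> (\<Union>r\<in>R. H #> r)"
  shows "openin \<tau> H"
proof -
  let ?F = "\<Union>r\<in>R - H. H #> r"
  have "closedin \<tau> ?F"
    using fin by (intro closedin_Union) (auto intro!: closedin_r_coset H)
  moreover have "H = W - ?F"
  proof
    have "x \<notin> H" if "r \<in> R" "r \<notin> H" "x \<in> H #> r" for x r
    proof
      assume "x \<in> H"
      have "r \<in> carrier G" using that fin by blast
      then have "inv (x \<otimes> inv r) \<otimes> x \<in> H" "x \<in> carrier G"
        using that(3) \<open>x \<in> H\<close> H(1) mem_r_coset_iff[OF H(1)]
        by (meson subgroup.m_closed subgroup.m_inv_closed)+
      then show False using that \<open>r \<in> carrier G\<close> by (simp add: inv_mult_group m_assoc)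
    qed
    then show "H \<subseteq> W - ?F" using W by blast
    show "W - ?F \<subseteq> H"
    proof
      fix x assume x: "x \<in> W - ?F"
      then obtain r where r: "r \<in> R" "x \<in> H #> r" using W by blast
      then have "r \<in> H" using x by blast
      then have "H #> r = H" using H(1) fin r(1) by (meson coset_join2 subsetD)
      then show "x \<in> H" using r by simp
    qed
  qed
  ultimately show ?thesis using W(1) by (metis openin_diff)
qed

lemma closed_finite_index_openin:
  assumes H: "subgroup H G" "closedin \<tau> H" and fin: "finite (rcosets H)"
  shows "openin \<tau> H"
proof -
  obtain R where R: "finite R" "R \<subseteq> carrier G" "carrier G = (\<Union>r\<in>R. H #> r)"
    using finite_rcosets_repr[OF H(1) fin] by blast
  show ?thesis
    using closed_subgroup_openin[OF H R(1,2), of "carrier G"] R(3) subgroup.subset[OF H(1)]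
      openin_topspace[of \<tau>] topspace_eq by simp
qed

lemma subgroup_openinI:
  assumes H: "subgroup H G" and V: "openin \<tau> V" "\<one> \<in> V" "V \<subseteq> H"
  shows "openin \<tau> H"
proof -
  have "\<exists>T. openin \<tau> T \<and> h \<in> T \<and> T \<subseteq> H" if h: "h \<in> H" for h
  proof (intro exI[of _ "{x \<in> carrier G. inv h \<otimes> x \<in> V}"] conjI)
    have hG: "h \<in> carrier G" using h H subgroup.mem_carrier by metis
    show "openin \<tau> {x \<in> carrier G. inv h \<otimes> x \<in> V}"
      using hG V by (intro openin_preimage group_continuous inv_closed)
    show "h \<in> {x \<in> carrier G. inv h \<otimes> x \<in> V}" using hG V by simp
    show "{x \<in> carrier G. inv h \<otimes> x \<in> V} \<subseteq> H"
    proof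
      fix x assume "x \<in> {x \<in> carrier G. inv h \<otimes> x \<in> V}"
      then have x: "x \<in> carrier G" "inv h \<otimes> x \<in> H" using V by auto
      then have "h \<otimes> (inv h \<otimes> x) \<in> H" using H h by (meson subgroup.m_closed)
      then show "x \<in> H" using x hG by (simp add: m_assoc[symmetric])
    qed
  qed
  then show ?thesis using openin_subopen by blast
qed

end

section \<open>Compactness, clopen neighbourhoods and open normal subgroups\<close>

context profinite_group
begin

lemma compactin_closed: "closedin \<tau> S \<Longrightarrow> compactin \<tau> S"
  by (rule closedin_compact_space[OF compact])

lemma closedin_image:
  assumes "continuous_map \<tau> \<tau> f" "closedin \<tau> S"
  shows "closedin \<tau> (f ` S)"
  by (meson Hausdorff assms compactin_closed compactin_imp_closedin image_compactin)

lemma closedin_set_mult: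
  assumes "closedin \<tau> S" "closedin \<tau> T"
  shows "closedin \<tau> (S <#> T)"
proof -
  have "S <#> T = (\<lambda>(x, y). x \<otimes> y) ` (S \<times> T)" by (auto simp: set_mult_def)
  moreover have "compactin (prod_topology \<tau> \<tau>) (S \<times> T)"
    using assms by (simp add: compactin_Times compactin_closed)
  ultimately show ?thesis
    by (metis Hausdorff compactin_imp_closedin continuous_mult image_compactin)
qed

lemma closedin_finite: "finite S \<Longrightarrow> S \<subseteq> carrier G \<Longrightarrow> closedin \<tau> S"
  using Hausdorff compactin_imp_closedin finite_imp_compactin topspace_eq by metis

text \<open>In a compact Hausdorff space quasi-components are connected components, here single
  points. Compactness of the complement of \<open>V0\<close> then merges the separations of
  \<open>a\<close> from its points into a single one.\<close>

lemma clopen_neighbourhood: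
  assumes V0: "openin \<tau> V0" and a: "a \<in> V0"
  shows "\<exists>W. openin \<tau> W \<and> closedin \<tau> W \<and> a \<in> W \<and> W \<subseteq> V0"
proof -
  have aG: "a \<in> topspace \<tau>" using assms openin_subset by blast
  have C: "quasi_component_of_set \<tau> a \<in> quasi_components_of \<tau>"
    using aG by (simp add: quasi_component_in_quasi_components_of)
  have "connectedin \<tau> (quasi_component_of_set \<tau> a)"
    using compact Hausdorff C compact_quasi_eq_connected_components_of[of \<tau>] connectedin_connected_components_of[of _ \<tau>] compact_imp_locally_compact_space closedin_quasi_components_of[of _ \<tau>] compactin_closed
    by metis
  then have "quasi_component_of_set \<tau> a \<subseteq> {a}"
    using totally_disconnected aG unfolding totally_disconnected_space_def
    by (metis mem_Collect_eq quasi_component_of_refl singletonD subsetD)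
  moreover have "compactin \<tau> (topspace \<tau> - V0)"
    using V0 by (intro compactin_closed) blast
  ultimately have "separated_between \<tau> (quasi_component_of_set \<tau> a) (topspace \<tau> - V0)"
    using separated_between_quasi_component_compact[OF C] a by (auto simp: disjnt_def)
  then obtain U T where UT: "openin \<tau> U" "openin \<tau> T" "U \<union> T = topspace \<tau>" "disjnt U T"
      "quasi_component_of_set \<tau> a \<subseteq> U" "topspace \<tau> - V0 \<subseteq> T"
    unfolding separated_between_def by blast
  have "U = topspace \<tau> - T" using UT openin_subset[OF UT(1)] by (auto simp: disjnt_def)
  then have "closedin \<tau> U" using UT by blast
  moreover have "a \<in> U" using UT(5) aG quasi_component_of_refl by fastforce
  moreover have "U \<subseteq> V0" using UT openin_subset[OF UT(1)] by (auto simp: disjnt_def)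
  ultimately show ?thesis using UT(1) by blast
qed

lemma finite_index:
  assumes H: "subgroup H G" "openin \<tau> H"
  shows "finite (rcosets H)"
proof -
  have open_cosets: "\<And>c. c \<in> rcosets H \<Longrightarrow> openin \<tau> c"
    using openin_r_coset[OF H] by (auto simp: RCOSETS_def)
  have "compactin \<tau> (carrier G)" using compact topspace_eq by (simp add: compact_space_def)
  then obtain \<F> where \<F>: "finite \<F>" "\<F> \<subseteq> rcosets H" "carrier G \<subseteq> \<Union>\<F>"
    using open_cosets rcosets_part_G[OF H(1)] unfolding compactin_def by (metis order_refl)
  have "rcosets H \<subseteq> \<F>"
  proof
    fix c assume c: "c \<in> rcosets H"
    then obtain a where a: "a \<in> carrier G" "c = H #> a" by (auto simp: RCOSETS_def)
    then obtain d where d: "d \<in> \<F>" "a \<in> d" using \<F>(3) by blast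
    have "a \<in> c" using a rcos_self[OF _ H(1)] by blast
    moreover have "d \<in> rcosets H" using d \<F>(2) by blast
    ultimately have "c = d"
      using rcos_disjoint[OF H(1)] c d by (auto simp: pairwise_def disjnt_def)
    then show "c \<in> \<F>" using d by simp
  qed
  then show ?thesis using \<F>(1) finite_subset by blast
qed

text \<open>\<open>U\<close> collects the elements that can be inserted into any product
  \<open>a \<otimes> b\<close> without changing its membership in a clopen \<open>W\<close>. Letting
  both factors vary makes \<open>U\<close> normal, and \<open>a = b = \<one>\<close> places it
  inside \<open>W\<close>.\<close>

lemma open_normal_subgroup:
  assumes V0: "openin \<tau> V0" and "\<one> \<in> V0"
  shows "\<exists>U. U \<lhd> G \<and> openin \<tau> U \<and> U \<subseteq> V0"
proof -
  obtain W where W: "openin \<tau> W" "closedin \<tau> W" "\<one> \<in> W" "W \<subseteq> V0"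
    using clopen_neighbourhood assms by blast
  define U where "U = {g \<in> carrier G. \<forall>a\<in>carrier G. \<forall>b\<in>carrier G. a \<otimes> b \<in> W \<longleftrightarrow> a \<otimes> g \<otimes> b \<in> W}"
  have UD: "a \<otimes> b \<in> W \<longleftrightarrow> a \<otimes> g \<otimes> b \<in> W" if "g \<in> U" "a \<in> carrier G" "b \<in> carrier G" for a b g
    using that unfolding U_def by blast
  have UG: "U \<subseteq> carrier G" unfolding U_def by blast
  have sub: "subgroup U G"
  proof (rule subgroupI)
    show "U \<subseteq> carrier G" by (rule UG)
    have "\<one> \<in> U" unfolding U_def by simp
    then show "U \<noteq> {}" by blast
    show "inv g \<in> U" if g: "g \<in> U" for g
    proof -
      have gG: "g \<in> carrier G" using g UG by blast
      have "a \<otimes> b \<in> W \<longleftrightarrow> a \<otimes> inv g \<otimes> b \<in> W" if "a \<in> carrier G" "b \<in> carrier G" for a b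
        using UD[OF g, of "a \<otimes> inv g" b] that gG by (simp add: m_assoc)
      then show ?thesis using gG unfolding U_def by blast
    qed
    show "g \<otimes> h \<in> U" if g: "g \<in> U" and h: "h \<in> U" for g h
    proof -
      have gG: "g \<in> carrier G" "h \<in> carrier G" using g h UG by auto
      have "a \<otimes> b \<in> W \<longleftrightarrow> a \<otimes> (g \<otimes> h) \<otimes> b \<in> W" if "a \<in> carrier G" "b \<in> carrier G" for a b
        using UD[OF h, of "a \<otimes> g" b] UD[OF g, of a b] that gG by (simp add: m_assoc)
      then show ?thesis using gG unfolding U_def by blast
    qed
  qed
  have "U \<lhd> G"
  proof (rule normal_invI[OF sub])
    fix x g assume x: "x \<in> carrier G" and g: "g \<in> U"
    have gG: "g \<in> carrier G" using g UG by blast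
    have "a \<otimes> b \<in> W \<longleftrightarrow> a \<otimes> (x \<otimes> g \<otimes> inv x) \<otimes> b \<in> W"
      if "a \<in> carrier G" "b \<in> carrier G" for a b
    proof -
      have "a \<otimes> x \<otimes> (inv x \<otimes> b) = a \<otimes> b"
        using that x by (simp add: m_assoc) (simp add: m_assoc[symmetric])
      moreover have "a \<otimes> x \<otimes> g \<otimes> (inv x \<otimes> b) = a \<otimes> (x \<otimes> g \<otimes> inv x) \<otimes> b"
        using that x gG by (simp add: m_assoc)
      ultimately show ?thesis using UD[OF g, of "a \<otimes> x" "inv x \<otimes> b"] that x by simp
    qed
    then show "x \<otimes> g \<otimes> inv x \<in> U" using x gG unfolding U_def by blast
  qed
  moreover have "U \<subseteq> W"
  proof
    fix g assume "g \<in> U"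
    then show "g \<in> W" using UD[of g \<one> \<one>] W(3) UG by auto
  qed
  moreover have "openin \<tau> U"
  proof -
    let ?P = "prod_topology (prod_topology \<tau> \<tau>) \<tau>"
    have c1: "continuous_map ?P \<tau> (\<lambda>z. fst (fst z) \<otimes> snd (fst z))"
      by (intro continuous_map_mult continuous_map_fst_of continuous_map_snd_of continuous_map_fst
          continuous_map_snd continuous_map_compose[OF continuous_map_fst, unfolded o_def])
    have c2: "continuous_map ?P \<tau> (\<lambda>z. fst (fst z) \<otimes> snd z \<otimes> snd (fst z))"
      by (intro continuous_map_mult continuous_map_fst_of continuous_map_snd_of continuous_map_fst
          continuous_map_snd continuous_map_compose[OF continuous_map_fst, unfolded o_def])
    define V where "V = {z \<in> topspace ?P. fst (fst z) \<otimes> snd (fst z) \<in> W \<longleftrightarrow> fst (fst z) \<otimes> snd z \<otimes> snd (fst z) \<in> W}"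
    have V: "openin ?P V"
      unfolding V_def by (rule openin_clopen_agree[OF c1 c2 W(1,2)])
    \<comment> \<open>Inserting the identity changes nothing, so the whole slice over it lies in the
      open set \<open>V\<close>. As the space of pairs is compact, the tube lemma gives one
      neighbourhood of the identity that works for all pairs at once.\<close>
    have "topspace (prod_topology \<tau> \<tau>) \<times> {\<one>} \<subseteq> V"
      unfolding V_def by (auto simp: topspace_eq)
    moreover have "compactin (prod_topology \<tau> \<tau>) (topspace (prod_topology \<tau> \<tau>))"
      using compact by (metis compact_space_def compact_space_prod_topology)
    ultimately obtain A B where AB: "openin \<tau> B" "topspace (prod_topology \<tau> \<tau>) \<subseteq> A" "\<one> \<in> B" "A \<times> B \<subseteq> V"
      using tube_lemma_left[OF V] topspace_eq by (metis one_closed)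
    have "B \<subseteq> U"
    proof
      fix g assume g: "g \<in> B"
      then have "((a, b), g) \<in> V" if "a \<in> carrier G" "b \<in> carrier G" for a b
        using that g AB(2,4) by (auto simp: topspace_eq)
      then show "g \<in> U" using openin_subset[OF AB(1)] g unfolding U_def V_def by (auto simp: topspace_eq)
    qed
    then show ?thesis using subgroup_openinI[OF sub AB(1,3)] by blast
  qed
  ultimately show ?thesis using W(4) by blast
qed

text \<open>Choose an open normal \<open>U\<close> with \<open>x U\<close> disjoint from
  \<open>S\<close>; then \<open>S U\<close> is an open subgroup that misses
  \<open>x\<close>.\<close>

lemma closed_subgroup_separation:
  assumes S: "subgroup S G" "closedin \<tau> S" and x: "x \<in> carrier G" "x \<notin> S"
  shows "\<exists>Y. subgroup Y G \<and> openin \<tau> Y \<and> S \<subseteq> Y \<and> x \<notin> Y"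
proof -
  define V0 where "V0 = {u \<in> carrier G. x \<otimes> u \<in> carrier G - S}"
  have "openin \<tau> (carrier G - S)" using S(2) topspace_eq by (metis closedin_def)
  then have "openin \<tau> V0" unfolding V0_def using x by (intro openin_preimage group_continuous)
  moreover have "\<one> \<in> V0" unfolding V0_def using x by simp
  ultimately obtain U where U: "U \<lhd> G" "openin \<tau> U" "U \<subseteq> V0"
    using open_normal_subgroup by blast
  interpret U: normal U G by (rule U(1))
  have Y: "subgroup (S <#> U) G"
    using mult_norm_subgroup[OF U(1) S(1)] commut_normal[OF S(1) U(1)] by simp
  have "U \<subseteq> S <#> U"
  proof
    fix u assume u: "u \<in> U"
    then have "u = \<one> \<otimes> u" by simp
    then show "u \<in> S <#> U"
      using u subgroup.one_closed[OF S(1)] unfolding set_mult_def by blast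
  qed
  moreover have "S \<subseteq> S <#> U"
  proof
    fix s assume s: "s \<in> S"
    then have "s = s \<otimes> \<one>" using subgroup.mem_carrier[OF S(1)] by simp
    then show "s \<in> S <#> U" using s U.one_closed unfolding set_mult_def by blast
  qed
  moreover have "x \<notin> S <#> U"
  proof
    assume "x \<in> S <#> U"
    then obtain y u where yu: "y \<in> S" "u \<in> U" "x = y \<otimes> u" by (auto simp: set_mult_def)
    moreover from this have "y \<in> carrier G" "u \<in> carrier G"
      using subgroup.subset[OF S(1)] by auto
    ultimately have "x \<otimes> inv u = y" by (simp add: m_assoc)
    moreover have "inv u \<in> V0" using yu U by blast
    ultimately show False using yu unfolding V0_def by simp
  qed
  ultimately show ?thesis
    using Y openin_subgroup_superset[OF U.is_subgroup U(2) Y] by blast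
qed

end

section \<open>Procyclic subgroups\<close>

context topological_group
begin

definition pcyc :: "'a \<Rightarrow> 'a set"
  where "pcyc x = \<tau> closure_of (range (\<lambda>i::int. x [^] i))"

lemma subgroup_range_int_pow:
  assumes x: "x \<in> carrier G"
  shows "subgroup (range (\<lambda>i::int. x [^] i)) G"
proof (rule subgroupI)
  show "inv a \<in> range (\<lambda>i::int. x [^] i)" if "a \<in> range (\<lambda>i::int. x [^] i)" for a
    using that x by (auto simp: int_pow_neg[symmetric])
  show "a \<otimes> b \<in> range (\<lambda>i::int. x [^] i)"
    if "a \<in> range (\<lambda>i::int. x [^] i)" "b \<in> range (\<lambda>i::int. x [^] i)" for a b
    using that x by (auto simp: int_pow_mult[symmetric])
qed (use x in auto)

lemma subgroup_pcyc: "x \<in> carrier G \<Longrightarrow> subgroup (pcyc x) G"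
  unfolding pcyc_def by (intro subgroup_closure_of subgroup_range_int_pow)

lemma closedin_pcyc: "closedin \<tau> (pcyc x)"
  unfolding pcyc_def by simp

lemma pcyc_subset_carrier: "pcyc x \<subseteq> carrier G"
  using closedin_subset[OF closedin_pcyc] by (simp add: topspace_eq)

lemma pcyc_mem_carrier: "c \<in> pcyc x \<Longrightarrow> c \<in> carrier G"
  using pcyc_subset_carrier by blast

lemma int_pow_mem_pcyc: "x \<in> carrier G \<Longrightarrow> x [^] (i::int) \<in> pcyc x"
  unfolding pcyc_def
  by (rule closure_of_subset[THEN subsetD]) (auto simp: topspace_eq)

lemma nat_pow_mem_pcyc: "x \<in> carrier G \<Longrightarrow> x [^] (n::nat) \<in> pcyc x"
  by (metis int_pow_int int_pow_mem_pcyc)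

lemma mem_pcyc_self: "x \<in> carrier G \<Longrightarrow> x \<in> pcyc x"
  using int_pow_mem_pcyc[of x 1] by simp

text \<open>\<open>S\<close> is only required to be closed, not to be a subgroup, so that it can be
  an equalizer or a finite union of cosets.\<close>

lemma pcyc_induct:
  assumes "closedin \<tau> S" "\<And>i::int. x [^] i \<in> S"
  shows "pcyc x \<subseteq> S"
  unfolding pcyc_def using assms by (intro closure_of_minimal) auto

lemma pcyc_least:
  assumes "subgroup H G" "closedin \<tau> H" "x \<in> H"
  shows "pcyc x \<subseteq> H"
  using assms by (intro pcyc_induct subgroup_int_pow_closed)

lemma pcyc_mono: "y \<in> carrier G \<Longrightarrow> x \<in> pcyc y \<Longrightarrow> pcyc x \<subseteq> pcyc y"
  by (intro pcyc_least subgroup_pcyc closedin_pcyc)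

end

section \<open>Powers and cosets in procyclic subgroups of a profinite group\<close>

context profinite_group
begin

lemma closedin_equalizer:
  assumes "continuous_map \<tau> \<tau> f" "continuous_map \<tau> \<tau> g"
  shows "closedin \<tau> {x \<in> carrier G. f x = g x}"
  using closedin_continuous_maps_eq[OF Hausdorff assms] by (simp add: topspace_eq)

lemma commuting_powers:
  assumes "x \<in> carrier G" "y \<in> carrier G" "x \<otimes> y = y \<otimes> x"
  shows "x \<otimes> y [^] (i::int) = y [^] i \<otimes> x"
proof -
  have c: "x \<otimes> y [^] n = y [^] n \<otimes> x" for n :: nat
    using group_commutes_pow[of y x n] assms by simp
  have d: "x \<otimes> inv (y [^] n) = inv (y [^] n) \<otimes> x" for n :: nat
  proof -
    have a: "y [^] n \<in> carrier G" using assms by simp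
    have "x \<otimes> inv (y [^] n) = inv (y [^] n) \<otimes> (y [^] n \<otimes> x) \<otimes> inv (y [^] n)"
      using assms a by (simp add: m_assoc[symmetric])
    also have "y [^] n \<otimes> x = x \<otimes> y [^] n" by (rule c[symmetric])
    also have "inv (y [^] n) \<otimes> (x \<otimes> y [^] n) \<otimes> inv (y [^] n) = inv (y [^] n) \<otimes> x"
      using assms a by (simp add: m_assoc)
    finally show ?thesis .
  qed
  show ?thesis unfolding int_pow_def2 by (cases "i < 0") (simp_all only: c d if_True if_False not_False_eq_True)
qed

lemma commute_pcyc:
  assumes "x \<in> carrier G" "y \<in> carrier G" "x \<otimes> y = y \<otimes> x" and "c \<in> pcyc y"
  shows "x \<otimes> c = c \<otimes> x"
proof -
  have "closedin \<tau> {c \<in> carrier G. x \<otimes> c = c \<otimes> x}"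
    using assms by (intro closedin_equalizer group_continuous)
  then have "pcyc y \<subseteq> {c \<in> carrier G. x \<otimes> c = c \<otimes> x}"
    using assms commuting_powers by (intro pcyc_induct) auto
  then show ?thesis using assms by blast
qed

lemma pcyc_commute:
  assumes "x \<in> carrier G" "c \<in> pcyc x" "d \<in> pcyc x"
  shows "c \<otimes> d = d \<otimes> c"
proof (rule commute_pcyc[of c x d])
  have "x \<otimes> c = c \<otimes> x"
    using assms by (intro commute_pcyc[of x x c]) auto
  then show "c \<otimes> x = x \<otimes> c" by simp
qed (use assms pcyc_mem_carrier in auto)

text \<open>The power map is a continuous endomorphism of the abelian group \<open>pcyc x\<close>,
  so its image is a closed subgroup by compactness. For the other inclusion, having the
  \<open>n\<close>-th power in a closed set is a closed condition, checked on the powers of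
  \<open>x\<close>.\<close>

lemma pcyc_nat_pow:
  assumes x: "x \<in> carrier G"
  shows "pcyc (x [^] (n::nat)) = (\<lambda>c. c [^] n) ` pcyc x"
proof
  let ?S = "(\<lambda>c. c [^] n) ` pcyc x"
  note sub = subgroup_pcyc[OF x]
  have "continuous_map \<tau> \<tau> (\<lambda>c. c [^] n)" by (intro group_continuous)
  then have cl: "closedin \<tau> ?S" by (intro closedin_image closedin_pcyc)
  show "pcyc (x [^] n) \<subseteq> ?S"
  proof (rule pcyc_least[OF _ cl])
    show "subgroup ?S G"
    proof (rule subgroupI)
      show "?S \<subseteq> carrier G" using pcyc_mem_carrier by auto
      show "?S \<noteq> {}" using mem_pcyc_self[OF x] by blast
      show "inv a \<in> ?S" if a: "a \<in> ?S" for a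
      proof -
        obtain c where c: "c \<in> pcyc x" "a = c [^] n" using a by blast
        then have "inv a = (inv c) [^] n" using pcyc_mem_carrier nat_pow_inv by metis
        then show ?thesis using c subgroup.m_inv_closed[OF sub] by blast
      qed
      show "a \<otimes> b \<in> ?S" if ab: "a \<in> ?S" "b \<in> ?S" for a b
      proof -
        obtain c d where cd: "c \<in> pcyc x" "a = c [^] n" "d \<in> pcyc x" "b = d [^] n"
          using ab by blast
        then have "a \<otimes> b = (c \<otimes> d) [^] n"
          using pow_mult_distrib[of c d n] pcyc_commute[OF x] pcyc_mem_carrier by metis
        then show ?thesis using cd subgroup.m_closed[OF sub] by blast
      qed
    qed
    show "x [^] n \<in> ?S" using mem_pcyc_self[OF x] by blast
  qed
  show "?S \<subseteq> pcyc (x [^] n)"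
  proof -
    have "closedin \<tau> {c \<in> carrier G. c [^] n \<in> pcyc (x [^] n)}"
      by (intro closedin_preimage group_continuous closedin_pcyc)
    moreover have "(x [^] i) [^] n = (x [^] n) [^] i" for i :: int
      using x int_pow_pow[of x i "int n"] int_pow_pow[of x "int n" i]
      by (simp add: int_pow_int mult.commute)
    ultimately have "pcyc x \<subseteq> {c \<in> carrier G. c [^] n \<in> pcyc (x [^] n)}"
      using x by (intro pcyc_induct) (auto intro: int_pow_mem_pcyc)
    then show ?thesis by blast
  qed
qed

lemma pcyc_nat_pow_mono:
  assumes "x \<in> carrier G" "(a::nat) dvd b"
  shows "pcyc (x [^] b) \<subseteq> pcyc (x [^] a)"
proof -
  obtain k where "b = a * k" using assms by blast
  then have "x [^] b \<in> pcyc (x [^] a)"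
    using nat_pow_mem_pcyc[of "x [^] a" k] assms by (simp add: nat_pow_pow)
  then show ?thesis using assms by (intro pcyc_mono) auto
qed

text \<open>Division with remainder puts each power of \<open>x\<close> into one of finitely many
  closed cosets, and the closure stays in their union. The cosets may coincide, as no index is
  claimed.\<close>

lemma pcyc_cover:
  assumes x: "x \<in> carrier G" and n: "n > 0"
  shows "pcyc x = (\<Union>i<n. pcyc (x [^] n) #> x [^] (i::nat))"
proof
  note sub = subgroup_pcyc[OF nat_pow_closed[OF x, of n]]
  have "closedin \<tau> (\<Union>i<n. pcyc (x [^] n) #> x [^] (i::nat))"
    using x by (intro closedin_Union) (auto intro!: closedin_r_coset subgroup_pcyc closedin_pcyc)
  moreover have "x [^] i \<in> (\<Union>i<n. pcyc (x [^] n) #> x [^] (i::nat))" for i :: int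
  proof -
    define r where "r = nat (i mod int n)"
    have r: "r < n" "int r = i mod int n" unfolding r_def using n by (auto simp: nat_less_iff)
    have "x [^] i = x [^] (int n * (i div int n) + int r)" unfolding r(2) by simp
    also have "\<dots> = (x [^] n) [^] (i div int n) \<otimes> x [^] r"
      using x int_pow_pow[of x "int n" "i div int n"] by (simp add: int_pow_mult int_pow_int)
    finally have "x [^] i \<in> pcyc (x [^] n) #> x [^] r"
      using x int_pow_mem_pcyc[of "x [^] n"] unfolding r_coset_def by auto
    then show ?thesis using r by blast
  qed
  ultimately show "pcyc x \<subseteq> (\<Union>i<n. pcyc (x [^] n) #> x [^] (i::nat))"
    by (rule pcyc_induct)
  have "pcyc (x [^] n) \<subseteq> pcyc x"
    using x by (intro pcyc_mono nat_pow_mem_pcyc)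
  then show "(\<Union>i<n. pcyc (x [^] n) #> x [^] (i::nat)) \<subseteq> pcyc x"
    using nat_pow_mem_pcyc[OF x] subgroup.m_closed[OF subgroup_pcyc[OF x]]
    by (auto simp: r_coset_def)
qed

lemma pcyc_coverE:
  assumes "x \<in> carrier G" "n > 0" "c \<in> pcyc x"
  obtains i a where "i < n" "a \<in> pcyc (x [^] n)" "c = a \<otimes> x [^] (i::nat)"
  using assms pcyc_cover[OF assms(1,2)] by (auto simp: r_coset_def)

lemma openin_pcyc_nat_pow:
  assumes x: "x \<in> carrier G" and "openin \<tau> (pcyc x)" and n: "(n::nat) > 0"
  shows "openin \<tau> (pcyc (x [^] n))"
proof (rule closed_subgroup_openin)
  show "pcyc x \<subseteq> (\<Union>r\<in>(\<lambda>i. x [^] i) ` {..<n}. pcyc (x [^] n) #> r)"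
    using pcyc_cover[OF x n] by auto
  show "pcyc (x [^] n) \<subseteq> pcyc x" using x by (intro pcyc_mono nat_pow_mem_pcyc)
qed (use assms in \<open>auto intro: subgroup_pcyc closedin_pcyc\<close>)

text \<open>By compactness the positive powers of \<open>g\<close> come back to every neighbourhood
  of the identity, hence the powers with exponent one less come arbitrarily close to the
  inverse.\<close>

lemma closed_semigroup_subgroup:
  assumes S: "closedin \<tau> S" "S \<noteq> {}" and mult: "\<And>x y. x \<in> S \<Longrightarrow> y \<in> S \<Longrightarrow> x \<otimes> y \<in> S"
  shows "subgroup S G"
proof (rule subgroupI)
  show SG: "S \<subseteq> carrier G" using closedin_subset[OF S(1)] topspace_eq by simp
  fix g assume g: "g \<in> S"
  then have gG: "g \<in> carrier G" using SG by blast
  have pow: "g [^] Suc n \<in> S" for n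
    using g by (induction n) (use gG mult in auto)
  show "inv g \<in> S"
  proof (rule ccontr)
    assume no: "inv g \<notin> S"
    define V where "V = {u \<in> carrier G. inv g \<otimes> u \<in> carrier G - S}"
    have "openin \<tau> (carrier G - S)" using S(1) topspace_eq by (metis closedin_def)
    then have "openin \<tau> V"
      unfolding V_def using gG by (intro openin_preimage group_continuous) auto
    moreover have "\<one> \<in> V" unfolding V_def using no gG by simp
    ultimately obtain U where U: "U \<lhd> G" "openin \<tau> U" "U \<subseteq> V"
      using open_normal_subgroup by blast
    note U_sub = normal_imp_subgroup[OF U(1)]
    obtain n where n: "n > 0" "g [^] (n::nat) \<in> U"
      using finite_rcosets_pow[OF U_sub finite_index[OF U_sub U(2)] gG] by blast
    obtain m where m: "n = Suc m" using n(1) gr0_conv_Suc by blast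
    \<comment> \<open>The exponent is doubled because \<open>n = 1\<close> is possible: then
      \<open>n - 1\<close> would be zero, and only positive powers are known to lie in
      \<open>S\<close>, whereas \<open>2 * n - 1\<close> is always positive.\<close>
    have "g [^] n \<otimes> g [^] n \<in> U" using n(2) U_sub by (simp add: subgroup.m_closed)
    moreover have "inv g \<otimes> (g [^] n \<otimes> g [^] n) = g [^] Suc (m + m)"
    proof -
      have "g [^] n \<otimes> g [^] n = g [^] (n + n)" using gG by (simp add: nat_pow_mult)
      also have "n + n = Suc (Suc (m + m))" using m by simp
      finally have "g [^] n \<otimes> g [^] n = g \<otimes> g [^] Suc (m + m)"
        by (simp only: nat_pow_Suc2[OF gG, of "Suc (m + m)"])
      then show ?thesis using gG by (simp add: m_assoc[symmetric])
    qed
    ultimately show False using pow[of "m + m"] U(3) unfolding V_def by auto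
  qed
qed (use S mult in auto)

end

section \<open>The p-adic integers\<close>

lemma padic_carrier_iff:
  assumes "p > 0"
  shows "x \<in> carrier (padic_int_group p) \<longleftrightarrow>
    (\<forall>n. 0 \<le> x n \<and> x n < int p ^ n) \<and> (\<forall>n. x (Suc n) mod int p ^ n = x n)"
  using assms unfolding padic_int_group_def
  by (auto simp: carrier_integer_mod_group PiE_UNIV_domain)

lemma padic_mult [simp]: "(x \<otimes>\<^bsub>padic_int_group p\<^esub> y) n = (x n + y n) mod int p ^ n"
  by (simp add: padic_int_group_def)

lemma padic_one [simp]: "\<one>\<^bsub>padic_int_group p\<^esub> n = 0"
  by (simp add: padic_int_group_def)

lemma padic_mod:
  assumes "p > 0" "x \<in> carrier (padic_int_group p)" "m \<le> n"
  shows "x n mod int p ^ m = x m"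
  using \<open>m \<le> n\<close>
proof (induction n rule: dec_induct)
  case base
  show ?case using assms padic_carrier_iff[of p x] by simp
next
  case (step k)
  have "x (Suc k) mod int p ^ m = x (Suc k) mod int p ^ k mod int p ^ m"
    using step.hyps by (simp add: mod_mod_cancel le_imp_power_dvd)
  also have "\<dots> = x k mod int p ^ m" using assms padic_carrier_iff[of p x] by simp
  finally show ?case using step by simp
qed

lemma padic_nat_pow:
  assumes "p > 0" "x \<in> carrier (padic_int_group p)"
  shows "(x [^]\<^bsub>padic_int_group p\<^esub> (m::nat)) n = (int m * x n) mod int p ^ n"
  by (induction m) (simp_all add: algebra_simps mod_simps)

lemma group_padic:
  assumes "p > 0"
  shows "group (padic_int_group p)"
proof -
  let ?P = "product_group UNIV (\<lambda>n. integer_mod_group (p ^ n))"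
  interpret P: group ?P by simp
  have "subgroup (carrier (padic_int_group p)) ?P"
  proof (rule P.subgroupI)
    show "carrier (padic_int_group p) \<subseteq> carrier ?P"
      unfolding padic_int_group_def by auto
    have "(\<lambda>n. 0) \<in> carrier (padic_int_group p)"
      using assms by (simp add: padic_carrier_iff)
    then show "carrier (padic_int_group p) \<noteq> {}" by blast
    fix x assume x: "x \<in> carrier (padic_int_group p)"
    then have xP: "x \<in> carrier ?P" unfolding padic_int_group_def by auto
    have c: "x (Suc n) mod int p ^ n = x n" for n using x padic_carrier_iff[OF assms] by blast
    have "(- x (Suc n)) mod int p ^ Suc n mod int p ^ n = (- x n) mod int p ^ n" for n
    proof -
      have "(- x (Suc n)) mod int p ^ Suc n mod int p ^ n = (- x (Suc n)) mod int p ^ n"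
        by (rule mod_mod_cancel) simp
      also have "\<dots> = (- (x (Suc n) mod int p ^ n)) mod int p ^ n" by (simp add: mod_minus_eq)
      finally show ?thesis using c by simp
    qed
    then have "(\<lambda>n. (- x n) mod int p ^ n) \<in> carrier (padic_int_group p)"
      using assms by (simp add: padic_carrier_iff)
    moreover have "inv\<^bsub>?P\<^esub> x = (\<lambda>n. (- x n) mod int p ^ n)"
      using xP by (subst inv_product_group) (auto simp: PiE_UNIV_domain Pi_iff fun_eq_iff)
    ultimately show "inv\<^bsub>?P\<^esub> x \<in> carrier (padic_int_group p)" by simp
    fix y assume y: "y \<in> carrier (padic_int_group p)"
    have d: "y (Suc n) mod int p ^ n = y n" for n using y padic_carrier_iff[OF assms] by blast
    have "(x (Suc n) + y (Suc n)) mod int p ^ Suc n mod int p ^ n = (x n + y n) mod int p ^ n" for n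
    proof -
      have "(x (Suc n) + y (Suc n)) mod int p ^ Suc n mod int p ^ n = (x (Suc n) + y (Suc n)) mod int p ^ n"
        by (rule mod_mod_cancel) simp
      also have "\<dots> = (x (Suc n) mod int p ^ n + y (Suc n) mod int p ^ n) mod int p ^ n"
        by (simp add: mod_add_eq)
      finally show ?thesis using c d by simp
    qed
    then show "x \<otimes>\<^bsub>?P\<^esub> y \<in> carrier (padic_int_group p)"
      using assms by (simp add: padic_carrier_iff)
  qed
  from P.subgroup_imp_group[OF this] show ?thesis
    unfolding padic_int_group_def by simp
qed

lemma topspace_padic: "topspace (padic_int_topology p) = carrier (padic_int_group p)"
  unfolding padic_int_topology_def by (auto simp: padic_int_group_def)

lemma Hausdorff_padic: "Hausdorff_space (padic_int_topology p)"
  unfolding padic_int_topology_def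
  by (intro Hausdorff_space_subtopology) (simp add: Hausdorff_space_product_topology)

text \<open>A basic neighbourhood of \<open>y\<close> restricts finitely many coordinates, and by
  compatibility agreement in one coordinate beyond them forces agreement in all of them.\<close>

lemma padic_closed_mem:
  assumes p: "p > 0" and H: "closedin (padic_int_topology p) H"
    and y: "y \<in> carrier (padic_int_group p)" and app: "\<And>n. \<exists>h\<in>H. h n = y n"
  shows "y \<in> H"
proof (rule ccontr)
  assume "y \<notin> H"
  let ?D = "\<lambda>n. discrete_topology (carrier (integer_mod_group (p ^ n)))"
  let ?C = "carrier (padic_int_group p)"
  have HC: "H \<subseteq> ?C" using closedin_subset[OF H] topspace_padic by simp
  have "openin (padic_int_topology p) (?C - H)" using H topspace_padic by (metis closedin_def)
  then obtain V where V: "openin (product_topology ?D UNIV) V" "?C - H = V \<inter> ?C"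
    unfolding padic_int_topology_def openin_subtopology by blast
  then have "y \<in> V" using y \<open>y \<notin> H\<close> by blast
  then obtain U where U: "finite {i. U i \<noteq> topspace (?D i)}" "y \<in> Pi\<^sub>E UNIV U" "Pi\<^sub>E UNIV U \<subseteq> V"
    using V(1) unfolding openin_product_topology_alt by auto
  obtain n where n: "\<And>i. U i \<noteq> topspace (?D i) \<Longrightarrow> i \<le> n"
    using U(1) finite_nat_set_iff_bounded_le by auto
  obtain h where h: "h \<in> H" "h n = y n" using app by blast
  have hC: "h \<in> ?C" using h HC by blast
  have "h i \<in> U i" for i
  proof (cases "U i = topspace (?D i)")
    case True
    then show ?thesis using hC p by (auto simp: padic_carrier_iff carrier_integer_mod_group)
  next
    case False
    then have "h i = y i"
      using n[OF False] padic_mod[OF p hC] padic_mod[OF p y] h(2) by metis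
    then show ?thesis using U(2) by (auto simp: PiE_UNIV_domain)
  qed
  then have "h \<in> V" using U(3) by (auto simp: PiE_UNIV_domain)
  then show False using V(2) h hC by blast
qed

text \<open>The condition on zeros says that the valuation of \<open>y\<close> is at least that of
  \<open>x\<close>. Hence \<open>y\<close> is an integer multiple of \<open>x\<close> modulo every
  \<open>p ^ n\<close>, and thus lies in the closure of these multiples.\<close>

lemma padic_closed_subgroup_mem:
  assumes p: "Factorial_Ring.prime p"
    and H: "subgroup H (padic_int_group p)" "closedin (padic_int_topology p) H"
    and x: "x \<in> H" and y: "y \<in> carrier (padic_int_group p)"
    and zeros: "\<And>n. x n = 0 \<Longrightarrow> y n = 0"
  shows "y \<in> H"
proof (rule padic_closed_mem[OF _ H(2) y])
  show p0: "p > 0" using p prime_gt_0_nat by blast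
  interpret P: group "padic_int_group p" by (rule group_padic[OF p0])
  have xC: "x \<in> carrier (padic_int_group p)" using H(1) x subgroup.mem_carrier by metis
  have pow: "x [^]\<^bsub>padic_int_group p\<^esub> (m::nat) \<in> H" for m
    using H(1) x by (metis P.subgroup_int_pow_closed int_pow_int)
  fix n
  have pp: "Factorial_Ring.prime (int p)" using p by simp
  have "gcd (x n) (int p ^ n) dvd int p ^ n" by simp
  then obtain j where j: "j \<le> n" "gcd (x n) (int p ^ n) = int p ^ j"
    using divides_primepow[OF pp] by (metis abs_of_nonneg gcd_ge_0_int normalize_int_def normalize_gcd of_nat_0_le_iff of_nat_power normalize_int_def)
  have "x j = 0"
    using padic_mod[OF p0 xC j(1)] j(2) by (metis dvd_imp_mod_0 gcd_dvd1)
  then have "int p ^ j dvd y n"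
    using zeros padic_mod[OF p0 y j(1)] by (simp add: mod_0_imp_dvd)
  then obtain k where k: "y n = int p ^ j * k" by blast
  obtain u v where uv: "u * x n + v * int p ^ n = int p ^ j"
    using bezout_int[of "x n" "int p ^ n"] j(2) by metis
  \<comment> \<open>Multiplying the Bezout identity by \<open>k\<close> gives the multiplier
    \<open>u * k\<close>; it is reduced modulo \<open>p ^ n\<close> to obtain a natural
    number.\<close>
  define m where "m = nat ((u * k) mod int p ^ n)"
  have m: "int m = (u * k) mod int p ^ n" unfolding m_def using p0 by simp
  have "(int m * x n) mod int p ^ n = (u * k * x n) mod int p ^ n"
    unfolding m by (simp add: mod_mult_left_eq)
  also have "u * k * x n = y n + int p ^ n * (- v * k)"
    unfolding k uv[symmetric] by (simp add: algebra_simps)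
  also have "(y n + int p ^ n * (- v * k)) mod int p ^ n = y n mod int p ^ n"
    by (rule mod_mult_self2)
  also have "\<dots> = y n" using padic_mod[OF p0 y, of n n] by simp
  finally have "(x [^]\<^bsub>padic_int_group p\<^esub> m) n = y n"
    using padic_nat_pow[OF p0 xC] by simp
  then show "\<exists>h\<in>H. h n = y n" using pow by blast
qed

lemma padic_zeros_initial:
  assumes "p > 0" "x \<in> carrier (padic_int_group p)" "x n = 0" "m \<le> n"
  shows "x m = 0"
  using padic_mod[OF assms(1,2,4)] assms(3) by simp

text \<open>The zero coordinates of a p-adic integer form an initial segment, so of any two elements
  one vanishes wherever the other does.\<close>

lemma padic_closed_subgroups_chain:
  assumes p: "Factorial_Ring.prime p"
    and L: "subgroup L (padic_int_group p)" "closedin (padic_int_topology p) L"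
    and M: "subgroup M (padic_int_group p)" "closedin (padic_int_topology p) M"
  shows "L \<subseteq> M \<or> M \<subseteq> L"
proof (rule ccontr)
  assume "\<not> ?thesis"
  then obtain x y where xy: "x \<in> L" "x \<notin> M" "y \<in> M" "y \<notin> L" by blast
  have p0: "p > 0" using p prime_gt_0_nat by blast
  have xC: "x \<in> carrier (padic_int_group p)" using L(1) xy subgroup.mem_carrier by metis
  have yC: "y \<in> carrier (padic_int_group p)" using M(1) xy subgroup.mem_carrier by metis
  obtain n where "x n = 0" "y n \<noteq> 0"
    using padic_closed_subgroup_mem[OF p L xy(1) yC] xy by blast
  moreover obtain m where "y m = 0" "x m \<noteq> 0"
    using padic_closed_subgroup_mem[OF p M xy(3) xC] xy by blast
  ultimately show False
    using padic_zeros_initial[OF p0 xC] padic_zeros_initial[OF p0 yC] nat_le_linear by metis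
qed

text \<open>Multiplication by an integer prime to \<open>p\<close> creates no new zero
  coordinates.\<close>

lemma padic_unit_pow_mem:
  assumes p: "Factorial_Ring.prime p"
    and H: "subgroup H (padic_int_group p)" "closedin (padic_int_topology p) H"
    and x: "x \<in> carrier (padic_int_group p)"
    and e: "x [^]\<^bsub>padic_int_group p\<^esub> (e::nat) \<in> H" "\<not> p dvd e"
  shows "x \<in> H"
proof (rule padic_closed_subgroup_mem[OF p H e(1) x])
  have p0: "p > 0" using p prime_gt_0_nat by blast
  fix n
  assume "(x [^]\<^bsub>padic_int_group p\<^esub> e) n = 0"
  then have "int p ^ n dvd int e * x n" using padic_nat_pow[OF p0 x] by auto
  moreover have "coprime (int p ^ n) (int e)"
    using p e(2) by (simp add: prime_imp_coprime)
  ultimately have "int p ^ n dvd x n" using coprime_dvd_mult_right_iff by blast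
  then show "x n = 0" using padic_mod[OF p0 x, of n n] by simp
qed

section \<open>Closed subgroups of a copy of the p-adic integers\<close>

context profinite_group
begin

context
  fixes K p
  assumes K: "subgroup K G" "closedin \<tau> K" and p: "Factorial_Ring.prime p"
    and iso: "topologically_isomorphic (G\<lparr>carrier := K\<rparr>) (subtopology \<tau> K)
                 (padic_int_group p) (padic_int_topology p)"
begin

lemma padic_iso_image:
  obtains f where "\<And>L. subgroup L G \<Longrightarrow> closedin \<tau> L \<Longrightarrow> L \<subseteq> K \<Longrightarrow>
      subgroup (f ` L) (padic_int_group p) \<and> closedin (padic_int_topology p) (f ` L)"
    "inj_on f K" "f ` K = carrier (padic_int_group p)"
    "\<And>k e. k \<in> K \<Longrightarrow> f (k [^] (e::nat)) = f k [^]\<^bsub>padic_int_group p\<^esub> e"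
proof -
  obtain f where f: "f \<in> iso (G\<lparr>carrier := K\<rparr>) (padic_int_group p)"
      "homeomorphic_map (subtopology \<tau> K) (padic_int_topology p) f"
    using iso unfolding topologically_isomorphic_def by blast
  have gK: "group (G\<lparr>carrier := K\<rparr>)" by (rule subgroup_imp_group[OF K(1)])
  have gP: "group (padic_int_group p)" using p group_padic prime_gt_0_nat by blast
  have hom: "f \<in> hom (G\<lparr>carrier := K\<rparr>) (padic_int_group p)" using f(1) by (simp add: iso_def)
  interpret f: group_hom "G\<lparr>carrier := K\<rparr>" "padic_int_group p" f
    using gK gP hom by (simp add: group_hom_def group_hom_axioms_def)
  show thesis
  proof (rule that)
    show "inj_on f K" "f ` K = carrier (padic_int_group p)"
      using f(1) by (auto simp: iso_def bij_betw_def)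
    show "f (k [^] (e::nat)) = f k [^]\<^bsub>padic_int_group p\<^esub> e" if "k \<in> K" for k e
      using f.hom_nat_pow[of k e] that nat_pow_consistent by auto
    fix L assume L: "subgroup L G" "closedin \<tau> L" "L \<subseteq> K"
    have "subgroup L (G\<lparr>carrier := K\<rparr>)" using subgroup_incl[OF L(1) K(1) L(3)] .
    then have "subgroup (f ` L) (padic_int_group p)" by (rule f.subgroup_img_is_subgroup)
    moreover have "closedin (subtopology \<tau> K) L" using L by (simp add: closedin_closed_subtopology K)
    then have "closedin (padic_int_topology p) (f ` L)"
      using homeomorphic_imp_closed_map[OF f(2)] unfolding closed_map_def by blast
    ultimately show "subgroup (f ` L) (padic_int_group p) \<and> closedin (padic_int_topology p) (f ` L)"
      by blast
  qed
qed

lemma padic_iso_chain: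
  assumes "subgroup L G" "closedin \<tau> L" "L \<subseteq> K" "subgroup M G" "closedin \<tau> M" "M \<subseteq> K"
  shows "L \<subseteq> M \<or> M \<subseteq> L"
proof -
  obtain f where f: "\<And>L. subgroup L G \<Longrightarrow> closedin \<tau> L \<Longrightarrow> L \<subseteq> K \<Longrightarrow>
      subgroup (f ` L) (padic_int_group p) \<and> closedin (padic_int_topology p) (f ` L)"
    "inj_on f K"
    using padic_iso_image by metis
  have "f ` L \<subseteq> f ` M \<or> f ` M \<subseteq> f ` L"
    using f(1)[OF assms(1-3)] f(1)[OF assms(4-6)] padic_closed_subgroups_chain[OF p] by blast
  then show ?thesis using f(2) assms by (metis inj_on_image_subset_iff)
qed

lemma padic_iso_unit_pow:
  assumes "subgroup L G" "closedin \<tau> L" "L \<subseteq> K" "k \<in> K" "k [^] (e::nat) \<in> L" "\<not> p dvd e"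
  shows "k \<in> L"
proof -
  obtain f where f: "\<And>L. subgroup L G \<Longrightarrow> closedin \<tau> L \<Longrightarrow> L \<subseteq> K \<Longrightarrow>
      subgroup (f ` L) (padic_int_group p) \<and> closedin (padic_int_topology p) (f ` L)"
    "inj_on f K" "f ` K = carrier (padic_int_group p)"
    "\<And>k e. k \<in> K \<Longrightarrow> f (k [^] (e::nat)) = f k [^]\<^bsub>padic_int_group p\<^esub> e"
    using padic_iso_image by metis
  have "f k [^]\<^bsub>padic_int_group p\<^esub> e \<in> f ` L" using f(4) assms by (metis imageI)
  then have "f k \<in> f ` L"
    using padic_unit_pow_mem[OF p] f(1)[OF assms(1-3)] f(3) assms by blast
  then show ?thesis using f(2) assms by (metis inj_on_image_mem_iff)
qed

end

end

section \<open>Finite width\<close>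

text \<open>Bounded cardinalities have a maximum that is attained; the empty antichain guarantees
  that there is something to maximize over.\<close>

lemma finite_width_iff:
  "finite_width L \<longleftrightarrow> (\<exists>w. \<forall>A. antichain_in L A \<longrightarrow> finite A \<and> card A \<le> w)"
proof
  assume "\<exists>w. \<forall>A. antichain_in L A \<longrightarrow> finite A \<and> card A \<le> w"
  then obtain w where w: "\<And>A. antichain_in L A \<Longrightarrow> finite A \<and> card A \<le> w" by blast
  have "antichain_in L {}" by (simp add: antichain_in_def)
  then obtain A where "antichain_in L A" "\<And>B. antichain_in L B \<Longrightarrow> card B \<le> card A"
    using ex_has_greatest_nat[of "antichain_in L" "{}" card "Suc w"] w
    by (auto simp: less_Suc_eq_le)
  then show "finite_width L" unfolding finite_width_def has_width_def using w by blast
qed (auto simp: finite_width_def has_width_def)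

lemma antichain_in_subset: "antichain_in L A \<Longrightarrow> B \<subseteq> A \<Longrightarrow> antichain_in L B"
  by (auto simp: antichain_in_def subset_iff)

lemma antichain_in_closed_subgroups_iff:
  "antichain_in (closed_subgroup_lattice G \<tau>) A \<longleftrightarrow>
    (\<forall>H\<in>A. subgroup H G \<and> closedin \<tau> H) \<and> (\<forall>H\<in>A. \<forall>K\<in>A. H \<subseteq> K \<longrightarrow> H = K)"
  unfolding antichain_in_def closed_subgroup_lattice_def by auto

lemma antichain_in_open_subgroups_iff:
  "antichain_in (open_subgroup_lattice G \<tau>) A \<longleftrightarrow>
    (\<forall>H\<in>A. subgroup H G \<and> openin \<tau> H) \<and> (\<forall>H\<in>A. \<forall>K\<in>A. H \<subseteq> K \<longrightarrow> H = K)"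
  unfolding antichain_in_def open_subgroup_lattice_def by auto

context profinite_group
begin

lemma finite_width_closed_imp_open:
  assumes "finite_width (closed_subgroup_lattice G \<tau>)"
  shows "finite_width (open_subgroup_lattice G \<tau>)"
proof -
  have "antichain_in (closed_subgroup_lattice G \<tau>) A" if "antichain_in (open_subgroup_lattice G \<tau>) A" for A
    using that open_subgroup_closedin
    unfolding antichain_in_def closed_subgroup_lattice_def open_subgroup_lattice_def by auto
  then show ?thesis using assms unfolding finite_width_iff by blast
qed

text \<open>A finite antichain of closed subgroups can be fattened to one of open subgroups: for each
  pair of members choose an open overgroup of the second that misses a point of the first.\<close>

lemma closed_antichain_enlarge:
  assumes A: "antichain_in (closed_subgroup_lattice G \<tau>) A" and fin: "finite A"
  shows "\<exists>B. antichain_in (open_subgroup_lattice G \<tau>) B \<and> card B = card A"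
proof -
  note A' = A[unfolded antichain_in_closed_subgroups_iff]
  have A1: "subgroup H G" "closedin \<tau> H" if "H \<in> A" for H
    using A' that by auto
  have A2: "H = K" if "H \<in> A" "K \<in> A" "H \<subseteq> K" for H K
    using A'[THEN conjunct2, rule_format, OF that] .
  have "\<exists>Y. subgroup Y G \<and> openin \<tau> Y \<and> K \<subseteq> Y \<and> \<not> H \<subseteq> Y" if HK: "H \<in> A" "K \<in> A" "H \<noteq> K" for H K
  proof -
    obtain x where x: "x \<in> H" "x \<notin> K" using A2 HK by blast
    then have "x \<in> carrier G" using A1 HK subgroup.mem_carrier by metis
    then show ?thesis using closed_subgroup_separation[OF A1[OF HK(2)]] x by blast
  qed
  then obtain Y where Y: "\<And>H K. H \<in> A \<Longrightarrow> K \<in> A \<Longrightarrow> H \<noteq> K \<Longrightarrow>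
      subgroup (Y H K) G \<and> openin \<tau> (Y H K) \<and> K \<subseteq> Y H K \<and> \<not> H \<subseteq> Y H K"
    by metis
  \<comment> \<open>The finitely many separating overgroups of \<open>K\<close> are intersected,
    which keeps openness. Inserting \<open>carrier G\<close> keeps the family nonempty when
    \<open>K\<close> is the only member of \<open>A\<close>.\<close>
  define Z where "Z K = \<Inter> (insert (carrier G) ((\<lambda>H. Y H K) ` (A - {K})))" for K
  have Z1: "subgroup (Z K) G" if "K \<in> A" for K
    unfolding Z_def by (rule subgroups_Inter) (use Y that subgroup_self in auto)
  have Z2: "openin \<tau> (Z K)" if "K \<in> A" for K
    unfolding Z_def
    using fin Y that openin_topspace[of \<tau>] topspace_eq by (intro openin_Inter) auto
  have Z3: "K \<subseteq> Z K" if "K \<in> A" for K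
    unfolding Z_def using Y that subgroup.subset[OF A1(1)] by auto
  have Z4: "H = K" if "H \<in> A" "K \<in> A" "Z H \<subseteq> Z K" for H K
  proof (rule ccontr)
    assume "H \<noteq> K"
    then have "Z K \<subseteq> Y H K" unfolding Z_def using that by auto
    then have "H \<subseteq> Y H K" using Z3 that by blast
    then show False using Y that \<open>H \<noteq> K\<close> by blast
  qed
  have "antichain_in (open_subgroup_lattice G \<tau>) (Z ` A)"
    unfolding antichain_in_open_subgroups_iff using Z1 Z2 Z4 by blast
  moreover have "card (Z ` A) = card A"
    by (intro card_image inj_onI Z4) simp_all
  ultimately show ?thesis by blast
qed

text \<open>Enlarging to open subgroups works for finite families only, so it is applied to finite
  subsets of \<open>A\<close>: none has \<open>w + 1\<close> elements, which also makes
  \<open>A\<close> finite.\<close>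

lemma finite_width_open_imp_closed:
  assumes "finite_width (open_subgroup_lattice G \<tau>)"
  shows "finite_width (closed_subgroup_lattice G \<tau>)"
proof -
  obtain w where w: "\<And>B. antichain_in (open_subgroup_lattice G \<tau>) B \<Longrightarrow> finite B \<and> card B \<le> w"
    using assms unfolding finite_width_iff by blast
  have "finite A \<and> card A \<le> w" if A: "antichain_in (closed_subgroup_lattice G \<tau>) A" for A
  proof -
    have le: "card B \<le> w" if B: "B \<subseteq> A" "finite B" for B
    proof -
      have "antichain_in (closed_subgroup_lattice G \<tau>) B"
        using antichain_in_subset[OF A B(1)] .
      then obtain D where "antichain_in (open_subgroup_lattice G \<tau>) D" "card D = card B"
        using closed_antichain_enlarge B by blast
      then show ?thesis using w[of D] by simp
    qed
    have "finite A"
    proof (rule ccontr)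
      assume "infinite A"
      then obtain B where "B \<subseteq> A" "finite B" "card B = Suc w"
        using infinite_arbitrarily_large by blast
      then show False using le[of B] by simp
    qed
    then show ?thesis using le by blast
  qed
  then show ?thesis unfolding finite_width_iff by blast
qed

text \<open>Only one inclusion is required of the conjugate. For a closed subgroup \<open>C\<close>
  this is already the normalizer, because a nonempty closed set closed under products is a subgroup
  of the compact group.\<close>

definition normalizing :: "'a set \<Rightarrow> 'a set"
  where "normalizing C = {g \<in> carrier G. \<forall>c\<in>C. g \<otimes> c \<otimes> inv g \<in> C}"

lemma subgroup_normalizing:
  assumes C: "subgroup C G" "closedin \<tau> C"
  shows "subgroup (normalizing C) G" and closedin_normalizing: "closedin \<tau> (normalizing C)"
proof -
  have CG: "c \<in> carrier G" if "c \<in> C" for c using that C(1) subgroup.mem_carrier by metis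
  have eq: "normalizing C = carrier G \<inter> (\<Inter>c\<in>C. {g \<in> carrier G. g \<otimes> c \<otimes> inv g \<in> C})"
    unfolding normalizing_def by blast
  have "closedin \<tau> {g \<in> carrier G. g \<otimes> c \<otimes> inv g \<in> C}" if "c \<in> C" for c
    using CG[OF that] by (intro closedin_preimage group_continuous C(2))
  then have "closedin \<tau> (\<Inter>c\<in>C. {g \<in> carrier G. g \<otimes> c \<otimes> inv g \<in> C})"
    using subgroup.one_closed[OF C(1)] by (intro closedin_Inter) auto
  moreover have "closedin \<tau> (carrier G)" using closedin_topspace[of \<tau>] by (simp only: topspace_eq)
  ultimately show cl: "closedin \<tau> (normalizing C)" unfolding eq by (intro closedin_Int)
  show "subgroup (normalizing C) G"
  proof (rule closed_semigroup_subgroup[OF cl])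
    have "\<one> \<in> normalizing C" unfolding normalizing_def using CG by simp
    then show "normalizing C \<noteq> {}" by blast
    fix x y assume xy: "x \<in> normalizing C" "y \<in> normalizing C"
    then have xyG: "x \<in> carrier G" "y \<in> carrier G" unfolding normalizing_def by auto
    have "x \<otimes> y \<otimes> c \<otimes> inv (x \<otimes> y) \<in> C" if c: "c \<in> C" for c
    proof -
      have "x \<otimes> (y \<otimes> c \<otimes> inv y) \<otimes> inv x \<in> C" using xy c unfolding normalizing_def by blast
      moreover have "x \<otimes> (y \<otimes> c \<otimes> inv y) \<otimes> inv x = x \<otimes> y \<otimes> c \<otimes> inv (x \<otimes> y)"
        using xyG CG[OF c] by (simp add: inv_mult_group m_assoc)
      ultimately show ?thesis by simp
    qed
    then show "x \<otimes> y \<in> normalizing C" using xyG unfolding normalizing_def by blast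
  qed
qed

lemma normalizing_conj_mem: "g \<in> normalizing C \<Longrightarrow> c \<in> C \<Longrightarrow> g \<otimes> c \<otimes> inv g \<in> C"
  unfolding normalizing_def by blast

lemma subgroup_set_mult_normalizing:
  assumes C: "subgroup C G" and P: "subgroup P G" "P \<subseteq> normalizing C"
  shows "subgroup (C <#> P) G"
proof (rule subgroupI)
  have CG: "c \<in> carrier G" if "c \<in> C" for c using that C subgroup.mem_carrier by metis
  have PG: "p \<in> carrier G" if "p \<in> P" for p using that P(1) subgroup.mem_carrier by metis
  show "C <#> P \<subseteq> carrier G" using CG PG by (auto simp: set_mult_def)
  show "C <#> P \<noteq> {}"
    using subgroup.one_closed[OF C] subgroup.one_closed[OF P(1)] by (auto simp: set_mult_def)
  show "inv a \<in> C <#> P" if a: "a \<in> C <#> P" for a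
  proof -
    obtain c p where cp: "c \<in> C" "p \<in> P" "a = c \<otimes> p" using a by (auto simp: set_mult_def)
    have ip: "inv p \<in> P" "inv c \<in> C" using cp C P subgroup.m_inv_closed by metis+
    then have "inv p \<otimes> inv c \<otimes> inv (inv p) \<in> C" using P(2) normalizing_conj_mem by blast
    moreover have "inv a = inv p \<otimes> inv c \<otimes> inv (inv p) \<otimes> inv p"
      using cp CG PG by (simp add: inv_mult_group m_assoc)
    ultimately show ?thesis using ip unfolding set_mult_def by blast
  qed
  show "a \<otimes> b \<in> C <#> P" if ab: "a \<in> C <#> P" "b \<in> C <#> P" for a b
  proof -
    obtain c p where cp: "c \<in> C" "p \<in> P" "a = c \<otimes> p" using ab by (auto simp: set_mult_def)
    obtain d r where dr: "d \<in> C" "r \<in> P" "b = d \<otimes> r" using ab by (auto simp: set_mult_def)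
    have "p \<otimes> d \<otimes> inv p \<in> C" using P(2) normalizing_conj_mem cp dr by blast
    then have "c \<otimes> (p \<otimes> d \<otimes> inv p) \<in> C" "p \<otimes> r \<in> P"
      using cp dr C P subgroup.m_closed by metis+
    moreover have "a \<otimes> b = c \<otimes> (p \<otimes> d \<otimes> inv p) \<otimes> (p \<otimes> r)"
    proof -
      have "inv p \<otimes> (p \<otimes> r) = r" using cp dr PG by (simp add: m_assoc[symmetric])
      then show ?thesis using cp dr CG PG by (simp add: m_assoc)
    qed
    ultimately show ?thesis unfolding set_mult_def by blast
  qed
qed

lemma set_mult_supersets:
  assumes C: "subgroup C G" and P: "subgroup P G"
  shows "C \<subseteq> C <#> P" "P \<subseteq> C <#> P"
proof -
  show "C \<subseteq> C <#> P"
  proof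
    fix c assume c: "c \<in> C"
    then have "c = c \<otimes> \<one>" using C subgroup.mem_carrier by force
    then show "c \<in> C <#> P" using c subgroup.one_closed[OF P] unfolding set_mult_def by blast
  qed
  show "P \<subseteq> C <#> P"
  proof
    fix c assume c: "c \<in> P"
    then have "c = \<one> \<otimes> c" using P subgroup.mem_carrier by force
    then show "c \<in> C <#> P" using c subgroup.one_closed[OF C] unfolding set_mult_def by blast
  qed
qed

end

section \<open>First consequences of finite width\<close>

locale finite_width_profinite_group = profinite_group +
  assumes finite_width: "finite_width (closed_subgroup_lattice G \<tau>)"
begin

lemma finite_closed_antichain:
  assumes "\<And>H. H \<in> A \<Longrightarrow> subgroup H G \<and> closedin \<tau> H"
    and "\<And>H K. H \<in> A \<Longrightarrow> K \<in> A \<Longrightarrow> H \<subseteq> K \<Longrightarrow> K \<subseteq> H"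
  shows "finite A"
proof -
  have "antichain_in (closed_subgroup_lattice G \<tau>) A"
    unfolding antichain_in_closed_subgroups_iff using assms by (meson subset_antisym)
  then show ?thesis using finite_width unfolding finite_width_iff by blast
qed

text \<open>Row \<open>n\<close> of the family is an antichain with \<open>n + 1\<close> members, so
  the row indexed by a bound for the width has one member too many.\<close>

lemma no_long_antichains:
  fixes f :: "nat \<Rightarrow> nat \<Rightarrow> 'a set"
  assumes "\<And>n i. i \<le> n \<Longrightarrow> subgroup (f n i) G \<and> closedin \<tau> (f n i)"
    and "\<And>n i j. i \<le> n \<Longrightarrow> j \<le> n \<Longrightarrow> f n i \<subseteq> f n j \<Longrightarrow> i = j"
  shows False
proof -
  obtain w where w: "\<And>A. antichain_in (closed_subgroup_lattice G \<tau>) A \<Longrightarrow> card A \<le> w"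
    using finite_width unfolding finite_width_iff by blast
  have "antichain_in (closed_subgroup_lattice G \<tau>) (f w ` {..w})"
    unfolding antichain_in_closed_subgroups_iff using assms by blast
  then have "card (f w ` {..w}) \<le> w" by (rule w)
  moreover have "card (f w ` {..w}) = card {..w}"
    by (rule card_image) (auto intro!: inj_onI assms(2)[of _ w])
  ultimately show False by simp
qed

text \<open>The subgroups \<open>C <#> pcyc y\<close> with \<open>y\<close> of prime order modulo \<open>C\<close> are pairwise incomparable,
  so there are finitely many of them and the elements of prime order modulo \<open>C\<close> stay away from
  the identity.\<close>

lemma isolating_open_subgroup:
  assumes C: "subgroup C G" "closedin \<tau> C"
  shows "\<exists>N. subgroup N G \<and> openin \<tau> N \<and>
    (\<forall>y\<in>N. \<forall>n>0::nat. y \<in> normalizing C \<longrightarrow> y [^] n \<in> C \<longrightarrow> y \<in> C)"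
proof -
  note nsub = subgroup_normalizing(1)[OF C]
  define S where "S y = C <#> pcyc y" for y
  define Q where "Q = {(y, q::nat). y \<in> normalizing C \<and> y \<notin> C \<and> Factorial_Ring.prime q \<and> y [^] q \<in> C}"
  have QG: "y \<in> carrier G" if "(y, q) \<in> Q" for y q
    using that unfolding Q_def normalizing_def by blast
  have S: "subgroup (S y) G" "closedin \<tau> (S y)" "C \<subseteq> S y" "y \<in> S y" if "(y, q) \<in> Q" for y q
  proof -
    have y: "y \<in> normalizing C" using that unfolding Q_def by blast
    have "pcyc y \<subseteq> normalizing C" by (rule pcyc_least[OF nsub closedin_normalizing[OF C] y])
    then show "subgroup (S y) G"
      unfolding S_def by (intro subgroup_set_mult_normalizing C subgroup_pcyc QG[OF that])
    show "closedin \<tau> (S y)" unfolding S_def by (intro closedin_set_mult C closedin_pcyc)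
    show "C \<subseteq> S y" "y \<in> S y"
      unfolding S_def
      using set_mult_supersets[OF C(1) subgroup_pcyc[OF QG[OF that]]] mem_pcyc_self[OF QG[OF that]]
      by blast+
  qed
  \<comment> \<open>Since \<open>pcyc (y [^] q)\<close> lies in \<open>C\<close>, the cosets of
    \<open>C\<close> by \<open>y [^] i\<close> with \<open>i < q\<close> cover \<open>S y\<close>,
    and an element outside \<open>C\<close> needs a nonzero \<open>i\<close>.\<close>
  have elem: "\<exists>i. 0 < i \<and> i < q \<and> z \<in> C #> y [^] i" if el: "(y, q) \<in> Q" "z \<in> S y" "z \<notin> C" for y q z
  proof -
    have yG: "y \<in> carrier G" using QG el by blast
    have q: "q > 0" "y [^] q \<in> C" using el unfolding Q_def by (auto simp: prime_gt_0_nat)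
    obtain c d where cd: "c \<in> C" "d \<in> pcyc y" "z = c \<otimes> d"
      using el(2) unfolding S_def set_mult_def by blast
    obtain i a where ia: "i < q" "a \<in> pcyc (y [^] q)" "d = a \<otimes> y [^] i"
      using pcyc_coverE[OF yG q(1) cd(2)] by blast
    have a: "a \<in> C" using pcyc_least[OF C q(2)] ia(2) by blast
    have ca: "c \<otimes> a \<in> C" using cd a C subgroup.m_closed by metis
    have z: "z = c \<otimes> a \<otimes> y [^] i"
      using cd ia a yG subgroup.mem_carrier[OF C(1)] by (simp add: m_assoc)
    have "i \<noteq> 0"
    proof
      assume "i = 0"
      then have "z = c \<otimes> a" using z ca subgroup.mem_carrier[OF C(1)] by simp
      then show False using ca el by simp
    qed
    then show ?thesis using ia z ca unfolding r_coset_def by blast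
  qed
  \<comment> \<open>Conversely \<open>0 < i < q\<close> makes \<open>i\<close> prime to
    \<open>q\<close>, so \<open>y\<close> is recovered from its powers of exponents \<open>i\<close>
    and \<open>q\<close>. Together with \<open>elem\<close> this shows that no closed subgroup lies
    strictly between \<open>C\<close> and \<open>S y\<close>, whence the incomparability.\<close>
  have gen: "y \<in> H" if el: "(y, q) \<in> Q" "subgroup H G" "C \<subseteq> H" "z \<in> H" "0 < i" "i < q" "z \<in> C #> y [^] i"
    for y q z i H
  proof -
    have yG: "y \<in> carrier G" using QG el by blast
    obtain c where c: "c \<in> C" "z = c \<otimes> y [^] i" using el(7) unfolding r_coset_def by blast
    have cG: "c \<in> carrier G" using c C subgroup.mem_carrier by metis
    have "inv c \<otimes> z \<in> H" using c el(2-4) by (meson subgroup.m_closed subgroup.m_inv_closed subsetD)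
    moreover have "inv c \<otimes> z = y [^] i" using c cG yG by (simp add: m_assoc[symmetric])
    ultimately have "y [^] i \<in> H" by simp
    moreover have q: "y [^] q \<in> H" "Factorial_Ring.prime q" using el unfolding Q_def by auto
    moreover have "\<not> q dvd i" using el(5,6) by (simp add: nat_dvd_not_less)
    then have "coprime i q" using prime_imp_coprime[OF q(2)] by (simp add: coprime_commute)
    ultimately show ?thesis using coprime_nat_pow_mem[OF el(2) yG] by blast
  qed
  have "finite ((\<lambda>(y, q). S y) ` Q)"
  proof (rule finite_closed_antichain)
    show "subgroup H G \<and> closedin \<tau> H" if "H \<in> (\<lambda>(y, q). S y) ` Q" for H
      using that S by auto
    fix H K assume "H \<in> (\<lambda>(y, q). S y) ` Q" "K \<in> (\<lambda>(y, q). S y) ` Q" and HK: "H \<subseteq> K"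
    then obtain y q y' q' where y: "(y, q) \<in> Q" "H = S y" and y': "(y', q') \<in> Q" "K = S y'"
      by auto
    have "y \<notin> C" using y unfolding Q_def by blast
    moreover have "y \<in> S y'" using S(4)[OF y(1)] HK y y' by blast
    ultimately obtain i where "0 < i" "i < q'" "y \<in> C #> y' [^] i" using elem[OF y'(1)] by blast
    then have "y' \<in> S y" using gen[OF y'(1) S(1)[OF y(1)] S(3)[OF y(1)] S(4)[OF y(1)]] by blast
    then have "pcyc y' \<subseteq> S y" using pcyc_least S[OF y(1)] by blast
    then show "K \<subseteq> H"
      unfolding y y' S_def[of y'] set_mult_def
      using S(1,3)[OF y(1)] by (auto intro: subgroup.m_closed)
  qed
  then obtain R where R: "R \<subseteq> Q" "finite R" "(\<lambda>(y, q). S y) ` Q = (\<lambda>(y, q). S y) ` R"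
    by (metis finite_subset_image subset_refl)
  \<comment> \<open>The nontrivial cosets of \<open>C\<close> in the finitely many groups
    \<open>S y\<close>. Their union contains every element of prime order modulo \<open>C\<close>,
    is closed, and misses the identity, so the open normal subgroup \<open>N\<close> can avoid
    it.\<close>
  define E where "E = (\<Union>(y, q)\<in>R. \<Union>i\<in>{1..<q}. C #> y [^] i)"
  have Ecl: "closedin \<tau> E"
    unfolding E_def using R(1,2) QG
    by (intro closedin_Union) (auto intro!: closedin_Union closedin_r_coset C)
  have "\<one> \<notin> E"
  proof
    assume "\<one> \<in> E"
    then obtain y q i where yqR: "(y, q) \<in> R" "i \<in> {1..<q}" "\<one> \<in> C #> y [^] i"
      unfolding E_def by blast
    then have yq: "(y, q) \<in> Q" "0 < i" "i < q" "\<one> \<in> C #> y [^] i" using R(1) by auto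
    then have "y \<in> C" using gen[OF yq(1) C(1) _ _ yq(2-4)] subgroup.one_closed[OF C(1)] by blast
    then show False using yq unfolding Q_def by blast
  qed
  moreover have "openin \<tau> (carrier G - E)" using Ecl topspace_eq by (metis openin_diff openin_topspace)
  ultimately obtain N where N: "N \<lhd> G" "openin \<tau> N" "N \<subseteq> carrier G - E"
    using open_normal_subgroup[of "carrier G - E"] by auto
  have NG: "subgroup N G" by (rule normal_imp_subgroup[OF N(1)])
  have prime_step: "y \<in> C" if y: "y \<in> N" "y \<in> normalizing C" "Factorial_Ring.prime (q::nat)" "y [^] q \<in> C" for y q
  proof (rule ccontr)
    assume "y \<notin> C"
    then have yQ: "(y, q) \<in> Q" using y unfolding Q_def by blast
    then have "S y \<in> (\<lambda>(y, q). S y) ` R" using R(3) by (metis (no_types, lifting) case_prod_conv imageI)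
    then obtain y' q' where y': "(y', q') \<in> R" "S y = S y'" by auto
    have "y \<in> S y'" using S(4)[OF yQ] y' by simp
    then obtain i where "0 < i" "i < q'" "y \<in> C #> y' [^] i"
      using elem[of y' q' y] y' R(1) \<open>y \<notin> C\<close> by blast
    then have "y \<in> E" unfolding E_def using y'(1) by (auto intro!: bexI[of _ "(y', q')"] bexI[of _ i])
    then show False using N(3) y(1) by blast
  qed
  \<comment> \<open>One prime is split off at a time: for \<open>n = k * q\<close> the prime case
    applies to \<open>y [^] k\<close>, which stays in \<open>N\<close> and in the normalizer, and
    the exponent drops to \<open>k\<close>.\<close>
  have "y \<in> C" if "n > 0" "y \<in> N" "y \<in> normalizing C" "y [^] n \<in> C" for y and n :: nat
    using that
  proof (induction n arbitrary: y rule: less_induct)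
    case (less n)
    have yG: "y \<in> carrier G" using less.prems NG subgroup.mem_carrier by metis
    show ?case
    proof (cases "n = 1")
      case True
      then show ?thesis using less.prems yG by simp
    next
      case False
      then obtain q where q: "Factorial_Ring.prime q" "q dvd n" using prime_factor_nat by blast
      then obtain k where k: "n = k * q" by (metis dvd_def mult.commute)
      have pow: "y [^] k \<in> N" "y [^] k \<in> normalizing C"
        using less.prems NG nsub by (metis subgroup_int_pow_closed int_pow_int)+
      have "(y [^] k) [^] q \<in> C" using less.prems k yG by (simp add: nat_pow_pow)
      then have "y [^] k \<in> C" using prime_step[OF pow q(1)] by blast
      moreover have "k < n" "k > 0" using k less.prems prime_gt_1_nat[OF q(1)] by auto
      ultimately show ?thesis using less.IH less.prems by blast
    qed
  qed
  then show ?thesis using NG N(2) by blast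
qed

end

context finite_width_profinite_group
begin

text \<open>Cosets of the normalizer correspond to conjugates of \<open>C\<close>. These are
  pairwise incomparable, hence finite in number by the width hypothesis.\<close>

lemma finite_index_normalizing:
  assumes C: "subgroup C G" "closedin \<tau> C"
  shows "finite (rcosets (normalizing C))" and openin_normalizing: "openin \<tau> (normalizing C)"
proof -
  note nsub = subgroup_normalizing(1)[OF C]
  have CG: "c \<in> carrier G" if "c \<in> C" for c using that C(1) subgroup.mem_carrier by metis
  \<comment> \<open>\<open>f g\<close> is the conjugate of \<open>C\<close> by \<open>inv g\<close>,
    written as a preimage so that it is visibly closed.\<close>
  define f where "f g = {c \<in> carrier G. g \<otimes> c \<otimes> inv g \<in> C}" for g
  have stab: "h \<otimes> inv g \<in> normalizing C" if gh: "g \<in> carrier G" "h \<in> carrier G" "f g \<subseteq> f h" for g h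
  proof -
    have "h \<otimes> inv g \<otimes> c \<otimes> inv (h \<otimes> inv g) \<in> C" if c: "c \<in> C" for c
    proof -
      have "g \<otimes> (inv g \<otimes> c \<otimes> g) \<otimes> inv g = c"
      proof -
        have "g \<otimes> (inv g \<otimes> c \<otimes> g) \<otimes> inv g = (g \<otimes> inv g) \<otimes> c \<otimes> (g \<otimes> inv g)"
          using gh CG[OF c] by (simp only: m_assoc m_closed inv_closed)
        then show ?thesis using gh CG[OF c] by simp
      qed
      then have "inv g \<otimes> c \<otimes> g \<in> f g" unfolding f_def using gh CG[OF c] c by simp
      then have "h \<otimes> (inv g \<otimes> c \<otimes> g) \<otimes> inv h \<in> C" using gh(3) unfolding f_def by blast
      moreover have "h \<otimes> (inv g \<otimes> c \<otimes> g) \<otimes> inv h = h \<otimes> inv g \<otimes> c \<otimes> inv (h \<otimes> inv g)"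
        using gh CG[OF c] by (simp add: m_assoc inv_mult_group)
      ultimately show ?thesis by simp
    qed
    then show ?thesis unfolding normalizing_def using gh by simp
  qed
  have "finite (f ` carrier G)"
  proof (rule finite_closed_antichain)
    fix H assume "H \<in> f ` carrier G"
    then obtain g where g: "g \<in> carrier G" "H = f g" by blast
    have "closedin \<tau> (f g)"
      unfolding f_def using g by (intro closedin_preimage group_continuous C inv_closed)
    moreover have "subgroup (f g) G"
    proof (rule subgroupI)
      show "f g \<subseteq> carrier G" unfolding f_def by blast
      have "\<one> \<in> f g" unfolding f_def using g subgroup.one_closed[OF C(1)] by simp
      then show "f g \<noteq> {}" by blast
      show "inv c \<in> f g" if c: "c \<in> f g" for c
      proof -
        have cG: "c \<in> carrier G" using c unfolding f_def by blast
        have "inv (g \<otimes> c \<otimes> inv g) \<in> C"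
          using c C unfolding f_def by (auto intro: subgroup.m_inv_closed)
        moreover have "inv (g \<otimes> c \<otimes> inv g) = g \<otimes> inv c \<otimes> inv g"
          using g cG by (simp add: inv_mult_group m_assoc)
        ultimately show ?thesis unfolding f_def using cG by simp
      qed
      show "c \<otimes> d \<in> f g" if c: "c \<in> f g" and d: "d \<in> f g" for c d
      proof -
        have G: "c \<in> carrier G" "d \<in> carrier G" using c d unfolding f_def by auto
        have "(g \<otimes> c \<otimes> inv g) \<otimes> (g \<otimes> d \<otimes> inv g) \<in> C"
          using c d C unfolding f_def by (auto intro: subgroup.m_closed)
        moreover have "inv g \<otimes> (g \<otimes> (d \<otimes> inv g)) = d \<otimes> inv g"
          using g G by (simp add: m_assoc[symmetric])
        then have "(g \<otimes> c \<otimes> inv g) \<otimes> (g \<otimes> d \<otimes> inv g) = g \<otimes> (c \<otimes> d) \<otimes> inv g"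
          using g G by (simp add: m_assoc)
        ultimately show ?thesis unfolding f_def using G by simp
      qed
    qed
    ultimately show "subgroup H G \<and> closedin \<tau> H" using g by simp
  next
    fix H K assume "H \<in> f ` carrier G" "K \<in> f ` carrier G" and HK: "H \<subseteq> K"
    then obtain g h where g: "g \<in> carrier G" "H = f g" and h: "h \<in> carrier G" "K = f h" by blast
    \<comment> \<open>An inclusion of conjugates puts a quotient of the conjugating elements into
      the normalizer. That is a subgroup, so the inverse quotient belongs to it as well and gives
      the reverse inclusion.\<close>
    have "inv (h \<otimes> inv g) \<in> normalizing C"
      using stab[OF g(1) h(1)] HK g h nsub by (simp add: subgroup.m_inv_closed)
    then have s: "g \<otimes> inv h \<in> normalizing C" using g h by (simp add: inv_mult_group)
    show "K \<subseteq> H"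
    proof
      fix d assume "d \<in> K"
      then have d: "d \<in> carrier G" "h \<otimes> d \<otimes> inv h \<in> C" using h unfolding f_def by auto
      have "g \<otimes> inv h \<otimes> (h \<otimes> d \<otimes> inv h) \<otimes> inv (g \<otimes> inv h) \<in> C"
        using normalizing_conj_mem[OF s d(2)] .
      moreover have "g \<otimes> inv h \<otimes> (h \<otimes> d \<otimes> inv h) \<otimes> inv (g \<otimes> inv h)
          = g \<otimes> (inv h \<otimes> h) \<otimes> d \<otimes> (inv h \<otimes> h) \<otimes> inv g"
        using g h d by (simp only: m_assoc m_closed inv_closed inv_mult_group inv_inv)
      ultimately have "g \<otimes> d \<otimes> inv g \<in> C" using g h d by simp
      then show "d \<in> H" using d g unfolding f_def by blast
    qed
  qed
  then show fin: "finite (rcosets (normalizing C))"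
    by (rule finite_rcosetsI[OF nsub]) (use stab in blast)
  then show "openin \<tau> (normalizing C)"
    by (intro closed_finite_index_openin nsub closedin_normalizing C)
qed

end

section \<open>Generators of copies of the p-adic integers\<close>

context profinite_group
begin

definition torsion_free_pcyc :: "'a \<Rightarrow> bool"
  where "torsion_free_pcyc x \<longleftrightarrow> (\<forall>c\<in>pcyc x. \<forall>n>0::nat. c [^] n = \<one> \<longrightarrow> c = \<one>)"

text \<open>An intrinsic description of the topological generators of copies of the p-adic integers.
  Membership of \<open>x\<close> in \<open>pcyc (x [^] q)\<close> means that every element of
  \<open>pcyc x\<close> is a \<open>q\<close>-th power in it: this must hold for all primes except
  \<open>p\<close>.\<close>

definition padic_generator :: "nat \<Rightarrow> 'a \<Rightarrow> bool"
  where "padic_generator p x \<longleftrightarrow> x \<in> carrier G \<and> Factorial_Ring.prime p \<and> torsion_free_pcyc x \<and>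
    x \<notin> pcyc (x [^] p) \<and> (\<forall>q. Factorial_Ring.prime q \<longrightarrow> q \<noteq> p \<longrightarrow> x \<in> pcyc (x [^] q))"

lemma torsion_free_pow_inj:
  assumes x: "x \<in> carrier G" "torsion_free_pcyc x" and cd: "c \<in> pcyc x" "d \<in> pcyc x"
    and n: "n > 0" "c [^] (n::nat) = d [^] n"
  shows "c = d"
proof -
  note sub = subgroup_pcyc[OF x(1)]
  have G: "c \<in> carrier G" "d \<in> carrier G" using cd pcyc_mem_carrier by auto
  have id: "inv d \<in> pcyc x" using cd sub subgroup.m_inv_closed by metis
  have "(c \<otimes> inv d) [^] n = c [^] n \<otimes> inv d [^] n"
    by (rule pow_mult_distrib) (use pcyc_commute[OF x(1) cd(1) id] G in auto)
  also have "\<dots> = \<one>" using n G by (simp add: nat_pow_inv)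
  finally have "c \<otimes> inv d = \<one>"
    using x(2) n cd id sub subgroup.m_closed unfolding torsion_free_pcyc_def by metis
  then show ?thesis using G by (metis inv_equality inv_inv inv_closed)
qed

text \<open>The elements of \<open>pcyc (x [^] (m * k))\<close> are the \<open>m\<close>-th powers
  from \<open>pcyc (x [^] k)\<close>, and without torsion \<open>m\<close>-th roots in
  \<open>pcyc x\<close> are unique.\<close>

lemma torsion_free_pow_cancel:
  assumes x: "x \<in> carrier G" "torsion_free_pcyc x" and m: "m > 0"
    and mem: "x [^] (m * n :: nat) \<in> pcyc (x [^] (m * k :: nat))"
  shows "x [^] n \<in> pcyc (x [^] k)"
proof -
  have "pcyc (x [^] (m * k)) = (\<lambda>c. c [^] m) ` pcyc (x [^] k)"
    using pcyc_nat_pow[of "x [^] k" m] x by (simp add: nat_pow_pow mult.commute)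
  then obtain c where c: "c \<in> pcyc (x [^] k)" "(x [^] n) [^] m = c [^] m"
    using mem x by (auto simp: nat_pow_pow mult.commute)
  have "pcyc (x [^] k) \<subseteq> pcyc x" using x by (intro pcyc_mono nat_pow_mem_pcyc)
  then have "x [^] n = c"
    using torsion_free_pow_inj[OF x nat_pow_mem_pcyc[OF x(1)] _ m c(2)] c(1) by blast
  then show ?thesis using c by simp
qed

lemma pcyc_pow_mono:
  assumes "x \<in> carrier G" "x [^] (a::nat) \<in> pcyc (x [^] (b::nat))"
  shows "x [^] (a * m) \<in> pcyc (x [^] (b * m))"
proof -
  have "(x [^] a) [^] m \<in> pcyc ((x [^] b) [^] m)"
    using assms pcyc_nat_pow[of "x [^] b" m] by blast
  then show ?thesis using assms(1) by (simp add: nat_pow_pow)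
qed

lemma mem_pcyc_pow_mult:
  assumes x: "x \<in> carrier G" and "x \<in> pcyc (x [^] (a::nat))" "x \<in> pcyc (x [^] (b::nat))"
  shows "x \<in> pcyc (x [^] (a * b))"
proof -
  have "x [^] (1 * b) \<in> pcyc (x [^] (a * b))"
    using pcyc_pow_mono[of x 1 a b] assms by simp
  then have "pcyc (x [^] b) \<subseteq> pcyc (x [^] (a * b))" using x by (intro pcyc_mono) auto
  then show ?thesis using assms by blast
qed

lemma mem_pcyc_pow_primes:
  assumes x: "x \<in> carrier G" and n: "n > 0"
    and "\<And>q. Factorial_Ring.prime q \<Longrightarrow> q dvd n \<Longrightarrow> x \<in> pcyc (x [^] (q::nat))"
  shows "x \<in> pcyc (x [^] n)"
  using n
proof (rule nat_prime_factor_induct)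
  show "x \<in> pcyc (x [^] (1::nat))" using x mem_pcyc_self by simp
qed (use assms mem_pcyc_pow_mult in blast)

lemma pcyc_pow_open_subgroup:
  assumes "x \<in> carrier G" "subgroup U G" "openin \<tau> U"
  shows "\<exists>n>0::nat. pcyc (x [^] n) \<subseteq> U"
  using finite_rcosets_pow[OF assms(2) finite_index[OF assms(2,3)] assms(1)]
    pcyc_least[OF assms(2) open_subgroup_closedin[OF assms(2,3)]] by blast

lemma open_subgroup_avoiding:
  assumes "c \<in> carrier G" "c \<noteq> \<one>"
  shows "\<exists>U. subgroup U G \<and> openin \<tau> U \<and> c \<notin> U"
  using closed_subgroup_separation[of "{\<one>}" c] assms triv_subgroup closedin_finite by auto

section \<open>Valuations, digits and subgroups for a fixed generator\<close>

context
  fixes p x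
  assumes gen: "padic_generator p x"
begin

lemma padic_generatorD:
  shows "x \<in> carrier G" "Factorial_Ring.prime p" "torsion_free_pcyc x" "x \<notin> pcyc (x [^] p)"
    and "Factorial_Ring.prime q \<Longrightarrow> q \<noteq> p \<Longrightarrow> x \<in> pcyc (x [^] q)"
  using gen unfolding padic_generator_def by auto

lemma padic_generator_unit_pow:
  assumes "\<not> p dvd m"
  shows "x \<in> pcyc (x [^] m)"
proof (rule mem_pcyc_pow_primes[OF padic_generatorD(1)])
  show "m > 0" using assms by (cases m) auto
qed (use assms padic_generatorD(5) in blast)

text \<open>Write \<open>a = p ^ j * b\<close> with \<open>b\<close> prime to \<open>p\<close>. If
  \<open>j < k\<close>, cancelling \<open>p ^ j\<close> puts \<open>x [^] b\<close> into
  \<open>pcyc (x [^] p)\<close>, and then \<open>x\<close> itself, against the choice of a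
  generator. In this way divisibility of exponents can be read off from membership.\<close>

lemma padic_generator_dvd:
  assumes "x [^] (a::nat) \<in> pcyc (x [^] (p ^ k))"
  shows "p ^ k dvd a"
proof (cases "a = 0")
  case False
  note xG = padic_generatorD(1)
  have pu: "p \<noteq> 0" "\<not> is_unit p" using padic_generatorD(2) by (auto simp: prime_gt_0_nat)
  obtain b where b: "a = p ^ multiplicity p a * b" "\<not> p dvd b"
    using multiplicity_decompose'[OF False pu(2)] by blast
  show ?thesis
  proof (cases "k \<le> multiplicity p a")
    case True
    then show ?thesis using multiplicity_dvd'[of k p a] by simp
  next
    case lt: False
    define j where "j = multiplicity p a"
    have "p ^ k = p ^ j * p ^ (k - j)" using lt unfolding j_def by (simp add: power_add[symmetric])
    then have "x [^] (p ^ j * b) \<in> pcyc (x [^] (p ^ j * p ^ (k - j)))"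
      using assms b(1) unfolding j_def by metis
    then have "x [^] b \<in> pcyc (x [^] (p ^ (k - j)))"
      using torsion_free_pow_cancel[OF xG padic_generatorD(3), of "p ^ j" b "p ^ (k - j)"] pu by simp
    also have "\<dots> \<subseteq> pcyc (x [^] p)"
      using lt unfolding j_def by (intro pcyc_nat_pow_mono xG) (simp add: dvd_power)
    finally have "x [^] b \<in> pcyc (x [^] p)" .
    moreover have "x [^] p \<in> pcyc (x [^] p)" using xG by (simp add: mem_pcyc_self)
    moreover have "coprime b p"
      using prime_imp_coprime[OF padic_generatorD(2) b(2)] by (simp add: coprime_commute)
    ultimately have "x \<in> pcyc (x [^] p)"
      using coprime_nat_pow_mem[OF subgroup_pcyc xG] xG by blast
    then show ?thesis using padic_generatorD(4) by blast
  qed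
qed simp

text \<open>An open subgroup contains some \<open>pcyc (x [^] n)\<close>, and the factor of
  \<open>n\<close> prime to \<open>p\<close> does not change this group. So the groups generated by
  the \<open>p ^ k\<close>-th powers shrink into every open subgroup.\<close>

lemma padic_generator_Inter:
  assumes "c \<in> carrier G" "\<And>k. c \<in> pcyc (x [^] (p ^ k))"
  shows "c = \<one>"
proof (rule ccontr)
  assume "c \<noteq> \<one>"
  then obtain U where U: "subgroup U G" "openin \<tau> U" "c \<notin> U"
    using open_subgroup_avoiding assms by blast
  note xG = padic_generatorD(1)
  have pu: "\<not> is_unit p" using padic_generatorD(2) by auto
  obtain n where n: "n > 0" "pcyc (x [^] (n::nat)) \<subseteq> U"
    using pcyc_pow_open_subgroup[OF xG U(1,2)] by blast
  have "n \<noteq> 0" using n by simp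
  obtain b where b: "n = p ^ multiplicity p n * b" "\<not> p dvd b"
    using multiplicity_decompose'[OF \<open>n \<noteq> 0\<close> pu] by blast
  have "x [^] (1 * p ^ multiplicity p n) \<in> pcyc (x [^] (b * p ^ multiplicity p n))"
    using pcyc_pow_mono[of x 1 b] padic_generator_unit_pow[OF b(2)] xG by simp
  then have "x [^] (p ^ multiplicity p n) \<in> pcyc (x [^] n)" using b(1) by (simp add: mult.commute)
  then have "pcyc (x [^] (p ^ multiplicity p n)) \<subseteq> pcyc (x [^] n)" using xG by (intro pcyc_mono) auto
  then show False using assms(2) n U by blast
qed

text \<open>The map reads off residues: \<open>r c n\<close> is the exponent below
  \<open>p ^ n\<close> of the power of \<open>x\<close> in the coset of \<open>c\<close> modulo
  \<open>P n\<close>. It exists by \<open>pcyc_cover\<close>, is unique by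
  \<open>padic_generator_dvd\<close>, and the residues determine \<open>c\<close> by
  \<open>padic_generator_Inter\<close>.\<close>

lemma padic_generator_iso:
  "topologically_isomorphic (G\<lparr>carrier := pcyc x\<rparr>) (subtopology \<tau> (pcyc x))
    (padic_int_group p) (padic_int_topology p)"
proof -
  note xG = padic_generatorD(1)
  note sub = subgroup_pcyc[OF xG]
  have p0: "p > 0" using padic_generatorD(2) prime_gt_0_nat by blast
  define P where "P n = pcyc (x [^] (p ^ n))" for n
  have Psub: "subgroup (P n) G" and Pcl: "closedin \<tau> (P n)" for n
    unfolding P_def using xG by (auto intro: subgroup_pcyc closedin_pcyc)
  have Pmono: "P n \<subseteq> P m" if "m \<le> n" for m n
    unfolding P_def using that xG by (intro pcyc_nat_pow_mono le_imp_power_dvd)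
  have Px: "P n \<subseteq> pcyc x" for n
    unfolding P_def using xG by (intro pcyc_mono nat_pow_mem_pcyc)
  have PG: "a \<in> carrier G" if "a \<in> P n" for a n using that Psub subgroup.mem_carrier by metis
  define r where "r c n = (THE a. a < p ^ n \<and> c \<in> P n #> x [^] (a::nat))" for c n
  have unique: "a = b" if ab: "a < p ^ n" "b < p ^ n" "c \<in> P n #> x [^] a" "c \<in> P n #> x [^] b" for a b n c
  proof -
    have le: "a = b" if "a \<le> b" "a < p ^ n" "b < p ^ n" "P n #> x [^] a = P n #> x [^] b" for a b
    proof -
      have "x [^] b \<otimes> inv (x [^] a) \<in> P n"
        using r_coset_eq_iff[OF Psub nat_pow_closed[OF xG] nat_pow_closed[OF xG]] that(4) by blast
      moreover have "x [^] b = x [^] (b - a) \<otimes> x [^] a" using that xG by (simp add: nat_pow_mult)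
      ultimately have "x [^] (b - a) \<in> P n" using xG by (simp add: m_assoc)
      then have "p ^ n dvd b - a" unfolding P_def by (rule padic_generator_dvd)
      then show ?thesis using that by (meson diff_is_0_eq dvd_imp_le le_antisym less_imp_diff_less linorder_not_less not_gr_zero)
    qed
    have "P n #> x [^] a = P n #> x [^] b"
      using ab xG Psub repr_independence by (metis nat_pow_closed)
    then show ?thesis using le[of a b] le[of b a] ab by (metis nat_le_linear)
  qed
  \<comment> \<open>The representing exponent \<open>a\<close> need not be reduced. This one formula
    yields both the compatibility of the residues and their additivity.\<close>
  have r_mod: "r c n = a mod p ^ n" if c: "c \<in> P n #> x [^] (a::nat)" for c n a
  proof -
    obtain h where h: "h \<in> P n" "c = h \<otimes> x [^] a" using c unfolding r_coset_def by blast
    have "x [^] a = x [^] (p ^ n * (a div p ^ n)) \<otimes> x [^] (a mod p ^ n)"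
      using xG by (simp add: nat_pow_mult)
    then have "c = (h \<otimes> x [^] (p ^ n * (a div p ^ n))) \<otimes> x [^] (a mod p ^ n)"
      using h xG PG by (simp add: m_assoc)
    moreover have "h \<otimes> x [^] (p ^ n * (a div p ^ n)) \<in> P n"
    proof -
      have "x [^] (p ^ n * (a div p ^ n)) \<in> P n"
        unfolding P_def using xG nat_pow_mem_pcyc[of "x [^] (p ^ n)"] by (simp add: nat_pow_pow)
      then show ?thesis using h Psub by (simp add: subgroup.m_closed)
    qed
    ultimately have "a mod p ^ n < p ^ n \<and> c \<in> P n #> x [^] (a mod p ^ n)"
      using p0 unfolding r_coset_def by auto
    then show ?thesis unfolding r_def by (intro the_equality) (use unique in blast)+
  qed
  have r_mem: "c \<in> P n #> x [^] r c n \<and> r c n < p ^ n" if c: "c \<in> pcyc x" for c n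
  proof -
    obtain a where a: "a < p ^ n" "c \<in> P n #> x [^] a"
      using pcyc_cover[OF xG, of "p ^ n"] c p0 unfolding P_def by auto
    then show ?thesis using r_mod[OF a(2)] by simp
  qed
  define f where "f c = (\<lambda>n. int (r c n))" for c
  have f_carrier: "f c \<in> carrier (padic_int_group p)" if c: "c \<in> pcyc x" for c
  proof -
    have "r c (Suc n) mod p ^ n = r c n" for n
    proof -
      have "c \<in> P n #> x [^] r c (Suc n)"
        using r_mem[OF c, of "Suc n"] Pmono[of n "Suc n"] unfolding r_coset_def by auto
      then show ?thesis using r_mod by simp
    qed
    then show ?thesis
      unfolding padic_carrier_iff[OF p0] f_def using r_mem[OF c]
      by (metis of_nat_0_le_iff of_nat_less_iff of_nat_power zmod_int)
  qed
  have hom: "f \<in> hom (G\<lparr>carrier := pcyc x\<rparr>) (padic_int_group p)"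
  proof (rule homI)
    show "f c \<in> carrier (padic_int_group p)" if "c \<in> carrier (G\<lparr>carrier := pcyc x\<rparr>)" for c
      using that f_carrier by simp
    fix c d assume "c \<in> carrier (G\<lparr>carrier := pcyc x\<rparr>)" "d \<in> carrier (G\<lparr>carrier := pcyc x\<rparr>)"
    then have cd: "c \<in> pcyc x" "d \<in> pcyc x" by auto
    have "r (c \<otimes> d) n = (r c n + r d n) mod p ^ n" for n
    proof -
      obtain a where a: "a \<in> P n" "c = a \<otimes> x [^] r c n"
        using r_mem[OF cd(1), of n] unfolding r_coset_def by blast
      obtain b where b: "b \<in> P n" "d = b \<otimes> x [^] r d n"
        using r_mem[OF cd(2), of n] unfolding r_coset_def by blast
      have comm: "x [^] r c n \<otimes> b = b \<otimes> x [^] r c n"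
        using pcyc_commute[OF xG nat_pow_mem_pcyc[OF xG]] b Px by blast
      have aG: "a \<in> carrier G" "b \<in> carrier G" using a b PG by auto
      have "c \<otimes> d = a \<otimes> x [^] r c n \<otimes> (b \<otimes> x [^] r d n)"
        using a(2) b(2) by metis
      also have "\<dots> = a \<otimes> (x [^] r c n \<otimes> b) \<otimes> x [^] r d n"
        using aG xG by (simp add: m_assoc)
      also have "\<dots> = (a \<otimes> b) \<otimes> (x [^] r c n \<otimes> x [^] r d n)"
        unfolding comm using aG xG by (simp add: m_assoc)
      also have "\<dots> = (a \<otimes> b) \<otimes> x [^] (r c n + r d n)"
        using xG by (simp add: nat_pow_mult)
      finally have "c \<otimes> d \<in> P n #> x [^] (r c n + r d n)"
        using subgroup.m_closed[OF Psub a(1) b(1)] unfolding r_coset_def by blast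
      then show ?thesis by (rule r_mod)
    qed
    then show "f (c \<otimes>\<^bsub>G\<lparr>carrier := pcyc x\<rparr>\<^esub> d) = f c \<otimes>\<^bsub>padic_int_group p\<^esub> f d"
      unfolding f_def by (intro ext) (simp add: zmod_int)
  qed
  have inj: "inj_on f (pcyc x)"
  proof (rule inj_onI)
    fix c d assume cd: "c \<in> pcyc x" "d \<in> pcyc x" "f c = f d"
    have G: "c \<in> carrier G" "d \<in> carrier G" using cd pcyc_mem_carrier by auto
    have "c \<otimes> inv d \<in> P n" for n
    proof -
      have "r c n = r d n" using cd(3) unfolding f_def by (metis of_nat_eq_iff)
      then have "P n #> c = P n #> d"
        using r_mem[OF cd(1), of n] r_mem[OF cd(2), of n] repr_independence[OF _ _ Psub] xG
        by (metis nat_pow_closed)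
      then show ?thesis using r_coset_eq_iff[OF Psub] G by blast
    qed
    then have "c \<otimes> inv d = \<one>" using padic_generator_Inter G unfolding P_def by simp
    then show "c = d" using G by (metis inv_equality inv_inv inv_closed)
  qed
  have coord: "continuous_map (subtopology \<tau> (pcyc x))
      (discrete_topology (carrier (integer_mod_group (p ^ n)))) (\<lambda>c. f c n)" for n
    unfolding continuous_map_closedin
  proof (intro conjI allI impI)
    have ts: "topspace (subtopology \<tau> (pcyc x)) = pcyc x"
      using pcyc_subset_carrier by (auto simp: topspace_eq)
    show "(\<lambda>c. f c n) \<in> topspace (subtopology \<tau> (pcyc x)) \<rightarrow>
        topspace (discrete_topology (carrier (integer_mod_group (p ^ n))))"
      unfolding ts using r_mem p0 by (auto simp: carrier_integer_mod_group f_def simp flip: of_nat_power)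
    fix V assume "closedin (discrete_topology (carrier (integer_mod_group (p ^ n)))) V"
    have "{c \<in> topspace (subtopology \<tau> (pcyc x)). f c n \<in> V} =
        (\<Union>a\<in>{a. a < p ^ n \<and> int a \<in> V}. P n #> x [^] a)" (is "?l = ?r")
    proof
      show "?l \<subseteq> ?r" unfolding ts using r_mem f_def by auto
      show "?r \<subseteq> ?l"
      proof
        fix c assume "c \<in> ?r"
        then obtain a where a: "a < p ^ n" "int a \<in> V" "c \<in> P n #> x [^] a" by blast
        have "c \<in> pcyc x"
          using a(3) Px nat_pow_mem_pcyc[OF xG] subgroup.m_closed[OF sub] unfolding r_coset_def by blast
        then show "c \<in> ?l" unfolding ts f_def using r_mod[OF a(3)] a by simp
      qed
    qed
    moreover have "closedin \<tau> ?r"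
      using xG by (intro closedin_Union) (auto intro!: closedin_r_coset Psub Pcl)
    moreover have "?r \<subseteq> pcyc x" using calculation(1) ts by blast
    ultimately show "closedin (subtopology \<tau> (pcyc x)) {c \<in> topspace (subtopology \<tau> (pcyc x)). f c n \<in> V}"
      by (simp add: closedin_subset_topspace)
  qed
  have cont: "continuous_map (subtopology \<tau> (pcyc x)) (padic_int_topology p) f"
    unfolding padic_int_topology_def continuous_map_in_subtopology continuous_map_componentwise_UNIV
    using coord f_carrier by auto
  have comp: "compactin (subtopology \<tau> (pcyc x)) (pcyc x)"
    using compactin_closed[OF closedin_pcyc] by (simp add: compactin_subtopology)
  have compsp: "compact_space (subtopology \<tau> (pcyc x))"
    by (simp add: compact_space_subtopology compactin_closed closedin_pcyc)
  have fcl: "closedin (padic_int_topology p) (f ` pcyc x)"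
    using compactin_imp_closedin[OF Hausdorff_padic image_compactin[OF comp cont]] .
  interpret f: group_hom "G\<lparr>carrier := pcyc x\<rparr>" "padic_int_group p" f
    using subgroup_imp_group[OF sub] group_padic[OF p0] hom
    by (simp add: group_hom_def group_hom_axioms_def)
  have fsub: "subgroup (f ` pcyc x) (padic_int_group p)" using f.img_is_subgroup by simp
  have surj: "f ` pcyc x = carrier (padic_int_group p)"
  proof
    show "f ` pcyc x \<subseteq> carrier (padic_int_group p)" using f_carrier by blast
    show "carrier (padic_int_group p) \<subseteq> f ` pcyc x"
    proof
      fix y assume y: "y \<in> carrier (padic_int_group p)"
      \<comment> \<open>The coordinates of \<open>f x\<close> are the residues of 1, which vanish
        only modulo \<open>p ^ 0\<close>. There every p-adic integer vanishes, so the closed image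
        contains all of them.\<close>
      have xx: "f x \<in> f ` pcyc x" using mem_pcyc_self[OF xG] by blast
      show "y \<in> f ` pcyc x"
      proof (rule padic_closed_subgroup_mem[OF padic_generatorD(2) fsub fcl xx y])
        fix n assume z: "f x n = 0"
        have "x \<in> P n #> x [^] (1::nat)"
          using xG rcos_self[OF _ Psub] by simp
        then have "1 mod p ^ n = 0" using r_mod z unfolding f_def by (metis of_nat_eq_0_iff)
        then have "p ^ n = 1" by (metis dvd_1_iff_1 mod_0_imp_dvd One_nat_def)
        then have "n = 0" using prime_gt_1_nat[OF padic_generatorD(2)] by simp
        moreover have "0 \<le> y 0" "y 0 < int p ^ 0" using y padic_carrier_iff[OF p0] by blast+
        ultimately show "y n = 0" by simp
      qed
    qed
  qed
  have "f \<in> iso (G\<lparr>carrier := pcyc x\<rparr>) (padic_int_group p)"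
    unfolding iso_def bij_betw_def using hom inj surj by simp
  moreover have "homeomorphic_map (subtopology \<tau> (pcyc x)) (padic_int_topology p) f"
    using continuous_imp_homeomorphic_map[OF cont compsp Hausdorff_padic] inj surj
      pcyc_subset_carrier topspace_padic
    by (simp add: topspace_eq Int_absorb1)
  ultimately show ?thesis unfolding topologically_isomorphic_def by blast
qed

lemmas padic_generator_chain = padic_iso_chain[OF subgroup_pcyc[OF padic_generatorD(1)] closedin_pcyc
    padic_generatorD(2) padic_generator_iso]

text \<open>Some \<open>pcyc (x [^] (p ^ k))\<close> omits \<open>c\<close>. Closed subgroups of
  \<open>pcyc x\<close> form a chain, so that group is contained in \<open>pcyc c\<close>.\<close>

lemma padic_generator_pow_mem:
  assumes c: "c \<in> pcyc x" "c \<noteq> \<one>"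
  shows "\<exists>m>0::nat. x [^] m \<in> pcyc c"
proof -
  note xG = padic_generatorD(1)
  have p0: "p > 0" using padic_generatorD(2) prime_gt_0_nat by blast
  have cG: "c \<in> carrier G" using c pcyc_mem_carrier by blast
  obtain k where k: "c \<notin> pcyc (x [^] (p ^ k))" using padic_generator_Inter cG c by blast
  have "pcyc c \<subseteq> pcyc (x [^] (p ^ k)) \<or> pcyc (x [^] (p ^ k)) \<subseteq> pcyc c"
    using cG xG c by (intro padic_generator_chain subgroup_pcyc closedin_pcyc pcyc_mono nat_pow_mem_pcyc) auto
  then have "x [^] (p ^ k) \<in> pcyc c" using k mem_pcyc_self[OF cG] mem_pcyc_self[of "x [^] (p ^ k)"] xG by blast
  then show ?thesis using p0 by (intro exI[of _ "p ^ k"]) simp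
qed

end

end

section \<open>Existence of the prime attached to a torsion-free element\<close>

context finite_width_profinite_group
begin

text \<open>If \<open>x\<close> is not a \<open>p\<close>-th and not a \<open>q\<close>-th power in \<open>pcyc x\<close>, then the powers of \<open>x\<close> with
  exponent \<open>p ^ i * q ^ (n - i)\<close> generate an antichain of length \<open>n + 1\<close>.\<close>

lemma padic_generator_exists:
  assumes x: "x \<in> carrier G" "torsion_free_pcyc x" "x \<noteq> \<one>"
  shows "\<exists>p. padic_generator p x"
proof -
  \<comment> \<open>At least one prime \<open>p\<close> must fail: otherwise \<open>x\<close> would
    lie in \<open>pcyc (x [^] n)\<close> for every positive \<open>n\<close>, and one of these
    groups is contained in \<open>U\<close>.\<close>
  obtain U where U: "subgroup U G" "openin \<tau> U" "x \<notin> U" using open_subgroup_avoiding x by blast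
  obtain n where n: "n > 0" "pcyc (x [^] (n::nat)) \<subseteq> U" using pcyc_pow_open_subgroup[OF x(1) U(1,2)] by blast
  then obtain p where p: "Factorial_Ring.prime p" "x \<notin> pcyc (x [^] (p::nat))"
    using mem_pcyc_pow_primes[OF x(1) n(1)] U by blast
  \<comment> \<open>If the exponent of \<open>p\<close> went up, cancelling \<open>p ^ i\<close>
    would leave a power of \<open>x\<close> with exponent prime to \<open>p\<close> inside
    \<open>pcyc (x [^] p)\<close>. The primes are bound afresh because the claim is used twice, with
    their roles exchanged.\<close>
  have key: "i' \<le> i" if "Factorial_Ring.prime p" "Factorial_Ring.prime q" "p \<noteq> q" "x \<notin> pcyc (x [^] p)"
      "x [^] (p ^ i * q ^ j) \<in> pcyc (x [^] (p ^ i' * q ^ j'))" for p q i j i' j' :: nat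
  proof (rule ccontr)
    assume "\<not> i' \<le> i"
    then have "p ^ i * p dvd p ^ i' * q ^ j'"
      by (metis Suc_leI dvd_mult2 le_imp_power_dvd linorder_not_le power_Suc2)
    then have "x [^] (p ^ i * q ^ j) \<in> pcyc (x [^] (p ^ i * p))"
      using that(5) pcyc_nat_pow_mono[OF x(1)] by blast
    then have "x [^] (q ^ j) \<in> pcyc (x [^] p)"
      using torsion_free_pow_cancel[OF x(1,2), of "p ^ i" "q ^ j" p] that(1) prime_gt_0_nat by simp
    moreover have "x [^] p \<in> pcyc (x [^] p)" using x by (simp add: mem_pcyc_self)
    moreover have "coprime (q ^ j) p" using that(1-3) by (simp add: primes_coprime)
    ultimately have "x \<in> pcyc (x [^] p)" using coprime_nat_pow_mem[OF subgroup_pcyc x(1)] x(1) by blast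
    then show False using that(4) by blast
  qed
  have "x \<in> pcyc (x [^] q)" if q: "Factorial_Ring.prime q" "q \<noteq> p" for q
  proof (rule ccontr)
    assume nq: "x \<notin> pcyc (x [^] q)"
    show False
    proof (rule no_long_antichains[of "\<lambda>n i. pcyc (x [^] (p ^ i * q ^ (n - i)))"])
      show "subgroup (pcyc (x [^] (p ^ i * q ^ (n - i)))) G \<and> closedin \<tau> (pcyc (x [^] (p ^ i * q ^ (n - i))))" for n i
        using x by (simp add: subgroup_pcyc closedin_pcyc)
      fix n i j assume ij: "i \<le> n" "j \<le> n" "pcyc (x [^] (p ^ i * q ^ (n - i))) \<subseteq> pcyc (x [^] (p ^ j * q ^ (n - j)))"
      then have mem: "x [^] (p ^ i * q ^ (n - i)) \<in> pcyc (x [^] (p ^ j * q ^ (n - j)))"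
        using mem_pcyc_self[of "x [^] (p ^ i * q ^ (n - i))"] x by blast
      have "j \<le> i" using key[OF p(1) q(1) _ p(2) mem] q by blast
      moreover have "n - j \<le> n - i" using key[OF q(1) p(1) q(2) nq, of "n - i" i "n - j" j] mem
        by (simp add: mult.commute)
      ultimately show "i = j" using ij by simp
    qed
  qed
  then show ?thesis unfolding padic_generator_def using x p by blast
qed

end

section \<open>Semidirect products have finite width\<close>

context profinite_group
begin

text \<open>Two members of an antichain that do not contain \<open>U\<close> and have the same
  intersection with \<open>T\<close> differ only in their intersections with \<open>K\<close>, which
  are comparable. This bounds the antichain by the number of overgroups of \<open>U\<close> plus the
  number of subsets of \<open>T\<close>.\<close>

lemma finite_width_semidirect_padic:
  assumes p: "Factorial_Ring.prime p" and sd: "internal_semidirect_product G \<tau> K T"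
    and iso: "topologically_isomorphic (G\<lparr>carrier := K\<rparr>) (subtopology \<tau> K)
                 (padic_int_group p) (padic_int_topology p)"
    and T: "finite T" "\<not> p dvd card T"
  shows "finite_width (closed_subgroup_lattice G \<tau>)"
proof -
  have K: "subgroup K G" "closedin \<tau> K" and TN: "T \<lhd> G" and Tcl: "closedin \<tau> T"
    and KT: "K <#> T = carrier G"
    using sd unfolding internal_semidirect_product_def by auto
  note Tsub = normal_imp_subgroup[OF TN]
  have KG: "k \<in> carrier G" if "k \<in> K" for k using that K(1) subgroup.mem_carrier by metis
  have TG: "t \<in> carrier G" if "t \<in> T" for t using that Tsub subgroup.mem_carrier by metis
  define U where "U = K \<inter> (carrier G \<inter> (\<Inter>t\<in>T. {k \<in> carrier G. k \<otimes> t = t \<otimes> k}))"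
  have UK: "U \<subseteq> K" unfolding U_def by blast
  have Ucomm: "k \<otimes> t = t \<otimes> k" if "k \<in> U" "t \<in> T" for k t using that unfolding U_def by blast
  have UI: "k \<in> U" if "k \<in> K" "\<And>t. t \<in> T \<Longrightarrow> k \<otimes> t = t \<otimes> k" for k
    using that KG unfolding U_def by blast
  have Ucl: "closedin \<tau> U"
  proof -
    have "closedin \<tau> {k \<in> carrier G. k \<otimes> t = t \<otimes> k}" if "t \<in> T" for t
      using TG[OF that] by (intro closedin_equalizer group_continuous)
    then have "closedin \<tau> (\<Inter>t\<in>T. {k \<in> carrier G. k \<otimes> t = t \<otimes> k})"
      using subgroup.one_closed[OF Tsub] by (intro closedin_Inter) auto
    moreover have "closedin \<tau> (carrier G)" using closedin_topspace[of \<tau>] by (simp only: topspace_eq)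
    ultimately show ?thesis unfolding U_def by (intro closedin_Int K)
  qed
  have Usub: "subgroup U G"
  proof (rule closed_semigroup_subgroup[OF Ucl])
    have "\<one> \<in> U" by (rule UI) (use subgroup.one_closed[OF K(1)] TG in auto)
    then show "U \<noteq> {}" by blast
    fix x y assume xy: "x \<in> U" "y \<in> U"
    show "x \<otimes> y \<in> U"
    proof (rule UI)
      show "x \<otimes> y \<in> K" using xy UK K(1) by (meson subgroup.m_closed subsetD)
      fix t assume t: "t \<in> T"
      have G: "x \<in> carrier G" "y \<in> carrier G" "t \<in> carrier G" using xy UK KG TG t by auto
      have "x \<otimes> y \<otimes> t = x \<otimes> (t \<otimes> y)" using G Ucomm[OF xy(2) t] by (simp add: m_assoc)
      also have "\<dots> = t \<otimes> x \<otimes> y" using G Ucomm[OF xy(1) t] by (simp add: m_assoc[symmetric])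
      finally show "x \<otimes> y \<otimes> t = t \<otimes> (x \<otimes> y)" using G by (simp add: m_assoc)
    qed
  qed
  have Ufin: "finite (rcosets U)"
  proof -
    \<comment> \<open>\<open>F k\<close> is the conjugation action on \<open>T\<close>, restricted
      so that it lives in a finite function space. Elements with the same action differ by an
      element of the centralizer \<open>U\<close>.\<close>
    define F where "F k = restrict (\<lambda>t. inv k \<otimes> t \<otimes> k) T" for k
    have "inv k \<otimes> t \<otimes> k \<in> T" if "k \<in> K" "t \<in> T" for k t
      using TN[unfolded normal_inv_iff] KG[OF that(1)] that(2) by (metis inv_closed inv_inv)
    then have "F ` K \<subseteq> T \<rightarrow>\<^sub>E T" unfolding F_def by auto
    then have "finite (F ` K)" using T(1) finite_PiE finite_subset by metis
    then obtain R where R: "R \<subseteq> K" "finite R" "F ` K = F ` R"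
      by (metis finite_subset_image subset_refl)
    have "rcosets U \<subseteq> (\<lambda>(r, t). U #> (r \<otimes> t)) ` (R \<times> T)"
    proof
      fix c assume "c \<in> rcosets U"
      then obtain g where g: "g \<in> carrier G" "c = U #> g" by (auto simp: RCOSETS_def)
      then obtain k t where kt: "k \<in> K" "t \<in> T" "g = k \<otimes> t" using KT unfolding set_mult_def by blast
      obtain r where r: "r \<in> R" "F k = F r" using R(3) kt(1) by blast
      have rK: "r \<in> K" using r R by blast
      have G: "k \<in> carrier G" "r \<in> carrier G" using kt rK KG by auto
      have U: "k \<otimes> inv r \<in> U"
      proof (rule UI)
        show "k \<otimes> inv r \<in> K" using rK kt K(1) by (meson subgroup.m_closed subgroup.m_inv_closed)
        fix u assume u: "u \<in> T"
        have eq: "inv k \<otimes> u \<otimes> k = inv r \<otimes> u \<otimes> r" using fun_cong[OF r(2), of u] u unfolding F_def by simp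
        have "u \<otimes> (k \<otimes> inv r) = (k \<otimes> inv k) \<otimes> u \<otimes> (k \<otimes> inv r)" using G TG[OF u] by simp
        also have "\<dots> = k \<otimes> (inv k \<otimes> u \<otimes> k) \<otimes> inv r"
          using G TG[OF u] by (simp only: m_assoc m_closed inv_closed)
        also have "\<dots> = k \<otimes> inv r \<otimes> u \<otimes> (r \<otimes> inv r)"
          unfolding eq using G TG[OF u] by (simp only: m_assoc m_closed inv_closed)
        also have "\<dots> = k \<otimes> inv r \<otimes> u" using G TG[OF u] by simp
        finally show "k \<otimes> inv r \<otimes> u = u \<otimes> (k \<otimes> inv r)" by simp
      qed
      have "inv r \<otimes> (r \<otimes> t) = t" using G TG[OF kt(2)] by (simp add: m_assoc[symmetric])
      then have "g = k \<otimes> inv r \<otimes> (r \<otimes> t)" using kt G TG[OF kt(2)] by (simp add: m_assoc)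
      then have "g \<in> U #> (r \<otimes> t)" using U unfolding r_coset_def by blast
      then have "c = U #> (r \<otimes> t)"
        using g(2) repr_independence[OF _ _ Usub, of g "r \<otimes> t"] G TG[OF kt(2)] by simp
      then show "c \<in> (\<lambda>(r, t). U #> (r \<otimes> t)) ` (R \<times> T)" using r(1) kt(2) by blast
    qed
    then show ?thesis using R(2) T(1) by (meson finite_SigmaI finite_surj)
  qed
  \<comment> \<open>As \<open>k\<close> and \<open>t\<close> commute, the power with exponent
    \<open>card T\<close> removes \<open>t\<close>. Because \<open>p\<close> does not divide this
    exponent, \<open>k\<close> is recovered from its power inside
    \<open>H \<inter> K\<close>.\<close>
  have key: "k \<in> H" if H: "subgroup H G" "closedin \<tau> H" and k: "k \<in> U" and h: "k \<otimes> t \<in> H" and t: "t \<in> T" for H k t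
  proof -
    have G: "k \<in> carrier G" "t \<in> carrier G" using k UK KG t TG by auto
    have "(k \<otimes> t) [^] card T = k [^] card T \<otimes> t [^] card T"
      using Ucomm[OF k t] G by (rule pow_mult_distrib)
    also have "\<dots> = k [^] card T" using finite_subgroup_pow_card[OF Tsub T(1) t] G by simp
    finally have "k [^] card T \<in> H" using subgroup_int_pow_closed[OF H(1) h, of "int (card T)"]
      by (simp add: int_pow_int)
    moreover have "k [^] card T \<in> K"
      using subgroup_int_pow_closed[OF K(1), of k "int (card T)"] k UK by (auto simp: int_pow_int)
    ultimately have "k \<in> H \<inter> K"
      using k UK T(2) by (intro padic_iso_unit_pow[OF K p iso, of "H \<inter> K" k "card T"]
          subgroups_Inter_pair closedin_Int H K) auto
    then show ?thesis by blast
  qed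
  have dichotomy: "U \<subseteq> H \<or> H = (H \<inter> K) <#> (H \<inter> T)" if H: "subgroup H G" "closedin \<tau> H" for H
  proof -
    \<comment> \<open>The projection of \<open>H\<close> to \<open>K\<close> along \<open>T\<close>.
      It is comparable with \<open>U\<close> by the chain property, and \<open>key\<close> turns
      projections lying in \<open>U\<close> into elements of \<open>H\<close>; the two directions
      give the two alternatives.\<close>
    let ?L = "K \<inter> (H <#> T)"
    have HT: "subgroup (H <#> T) G"
      using mult_norm_subgroup[OF TN H(1)] commut_normal[OF H(1) TN] by simp
    have L: "subgroup ?L G" "closedin \<tau> ?L"
      using subgroups_Inter_pair[OF K(1) HT] closedin_Int[OF K(2) closedin_set_mult[OF H(2) Tcl]] by auto
    have HG: "h \<in> carrier G" if "h \<in> H" for h using that H(1) subgroup.mem_carrier by metis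
    have Lk: "k \<in> H" if k: "k \<in> ?L" "k \<in> U" for k
    proof -
      obtain h t where ht: "h \<in> H" "t \<in> T" "k = h \<otimes> t" using k(1) unfolding set_mult_def by blast
      have "k \<otimes> inv t \<in> H" using ht HG TG by (simp add: m_assoc)
      moreover have "inv t \<in> T" using ht Tsub subgroup.m_inv_closed by metis
      ultimately show ?thesis by (rule key[OF H k(2)])
    qed
    consider "U \<subseteq> ?L" | "?L \<subseteq> U"
      using padic_iso_chain[OF K p iso Usub Ucl UK L] by blast
    then show ?thesis
    proof cases
      case 1
      then show ?thesis using Lk by blast
    next
      case 2
      have "h \<in> (H \<inter> K) <#> (H \<inter> T)" if h: "h \<in> H" for h
      proof -
        obtain k t where kt: "k \<in> K" "t \<in> T" "h = k \<otimes> t" using KT HG[OF h] unfolding set_mult_def by blast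
        have "k = h \<otimes> inv t" using kt KG TG by (simp add: m_assoc)
        moreover have "inv t \<in> T" using kt Tsub subgroup.m_inv_closed by metis
        ultimately have "k \<in> ?L" using kt(1) h unfolding set_mult_def by blast
        then have kH: "k \<in> H" using Lk 2 by blast
        have "inv k \<otimes> h = t" using kt KG TG by (simp add: m_assoc[symmetric])
        then have "t \<in> H" using kH h H(1) by (metis subgroup.m_closed subgroup.m_inv_closed)
        then show ?thesis using kt kH unfolding set_mult_def by blast
      qed
      moreover have "(H \<inter> K) <#> (H \<inter> T) \<subseteq> H"
        unfolding set_mult_def using subgroup.m_closed[OF H(1)] by blast
      ultimately show ?thesis by blast
    qed
  qed
  let ?O = "{H. subgroup H G \<and> U \<subseteq> H}"
  have Ofin: "finite ?O" by (rule finite_overgroups[OF Usub Ufin])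
  have "finite A \<and> card A \<le> card ?O + card (Pow T)"
    if A: "antichain_in (closed_subgroup_lattice G \<tau>) A" for A
  proof -
    note A' = A[unfolded antichain_in_closed_subgroups_iff]
    have A1: "subgroup H G" "closedin \<tau> H" if "H \<in> A" for H
      using A' that by auto
    have A2: "H = J" if "H \<in> A" "J \<in> A" "H \<subseteq> J" for H J
      using A'[THEN conjunct2, rule_format, OF that] .
    let ?B = "A - ?O"
    have inj: "inj_on (\<lambda>H. H \<inter> T) ?B"
    proof (rule inj_onI)
      fix H J assume HJ: "H \<in> ?B" "J \<in> ?B" "H \<inter> T = J \<inter> T"
      have dH: "H = (H \<inter> K) <#> (H \<inter> T)" using dichotomy[of H] A1[of H] HJ(1) by blast
      have dJ: "J = (J \<inter> K) <#> (J \<inter> T)" using dichotomy[of J] A1[of J] HJ(2) by blast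
      have "H \<inter> K \<subseteq> J \<inter> K \<or> J \<inter> K \<subseteq> H \<inter> K"
        using A1 HJ K by (intro padic_iso_chain[OF K p iso] subgroups_Inter_pair closedin_Int) auto
      then have "H \<subseteq> J \<or> J \<subseteq> H"
        by (metis dH dJ HJ(3) mono_set_mult order_refl)
      then show "H = J" using A2[of H J] A2[of J H] HJ by blast
    qed
    have im: "(\<lambda>H. H \<inter> T) ` ?B \<subseteq> Pow T" by blast
    have finP: "finite (Pow T)" using T(1) by simp
    have B: "finite ?B" "card ?B \<le> card (Pow T)"
      by (rule inj_on_finite[OF inj im finP], rule card_inj_on_le[OF inj im finP])
    have AO: "finite (A \<inter> ?O)" "card (A \<inter> ?O) \<le> card ?O"
      using Ofin by (auto intro: card_mono)
    have eq: "(A \<inter> ?O) \<union> ?B = A" by blast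
    have "finite A" "card A \<le> card (A \<inter> ?O) + card ?B"
      using finite_UnI[OF AO(1) B(1), unfolded eq] card_Un_le[of "A \<inter> ?O" ?B, unfolded eq] .
    then show ?thesis using AO B by linarith
  qed
  then show ?thesis unfolding finite_width_iff by (intro exI allI impI)
qed

end

section \<open>The structure of profinite groups of finite width\<close>

context profinite_group
begin

lemma pcyc_one: "pcyc \<one> = {\<one>}"
proof
  show "pcyc \<one> \<subseteq> {\<one>}" using pcyc_least[OF triv_subgroup] closedin_finite by simp
  show "{\<one>} \<subseteq> pcyc \<one>" using mem_pcyc_self by simp
qed

end

section \<open>From an open procyclic subgroup to the semidirect product\<close>

context finite_width_profinite_group
begin

lemma torsion_free_open_subgroup:
  "\<exists>N. subgroup N G \<and> openin \<tau> N \<and> (\<forall>y\<in>N. \<forall>n>0::nat. y [^] n = \<one> \<longrightarrow> y = \<one>)"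
proof -
  have "closedin \<tau> {\<one>}" by (intro closedin_finite) auto
  moreover have "normalizing {\<one>} = carrier G" unfolding normalizing_def by auto
  ultimately obtain N where N: "subgroup N G" "openin \<tau> N"
      "\<forall>y\<in>N. \<forall>n>0::nat. y \<in> carrier G \<longrightarrow> y [^] n \<in> {\<one>} \<longrightarrow> y \<in> {\<one>}"
    using isolating_open_subgroup[OF triv_subgroup] by auto
  then show ?thesis using subgroup.mem_carrier[OF N(1)] by auto
qed

text \<open>Otherwise the products of \<open>p ^ i\<close>-th powers of \<open>x\<close> and \<open>q ^ (n - i)\<close>-th powers of \<open>y\<close>
  would form an antichain of length \<open>n + 1\<close>.\<close>

lemma padic_generators_intersect:
  assumes x: "padic_generator p x" and y: "padic_generator q y"
    and norm: "y \<in> normalizing (pcyc x)"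
  shows "\<exists>c. c \<in> pcyc x \<and> c \<in> pcyc y \<and> c \<noteq> \<one>"
proof (rule ccontr)
  assume "\<not> ?thesis"
  then have disj: "c = \<one>" if "c \<in> pcyc x" "c \<in> pcyc y" for c using that by blast
  note xG = padic_generatorD(1)[OF x] and yG = padic_generatorD(1)[OF y]
  note sx = subgroup_pcyc[OF xG] and sy = subgroup_pcyc[OF yG]
  have nat_sub: "pcyc (z [^] n) \<subseteq> pcyc z" if "z \<in> carrier G" for z and n :: nat
    using that by (intro pcyc_mono nat_pow_mem_pcyc)
  \<comment> \<open>Conjugation commutes with powers, so \<open>y\<close> normalizes the set of
    \<open>k\<close>-th powers of \<open>pcyc x\<close> too. This makes the products below
    subgroups.\<close>
  have norm_pow: "pcyc (y [^] m) \<subseteq> normalizing (pcyc (x [^] k))" for m k :: nat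
  proof -
    have C: "subgroup (pcyc (x [^] k)) G" "closedin \<tau> (pcyc (x [^] k))"
      using xG by (auto intro: subgroup_pcyc closedin_pcyc)
    have "y \<in> normalizing (pcyc (x [^] k))"
      unfolding normalizing_def
    proof (intro CollectI conjI ballI yG)
      fix d assume "d \<in> pcyc (x [^] k)"
      then obtain c where c: "c \<in> pcyc x" "d = c [^] k" using pcyc_nat_pow[OF xG] by auto
      have "y \<otimes> d \<otimes> inv y = (y \<otimes> c \<otimes> inv y) [^] k"
        using conj_nat_pow[OF yG pcyc_mem_carrier[OF c(1)]] c(2) by simp
      then show "y \<otimes> d \<otimes> inv y \<in> pcyc (x [^] k)"
        using normalizing_conj_mem[OF norm c(1)] pcyc_nat_pow[OF xG] by simp
    qed
    then have "pcyc y \<subseteq> normalizing (pcyc (x [^] k))"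
      using pcyc_least[OF subgroup_normalizing(1)[OF C] closedin_normalizing[OF C]] by blast
    then show ?thesis using nat_sub[OF yG] by blast
  qed
  show False
  proof (rule no_long_antichains[of "\<lambda>n i. pcyc (x [^] (p ^ i)) <#> pcyc (y [^] (q ^ (n - i)))"])
    fix n i :: nat
    show "subgroup (pcyc (x [^] (p ^ i)) <#> pcyc (y [^] (q ^ (n - i)))) G \<and>
        closedin \<tau> (pcyc (x [^] (p ^ i)) <#> pcyc (y [^] (q ^ (n - i))))"
      using xG yG norm_pow
      by (intro conjI subgroup_set_mult_normalizing closedin_set_mult closedin_pcyc subgroup_pcyc) auto
  next
    fix n i j :: nat assume ij: "i \<le> n" "j \<le> n"
      "pcyc (x [^] (p ^ i)) <#> pcyc (y [^] (q ^ (n - i))) \<subseteq> pcyc (x [^] (p ^ j)) <#> pcyc (y [^] (q ^ (n - j)))"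
    note sub = set_mult_supersets[OF subgroup_pcyc[OF nat_pow_closed[OF xG]] subgroup_pcyc[OF nat_pow_closed[OF yG]]]
    have "x [^] (p ^ i) \<in> pcyc (x [^] (p ^ j)) <#> pcyc (y [^] (q ^ (n - j)))"
      using ij(3) sub(1)[of "p ^ i" "q ^ (n - i)"] mem_pcyc_self[OF nat_pow_closed[OF xG]] by blast
    then obtain c d where cd: "c \<in> pcyc (x [^] (p ^ j))" "d \<in> pcyc (y [^] (q ^ (n - j)))"
        "x [^] (p ^ i) = c \<otimes> d"
      unfolding set_mult_def by blast
    have "inv c \<otimes> x [^] (p ^ i) = d"
      using cd pcyc_mem_carrier by (simp add: m_assoc[symmetric])
    moreover have "inv c \<otimes> x [^] (p ^ i) \<in> pcyc x"
      using cd(1) nat_sub[OF xG] nat_pow_mem_pcyc[OF xG] sx by (meson subgroup.m_closed subgroup.m_inv_closed subsetD)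
    \<comment> \<open>\<open>d\<close> lies in both procyclic groups, whose intersection is trivial.
      So membership in the product reduces to the first factor and compares exponents of
      \<open>p\<close>; the same argument for \<open>y\<close> compares those of \<open>q\<close> in
      the opposite direction.\<close>
    ultimately have "d = \<one>" using disj cd(2) nat_sub[OF yG] by blast
    then have "x [^] (p ^ i) \<in> pcyc (x [^] (p ^ j))" using cd pcyc_mem_carrier by simp
    then have "p ^ j dvd p ^ i" using padic_generator_dvd[OF x] by blast
    then have "j \<le> i" using prime_gt_1_nat[OF padic_generatorD(2)[OF x]] by (simp add: power_dvd_imp_le)
    have "y [^] (q ^ (n - i)) \<in> pcyc (x [^] (p ^ j)) <#> pcyc (y [^] (q ^ (n - j)))"
      using ij(3) sub(2)[of "q ^ (n - i)" "p ^ i"] mem_pcyc_self[OF nat_pow_closed[OF yG]] by blast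
    then obtain a b where ab: "a \<in> pcyc (x [^] (p ^ j))" "b \<in> pcyc (y [^] (q ^ (n - j)))"
        "y [^] (q ^ (n - i)) = a \<otimes> b"
      unfolding set_mult_def by blast
    have "y [^] (q ^ (n - i)) \<otimes> inv b = a"
      using ab pcyc_mem_carrier by (simp add: m_assoc)
    moreover have "y [^] (q ^ (n - i)) \<otimes> inv b \<in> pcyc y"
      using ab(2) nat_sub[OF yG] nat_pow_mem_pcyc[OF yG] sy by (meson subgroup.m_closed subgroup.m_inv_closed subsetD)
    ultimately have "a = \<one>" using disj ab(1) nat_sub[OF xG] by blast
    then have "y [^] (q ^ (n - i)) \<in> pcyc (y [^] (q ^ (n - j)))" using ab pcyc_mem_carrier by simp
    then have "q ^ (n - j) dvd q ^ (n - i)" using padic_generator_dvd[OF y] by blast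
    then have "n - j \<le> n - i" using prime_gt_1_nat[OF padic_generatorD(2)[OF y]] by (simp add: power_dvd_imp_le)
    then show "i = j" using \<open>j \<le> i\<close> ij by simp
  qed
qed

text \<open>For a nontrivial \<open>x\<close> in the torsion-free \<open>N\<close>, every element
  normalizing \<open>pcyc x\<close> has a positive power in it. An isolating neighbourhood for
  \<open>pcyc x\<close> then meets its open normalizer only inside \<open>pcyc x\<close>.\<close>

lemma open_padic_generator_exists:
  assumes inf: "infinite (carrier G)"
  shows "\<exists>p x. padic_generator p x \<and> openin \<tau> (pcyc x)"
proof -
  obtain N where N: "subgroup N G" "openin \<tau> N" and tf: "\<And>y n. y \<in> N \<Longrightarrow> n > 0 \<Longrightarrow> y [^] (n::nat) = \<one> \<Longrightarrow> y = \<one>"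
    using torsion_free_open_subgroup by blast
  have NG: "y \<in> carrier G" if "y \<in> N" for y using that N(1) subgroup.mem_carrier by metis
  have Ncl: "closedin \<tau> N" by (rule open_subgroup_closedin[OF N])
  have tfp: "torsion_free_pcyc y" if "y \<in> N" for y
    unfolding torsion_free_pcyc_def using tf pcyc_least[OF N(1) Ncl that] by blast
  have "\<exists>x\<in>N. x \<noteq> \<one>"
  proof (rule ccontr)
    assume "\<not> ?thesis"
    then have "N \<subseteq> {\<one>}" by blast
    obtain R where R: "finite R" "R \<subseteq> carrier G" "carrier G = (\<Union>r\<in>R. N #> r)"
      using finite_rcosets_repr[OF N(1) finite_index[OF N]] by blast
    have "finite (N #> r)" for r
      unfolding r_coset_def using \<open>N \<subseteq> {\<one>}\<close> finite_subset by blast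
    then have "finite (carrier G)" using R by simp
    then show False using inf by blast
  qed
  then obtain x where x: "x \<in> N" "x \<noteq> \<one>" by blast
  obtain p where p: "padic_generator p x"
    using padic_generator_exists[OF NG[OF x(1)] tfp[OF x(1)] x(2)] by blast
  note xG = NG[OF x(1)]
  let ?C = "pcyc x"
  note C = subgroup_pcyc[OF xG] closedin_pcyc[of x]
  obtain M where M: "subgroup M G" "openin \<tau> M"
      "\<And>y n. y \<in> M \<Longrightarrow> n > 0 \<Longrightarrow> y \<in> normalizing ?C \<Longrightarrow> y [^] (n::nat) \<in> ?C \<Longrightarrow> y \<in> ?C"
    using isolating_open_subgroup[OF C] by blast
  have "\<exists>n>0. y [^] (n::nat) \<in> ?C" if y: "y \<in> normalizing ?C" for y
  proof -
    have yG: "y \<in> carrier G" using y unfolding normalizing_def by blast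
    obtain a where a: "a > 0" "y [^] (a::nat) \<in> N"
      using finite_rcosets_pow[OF N(1) finite_index[OF N] yG] by blast
    show ?thesis
    proof (cases "y [^] a = \<one>")
      case True
      then show ?thesis using a subgroup.one_closed[OF C(1)] by metis
    next
      case False
      obtain q where q: "padic_generator q (y [^] a)"
        using padic_generator_exists[OF NG[OF a(2)] tfp[OF a(2)] False] by blast
      have "y [^] a \<in> normalizing ?C"
        using subgroup_int_pow_closed[OF subgroup_normalizing(1)[OF C] y, of "int a"] by (simp add: int_pow_int)
      then obtain c where c: "c \<in> ?C" "c \<in> pcyc (y [^] a)" "c \<noteq> \<one>"
        using padic_generators_intersect[OF p q] by blast
      \<comment> \<open>A common nontrivial element \<open>c\<close> suffices: some power of
        \<open>y [^] a\<close> falls into \<open>pcyc c\<close>, hence into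
        \<open>pcyc x\<close>.\<close>
      obtain m where m: "m > 0" "(y [^] a) [^] (m::nat) \<in> pcyc c"
        using padic_generator_pow_mem[OF q c(2,3)] by blast
      have "y [^] (a * m) \<in> ?C"
        using m(2) pcyc_mono[OF xG c(1)] yG by (auto simp: nat_pow_pow)
      then show ?thesis using a m by (intro exI[of _ "a * m"]) simp
    qed
  qed
  then have sub: "M \<inter> normalizing ?C \<subseteq> ?C" using M(3) by blast
  have "openin \<tau> (M \<inter> normalizing ?C)" using M(2) openin_normalizing[OF C] by blast
  moreover have "\<one> \<in> M \<inter> normalizing ?C"
    using subgroup.one_closed[OF M(1)] subgroup.one_closed[OF subgroup_normalizing(1)[OF C]] by blast
  ultimately have "openin \<tau> ?C" using subgroup_openinI[OF C(1) _ _ sub] by blast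
  then show ?thesis using p by blast
qed

text \<open>\<open>pcyc g\<close> is finite and its normalizer has finite index. Hence some power of
  \<open>x\<close> permutes a finite set by conjugation, and a further power fixes
  \<open>g\<close>.\<close>

lemma power_commutes_torsion:
  assumes x: "x \<in> carrier G" and g: "g \<in> carrier G" "g [^] (k::nat) = \<one>" "k > 0"
  shows "\<exists>m>0::nat. x [^] m \<otimes> g = g \<otimes> x [^] m"
proof -
  note C = subgroup_pcyc[OF g(1)] closedin_pcyc[of g]
  have fin: "finite (pcyc g)"
  proof -
    have "pcyc g = (\<Union>i<k. {\<one>} #> g [^] (i::nat))" using pcyc_cover[OF g(1,3)] g(2) pcyc_one by simp
    then show ?thesis by (simp add: r_coset_def)
  qed
  note N = subgroup_normalizing(1)[OF C]
  obtain a where a: "a > 0" "x [^] (a::nat) \<in> normalizing (pcyc g)"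
    using finite_rcosets_pow[OF N finite_index_normalizing(1)[OF C] x] by blast
  let ?z = "x [^] a"
  have zG: "?z \<in> carrier G" using x by simp
  have "?z [^] n \<otimes> g \<otimes> inv (?z [^] n) \<in> pcyc g" for n :: nat
    using subgroup_int_pow_closed[OF N a(2), of "int n"] mem_pcyc_self[OF g(1)]
    by (intro normalizing_conj_mem) (simp_all add: int_pow_int)
  then have "range (\<lambda>n::nat. ?z [^] n \<otimes> g \<otimes> inv (?z [^] n)) \<subseteq> pcyc g" by blast
  then have "\<not> inj (\<lambda>n::nat. ?z [^] n \<otimes> g \<otimes> inv (?z [^] n))"
    using fin finite_subset finite_imageD by blast
  then obtain i j :: nat where ij: "i < j" "?z [^] i \<otimes> g \<otimes> inv (?z [^] i) = ?z [^] j \<otimes> g \<otimes> inv (?z [^] j)"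
    unfolding inj_def by (metis linorder_neqE_nat)
  let ?w = "?z [^] (j - i)"
  have wG: "?w \<in> carrier G" using zG by simp
  have zj: "?z [^] j = ?z [^] i \<otimes> ?w" using ij(1) zG by (simp add: nat_pow_mult)
  have "g = inv (?z [^] i) \<otimes> (?z [^] i \<otimes> g \<otimes> inv (?z [^] i)) \<otimes> ?z [^] i"
  proof -
    have "inv (?z [^] i) \<otimes> (?z [^] i \<otimes> g \<otimes> inv (?z [^] i)) \<otimes> ?z [^] i =
        (inv (?z [^] i) \<otimes> ?z [^] i) \<otimes> g \<otimes> (inv (?z [^] i) \<otimes> ?z [^] i)"
      using g(1) zG by (simp only: m_assoc m_closed inv_closed nat_pow_closed)
    then show ?thesis using g(1) zG by simp
  qed
  also have "\<dots> = inv (?z [^] i) \<otimes> (?z [^] i \<otimes> ?w \<otimes> g \<otimes> inv (?z [^] i \<otimes> ?w)) \<otimes> ?z [^] i"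
    unfolding ij(2) zj ..
  also have "\<dots> = (inv (?z [^] i) \<otimes> ?z [^] i) \<otimes> ?w \<otimes> g \<otimes> inv ?w \<otimes> (inv (?z [^] i) \<otimes> ?z [^] i)"
    using g(1) zG wG by (simp only: m_assoc m_closed inv_closed nat_pow_closed inv_mult_group)
  also have "\<dots> = ?w \<otimes> g \<otimes> inv ?w" using g(1) zG wG by simp
  finally have "g \<otimes> ?w = ?w \<otimes> g" using g(1) wG by (metis inv_solve_right m_closed)
  moreover have "?w = x [^] (a * (j - i))" using x by (simp add: nat_pow_pow)
  ultimately show ?thesis using a(1) ij(1) by (intro exI[of _ "a * (j - i)"]) simp
qed

text \<open>Some power \<open>g [^] k\<close> lies in \<open>pcyc x\<close>. If it is trivial, the
  torsion case applies; otherwise a power of \<open>x\<close> lies in \<open>pcyc (g [^] k)\<close>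
  and so commutes with \<open>g\<close>. Finite index then allows one exponent for all
  \<open>g\<close>.\<close>

lemma central_power_exists:
  assumes gen: "padic_generator p x" and op: "openin \<tau> (pcyc x)"
  shows "\<exists>m>0::nat. \<forall>g\<in>carrier G. x [^] m \<otimes> g = g \<otimes> x [^] m"
proof -
  note xG = padic_generatorD(1)[OF gen]
  note C = subgroup_pcyc[OF xG]
  have each: "\<exists>m>0::nat. x [^] m \<otimes> g = g \<otimes> x [^] m" if g: "g \<in> carrier G" for g
  proof -
    obtain k where k: "k > 0" "g [^] (k::nat) \<in> pcyc x"
      using finite_rcosets_pow[OF C finite_index[OF C op] g] by blast
    show ?thesis
    proof (cases "g [^] k = \<one>")
      case True
      then show ?thesis using power_commutes_torsion[OF xG g _ k(1)] by blast
    next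
      case False
      then obtain m where m: "m > 0" "x [^] (m::nat) \<in> pcyc (g [^] k)"
        using padic_generator_pow_mem[OF gen k(2)] by blast
      have "x [^] m \<in> pcyc g" using m(2) pcyc_mono[OF g nat_pow_mem_pcyc[OF g]] by blast
      then show ?thesis using m(1) pcyc_commute[OF g _ mem_pcyc_self[OF g]] by blast
    qed
  qed
  then obtain m where m: "\<And>g. g \<in> carrier G \<Longrightarrow> (m g :: nat) > 0 \<and> x [^] m g \<otimes> g = g \<otimes> x [^] m g"
    by metis
  obtain R where R: "finite R" "R \<subseteq> carrier G" "carrier G = (\<Union>r\<in>R. pcyc x #> r)"
    using finite_rcosets_repr[OF C finite_index[OF C op]] by blast
  \<comment> \<open>A common multiple of the exponents of finitely many coset representatives
    suffices, as the remaining factor in \<open>pcyc x\<close> commutes with \<open>x\<close>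
    anyway.\<close>
  define M where "M = (\<Prod>r\<in>R. m r)"
  have xMG: "x [^] M \<in> carrier G" using xG by simp
  have commR: "x [^] M \<otimes> r = r \<otimes> x [^] M" if r: "r \<in> R" for r
  proof -
    have rG: "r \<in> carrier G" using r R by blast
    have "m r dvd M" unfolding M_def using R(1) r by blast
    then obtain b where b: "M = m r * b" by blast
    then have "x [^] M = (x [^] m r) [^] b" using xG by (simp add: nat_pow_pow)
    then show ?thesis using group_commutes_pow[of "x [^] m r" r b] m[OF rG] rG xG by simp
  qed
  have "x [^] M \<otimes> g = g \<otimes> x [^] M" if g: "g \<in> carrier G" for g
  proof -
    obtain r c where rc: "r \<in> R" "c \<in> pcyc x" "g = c \<otimes> r" using g R(3) unfolding r_coset_def by auto
    have G: "c \<in> carrier G" "r \<in> carrier G" using rc R pcyc_mem_carrier by auto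
    have "x [^] M \<otimes> (c \<otimes> r) = c \<otimes> x [^] M \<otimes> r"
      using pcyc_commute[OF xG nat_pow_mem_pcyc[OF xG] rc(2), of M] G xMG by (simp add: m_assoc[symmetric])
    also have "\<dots> = c \<otimes> r \<otimes> x [^] M" using commR[OF rc(1)] G xMG by (simp add: m_assoc)
    finally show ?thesis using rc(3) by simp
  qed
  moreover have "m r > 0" if "r \<in> R" for r using m R(2) that by blast
  then have "M > 0" unfolding M_def by (simp add: prod_pos)
  ultimately show ?thesis by blast
qed

text \<open>If \<open>t\<close> had order \<open>p\<close> and commuted with \<open>v\<close>, the elements \<open>v ^ p ^ k * t\<close> would generate
  pairwise incomparable subgroups.\<close>

lemma padic_generator_no_commuting_torsion:
  assumes v: "padic_generator p v" and t: "t \<in> carrier G" "t [^] p = \<one>" "v \<otimes> t = t \<otimes> v"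
  shows "t = \<one>"
proof (rule ccontr)
  assume "t \<noteq> \<one>"
  note vG = padic_generatorD(1)[OF v] and p = padic_generatorD(2)[OF v]
  have p0: "p > 0" using p prime_gt_0_nat by blast
  define y where "y k = v [^] (p ^ k) \<otimes> t" for k :: nat
  have yG: "y k \<in> carrier G" for k unfolding y_def using vG t by simp
  have comm: "v [^] (n::nat) \<otimes> t = t \<otimes> v [^] n" for n using group_commutes_pow[OF t(3) vG t(1)] .
  have ypow: "y k [^] (i::nat) = v [^] (p ^ k * i) \<otimes> t [^] i" for k i
    unfolding y_def using pow_mult_distrib[OF comm, of "p ^ k"] vG t(1) by (simp add: nat_pow_pow)
  have tors: "c = \<one>" if "c \<in> pcyc v" "c [^] p = \<one>" for c
    using padic_generatorD(3)[OF v] that p0 unfolding torsion_free_pcyc_def by blast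
  have vsub: "pcyc (v [^] (n::nat)) \<subseteq> pcyc v" for n using vG by (intro pcyc_mono nat_pow_mem_pcyc)
  \<comment> \<open>\<open>t\<close> disappears in the \<open>p\<close>-th power of
    \<open>y l\<close>, so \<open>pcyc (y l)\<close> consists of the cosets of
    \<open>pcyc (v [^] (p ^ Suc l))\<close> by powers of \<open>y l\<close> below \<open>p\<close>.
    Comparing the parts in \<open>t\<close> forces the first power.\<close>
  have key: "\<exists>a\<in>pcyc (v [^] (p ^ Suc l)). v [^] (p ^ k) = a \<otimes> v [^] (p ^ l)" if kl: "pcyc (y k) \<subseteq> pcyc (y l)" for k l
  proof -
    have "y l [^] p = v [^] (p ^ Suc l)" using ypow[of l p] t(2) vG by (simp add: mult.commute)
    moreover have "y k \<in> pcyc (y l)" using kl mem_pcyc_self[OF yG] by blast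
    ultimately obtain i a where ia: "i < p" "a \<in> pcyc (v [^] (p ^ Suc l))" "y k = a \<otimes> y l [^] (i::nat)"
      using pcyc_coverE[OF yG p0, of "y k" l] by metis
    have aG: "a \<in> carrier G" using ia pcyc_mem_carrier by blast
    let ?b = "a \<otimes> v [^] (p ^ l * i)"
    have b: "?b \<in> pcyc v"
      using ia(2) vsub nat_pow_mem_pcyc[OF vG] subgroup.m_closed[OF subgroup_pcyc[OF vG]] by blast
    have bG: "?b \<in> carrier G" using aG vG by simp
    have eq: "v [^] (p ^ k) \<otimes> t = ?b \<otimes> t [^] i"
      using ia(3) ypow[of l i] aG vG t(1) unfolding y_def[of k] by (simp add: m_assoc)
    let ?c = "inv ?b \<otimes> v [^] (p ^ k)"
    have c: "?c \<in> pcyc v"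
      using b nat_pow_mem_pcyc[OF vG] subgroup_pcyc[OF vG] by (meson subgroup.m_closed subgroup.m_inv_closed)
    have ct: "?c \<otimes> t = t [^] i"
      using eq bG vG t(1) by (metis inv_closed inv_solve_left m_assoc m_closed nat_pow_closed)
    have cG: "?c \<in> carrier G" using bG vG by simp
    have "?c = t [^] i \<otimes> inv t" using ct cG t(1) by (metis inv_solve_right nat_pow_closed)
    \<comment> \<open>Integer exponents are used because \<open>i\<close> may be zero. The element
      \<open>?c\<close> is now both a power of \<open>t\<close> and in the torsion-free group
      \<open>pcyc v\<close>, hence trivial.\<close>
    also have "\<dots> = t [^] (int i - 1)" using t(1) by (simp add: int_pow_diff int_pow_int)
    finally have ci: "?c = t [^] (int i - 1)" .
    then have "?c [^] p = (t [^] p) [^] (int i - 1)"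
      using t(1) int_pow_pow[of t "int i - 1" "int p"] int_pow_pow[of t "int p" "int i - 1"]
      by (simp add: int_pow_int mult.commute)
    then have c1: "?c = \<one>" using tors[OF c] t(2) by simp
    \<comment> \<open>Otherwise \<open>i - 1\<close> is nonzero and of absolute value below
      \<open>p\<close>, hence prime to \<open>p\<close>, and \<open>t\<close> would be
      trivial.\<close>
    have "i = 1"
    proof (rule ccontr)
      assume "i \<noteq> 1"
      have "coprime (int i - 1) (int p)"
      proof -
        have "\<not> int p dvd int i - 1"
        proof
          assume "int p dvd int i - 1"
          then have "\<bar>int p\<bar> \<le> \<bar>int i - 1\<bar>" using \<open>i \<noteq> 1\<close> by (intro dvd_imp_le_int) auto
          then show False using ia(1) p0 prime_gt_1_nat[OF p] by linarith
        qed
        then show ?thesis using p by (simp add: coprime_commute prime_imp_coprime)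
      qed
      then have "t \<in> {\<one>}"
        using coprime_pow_mem[OF triv_subgroup t(1), of "int i - 1" "int p"] ci c1 t(2)
        by (simp add: int_pow_int)
      then show False using \<open>t \<noteq> \<one>\<close> by blast
    qed
    moreover have "v [^] (p ^ k) = ?b" using c1 bG vG by (metis inv_closed inv_inv inv_equality nat_pow_closed inv_unique' l_inv m_closed)
    ultimately show ?thesis using ia(2) by auto
  qed
  have v_mem: "v [^] (p ^ k) \<in> pcyc (v [^] (p ^ l))" if "l \<le> k" for k l
    using pcyc_nat_pow_mono[OF vG, of "p ^ l" "p ^ k"] that mem_pcyc_self[of "v [^] (p ^ k)"] vG
    by (auto simp: le_imp_power_dvd)
  \<comment> \<open>By \<open>key\<close>, \<open>v [^] (p ^ k)\<close> equals
    \<open>v [^] (p ^ l)\<close> up to a factor of higher valuation, so its valuation is exactly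
    \<open>l\<close>.\<close>
  have eq: "k = l" if kl: "pcyc (y k) \<subseteq> pcyc (y l)" for k l
  proof -
    obtain a where a: "a \<in> pcyc (v [^] (p ^ Suc l))" "v [^] (p ^ k) = a \<otimes> v [^] (p ^ l)"
      using key[OF kl] by blast
    have aG: "a \<in> carrier G" using a pcyc_mem_carrier by blast
    note subl = subgroup_pcyc[OF nat_pow_closed[OF vG]]
    have "a \<in> pcyc (v [^] (p ^ l))" using a(1) pcyc_nat_pow_mono[OF vG, of "p ^ l" "p ^ Suc l"] by auto
    then have "v [^] (p ^ k) \<in> pcyc (v [^] (p ^ l))"
      using a(2) v_mem[of l l] subgroup.m_closed[OF subl] by simp
    then have "p ^ l dvd p ^ k" using padic_generator_dvd[OF v] by blast
    then have "l \<le> k" using prime_gt_1_nat[OF p] by (simp add: power_dvd_imp_le)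
    moreover have "\<not> l < k"
    proof
      assume "l < k"
      then have "v [^] (p ^ k) \<in> pcyc (v [^] (p ^ Suc l))" using v_mem[of "Suc l" k] by simp
      then have "inv a \<otimes> v [^] (p ^ k) \<in> pcyc (v [^] (p ^ Suc l))"
        using a(1) subl by (meson subgroup.m_closed subgroup.m_inv_closed)
      then have "v [^] (p ^ l) \<in> pcyc (v [^] (p ^ Suc l))"
        using a(2) aG vG by (simp add: m_assoc[symmetric])
      then have "p ^ Suc l dvd p ^ l" using padic_generator_dvd[OF v] by blast
      then show False using prime_gt_1_nat[OF p] by (auto dest: power_dvd_imp_le)
    qed
    ultimately show ?thesis by simp
  qed
  show False
    by (rule no_long_antichains[of "\<lambda>n i. pcyc (y i)"]) (use yG subgroup_pcyc closedin_pcyc eq in auto)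
qed

text \<open>Three generators occur, each with a prime obtained on its own: \<open>x\<close> for the
  open procyclic subgroup, \<open>v\<close> for the image of the transfer and \<open>k\<close> for
  the complement. The prime in the conclusion is that of \<open>v\<close>, and the prime of
  \<open>k\<close> is identified with it at the end.\<close>

lemma semidirect_product_exists:
  assumes inf: "infinite (carrier G)"
  shows "\<exists>p::nat. Factorial_Ring.prime p \<and>
     (\<exists>K T. internal_semidirect_product G \<tau> K T \<and>
       topologically_isomorphic (G\<lparr>carrier := K\<rparr>) (subtopology \<tau> K)
         (padic_int_group p) (padic_int_topology p) \<and>
       finite T \<and> \<not> p dvd card T)"
proof -
  obtain r x where x: "padic_generator r x" and op: "openin \<tau> (pcyc x)"
    using open_padic_generator_exists[OF inf] by blast
  note xG = padic_generatorD(1)[OF x]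
  obtain m where m: "m > 0" "\<And>g. g \<in> carrier G \<Longrightarrow> x [^] (m::nat) \<otimes> g = g \<otimes> x [^] m"
    using central_power_exists[OF x op] by blast
  define Z where "Z = pcyc (x [^] m)"
  have Z: "subgroup Z G" "closedin \<tau> Z" "openin \<tau> Z"
    unfolding Z_def using xG m openin_pcyc_nat_pow[OF xG op] by (auto intro: subgroup_pcyc closedin_pcyc)
  have central: "z \<otimes> g = g \<otimes> z" if "z \<in> Z" "g \<in> carrier G" for z g
    using commute_pcyc[of g "x [^] m" z] that m(2)[of g] xG unfolding Z_def by simp
  have Zx: "Z \<subseteq> pcyc x" unfolding Z_def using xG by (intro pcyc_mono nat_pow_mem_pcyc)
  have ZG: "z \<in> carrier G" if "z \<in> Z" for z using that Z(1) subgroup.mem_carrier by metis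
  have tf: "z = \<one>" if "z \<in> Z" "n > 0" "z [^] (n::nat) = \<one>" for z n
    using padic_generatorD(3)[OF x] Zx that unfolding torsion_free_pcyc_def by blast
  have Zfin: "finite (rcosets Z)" by (rule finite_index[OF Z(1,3)])
  define n where "n = card (rcosets Z)"
  have "Z \<in> rcosets Z" using subgroup.one_closed[OF Z(1)] Z(1) by (metis coset_join2 one_closed rcosetsI subgroup.subset)
  then have n0: "n > 0" unfolding n_def using Zfin card_gt_0_iff by blast
  obtain V where VZ: "V \<in> carrier G \<rightarrow> Z"
    and Vmult: "\<And>g h. g \<in> carrier G \<Longrightarrow> h \<in> carrier G \<Longrightarrow> V (g \<otimes> h) = V g \<otimes> V h"
    and Vpow: "\<And>z. z \<in> Z \<Longrightarrow> V z = z [^] n"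
    using central_transfer[OF Z(1) central Zfin] unfolding n_def by blast
  have VG: "V g \<in> carrier G" if "g \<in> carrier G" for g using VZ ZG that by blast
  interpret V: group_hom G G V
    using VG Vmult by unfold_locales (auto simp: hom_def)
  \<comment> \<open>The transfer was built purely algebraically. On the open coset of
    \<open>Z\<close> around \<open>g\<close> it is \<open>V g\<close> times an \<open>n\<close>-th
    power, and so it is continuous there.\<close>
  have Vcont: "continuous_map \<tau> \<tau> V"
    unfolding continuous_map_def
  proof (intro conjI allI impI)
    show "V \<in> topspace \<tau> \<rightarrow> topspace \<tau>" using VG by (auto simp: topspace_eq)
    fix W assume W: "openin \<tau> W"
    have "\<exists>S. openin \<tau> S \<and> g \<in> S \<and> S \<subseteq> {g \<in> topspace \<tau>. V g \<in> W}" if g: "g \<in> {g \<in> topspace \<tau>. V g \<in> W}" for g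
    proof -
      have gG: "g \<in> carrier G" and gW: "V g \<in> W" using g by (auto simp: topspace_eq)
      let ?S = "{h \<in> carrier G. inv g \<otimes> h \<in> Z} \<inter> {h \<in> carrier G. V g \<otimes> (inv g \<otimes> h) [^] n \<in> W}"
      have "openin \<tau> ?S"
        using gG VG[OF gG] by (intro openin_Int openin_preimage group_continuous Z W inv_closed)
      moreover have "g \<in> ?S" using gG gW VG[OF gG] subgroup.one_closed[OF Z(1)] by simp
      moreover have "?S \<subseteq> {g \<in> topspace \<tau>. V g \<in> W}"
      proof
        fix h assume h: "h \<in> ?S"
        then have hG: "h \<in> carrier G" by blast
        have "V h = V (g \<otimes> (inv g \<otimes> h))" using gG hG by (simp add: m_assoc[symmetric])
        also have "\<dots> = V g \<otimes> (inv g \<otimes> h) [^] n" using Vmult[of g "inv g \<otimes> h"] Vpow h gG hG by simp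
        finally show "h \<in> {g \<in> topspace \<tau>. V g \<in> W}" using h hG by (simp add: topspace_eq)
      qed
      ultimately show ?thesis by blast
    qed
    then show "openin \<tau> {g \<in> topspace \<tau>. V g \<in> W}" using openin_subopen by blast
  qed
  define T where "T = kernel G G V"
  have T_iff: "g \<in> T \<longleftrightarrow> g \<in> carrier G \<and> V g = \<one>" for g unfolding T_def kernel_def by blast
  have TN: "T \<lhd> G" unfolding T_def by (rule V.normal_kernel)
  note Tsub = normal_imp_subgroup[OF TN]
  \<comment> \<open>On \<open>Z\<close> the transfer is the \<open>n\<close>-th power, which is
    injective because \<open>Z\<close> is torsion-free. Hence distinct elements of \<open>T\<close>
    lie in distinct cosets of \<open>Z\<close>.\<close>
  have TZ: "z = \<one>" if "z \<in> T" "z \<in> Z" for z using tf[OF that(2) n0] that Vpow T_iff by simp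
  have Tfin: "finite T"
  proof -
    have "inj_on (\<lambda>t. Z #> t) T"
    proof (rule inj_onI)
      fix s t assume st: "s \<in> T" "t \<in> T" "Z #> s = Z #> t"
      then have G: "s \<in> carrier G" "t \<in> carrier G" using T_iff by auto
      have "s \<otimes> inv t \<in> Z" using st G r_coset_eq_iff[OF Z(1)] by blast
      moreover have "s \<otimes> inv t \<in> T" using st Tsub by (meson subgroup.m_closed subgroup.m_inv_closed)
      ultimately have "s \<otimes> inv t = \<one>" using TZ by blast
      then show "s = t" using G by (metis inv_equality inv_inv inv_closed)
    qed
    moreover have "(\<lambda>t. Z #> t) ` T \<subseteq> rcosets Z" using T_iff by (auto simp: RCOSETS_def)
    ultimately show ?thesis using Zfin inj_on_finite by blast
  qed
  define e where "e = card T"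
  have e0: "e > 0" unfolding e_def using Tfin subgroup.one_closed[OF Tsub] card_gt_0_iff by blast
  have Vsub: "pcyc (V g) \<subseteq> pcyc x" if "g \<in> carrier G" for g
    using VZ Zx that xG by (intro pcyc_mono) auto
  let ?v0 = "V (x [^] m)"
  have xmZ: "x [^] m \<in> Z" unfolding Z_def using xG by (simp add: mem_pcyc_self)
  have x1: "x \<noteq> \<one>" using padic_generatorD(4)[OF x] mem_pcyc_self by auto
  have v0: "?v0 = x [^] (m * n)" using Vpow[OF xmZ] xG by (simp add: nat_pow_pow)
  have v0_ne: "?v0 \<noteq> \<one>"
    using padic_generatorD(3)[OF x] mem_pcyc_self[OF xG] x1 m(1) n0
    unfolding v0 torsion_free_pcyc_def by (metis nat_0_less_mult_iff)
  \<comment> \<open>The values of \<open>V\<close> generate members of a chain, and only finitely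
    many groups contain the open group \<open>pcyc ?v0\<close>, so a largest one
    \<open>pcyc (V g)\<close> exists and contains the whole image. Anchoring at \<open>?v0\<close>
    also ensures that \<open>V g\<close> is nontrivial.\<close>
  obtain g where g: "g \<in> carrier G" "\<And>h. h \<in> carrier G \<Longrightarrow> V h \<in> pcyc (V g)" "?v0 \<in> pcyc (V g)"
  proof -
    have U0: "subgroup (pcyc ?v0) G" "openin \<tau> (pcyc ?v0)"
      using openin_pcyc_nat_pow[OF xG op, of "m * n"] m(1) n0 xG unfolding v0 by (auto intro: subgroup_pcyc)
    let ?P = "(\<lambda>g. pcyc (V g)) ` {g \<in> carrier G. pcyc ?v0 \<subseteq> pcyc (V g)}"
    have "?P \<subseteq> {H. subgroup H G \<and> pcyc ?v0 \<subseteq> H}" using VG subgroup_pcyc by auto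
    then have "finite ?P"
      using finite_overgroups[OF U0(1) finite_index[OF U0]] finite_subset by blast
    moreover have "pcyc ?v0 \<in> ?P" using xG by auto
    ultimately obtain H where H: "H \<in> ?P" "\<forall>J\<in>?P. H \<subseteq> J \<longrightarrow> H = J"
      using finite_has_maximal[of ?P] by blast
    then obtain g where g: "g \<in> carrier G" "pcyc ?v0 \<subseteq> pcyc (V g)" "H = pcyc (V g)" by blast
    have "pcyc (V h) \<subseteq> pcyc (V g)" if h: "h \<in> carrier G" for h
    proof -
      have "pcyc (V h) \<subseteq> pcyc (V g) \<or> pcyc (V g) \<subseteq> pcyc (V h)"
        by (intro padic_generator_chain[OF x] subgroup_pcyc closedin_pcyc Vsub VG h g)
      moreover have "pcyc (V g) \<subseteq> pcyc (V h) \<Longrightarrow> pcyc (V g) = pcyc (V h)"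
        using H(2) g h by (metis (no_types, lifting) imageI mem_Collect_eq subset_trans)
      ultimately show ?thesis by blast
    qed
    then have "V h \<in> pcyc (V g)" if "h \<in> carrier G" for h using that mem_pcyc_self[OF VG[OF that]] by blast
    moreover have "?v0 \<in> pcyc (V g)" using g(2) mem_pcyc_self[of ?v0] VG xG by auto
    ultimately show thesis using that g(1) by blast
  qed
  define v where "v = V g"
  have vZ: "v \<in> Z" and vG: "v \<in> carrier G" unfolding v_def using VZ VG g(1) by auto
  have vsubZ: "pcyc v \<subseteq> Z" by (rule pcyc_least[OF Z(1,2) vZ])
  have v1: "v \<noteq> \<one>"
  proof
    assume "v = \<one>"
    then have "?v0 \<in> {\<one>}" using g(3) pcyc_one unfolding v_def by metis
    then show False using v0_ne by blast
  qed
  have "torsion_free_pcyc v" unfolding torsion_free_pcyc_def using tf vsubZ by blast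
  then obtain p where p: "padic_generator p v" using padic_generator_exists[OF vG _ v1] by blast
  note pp = padic_generatorD(2)[OF p]
  have pT: "\<not> p dvd e"
  proof
    assume "p dvd e"
    then obtain t where t: "t \<in> T" "t \<noteq> \<one>" "t [^] p = \<one>"
      using subgroup_cauchy[OF Tsub Tfin pp] unfolding e_def by blast
    then have "t \<in> carrier G" using T_iff by blast
    then show False using padic_generator_no_commuting_torsion[OF p _ t(3) central[OF vZ]] t(2) by blast
  qed
  \<comment> \<open>An element of \<open>pcyc k\<close> is \<open>a [^] e\<close> with
    \<open>a\<close> in \<open>pcyc g\<close>. If it lies in \<open>T\<close>, then
    \<open>V a\<close> is torsion in \<open>Z\<close>, so \<open>a\<close> is in \<open>T\<close>
    and its power with exponent \<open>card T\<close> is trivial. Thus \<open>pcyc k\<close> meets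
    \<open>T\<close> trivially.\<close>
  define k where "k = g [^] e"
  have kG: "k \<in> carrier G" unfolding k_def using g by simp
  have Vk: "V k = v [^] e" unfolding k_def v_def using V.hom_nat_pow[OF g(1)] by simp
  let ?K = "pcyc k"
  note K = subgroup_pcyc[OF kG] closedin_pcyc[of k]
  have KT: "c = \<one>" if c: "c \<in> ?K" "c \<in> T" for c
  proof -
    obtain a where a: "a \<in> pcyc g" "c = a [^] e" using c(1) pcyc_nat_pow[OF g(1)] unfolding k_def by auto
    have aG: "a \<in> carrier G" using a pcyc_mem_carrier by blast
    have "V a [^] e = \<one>" using V.hom_nat_pow[OF aG] a(2) c(2) T_iff by simp
    then have "V a = \<one>" using tf[OF _ e0] VZ aG by blast
    then have "a \<in> T" using aG T_iff by blast
    then show ?thesis using finite_subgroup_pow_card[OF Tsub Tfin] a(2) unfolding e_def by blast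
  qed
  have Vinj: "c = d" if cd: "c \<in> ?K" "d \<in> ?K" "V c = V d" for c d
  proof -
    have G: "c \<in> carrier G" "d \<in> carrier G" using cd pcyc_mem_carrier by auto
    have "c \<otimes> inv d \<in> ?K" using cd K(1) by (meson subgroup.m_closed subgroup.m_inv_closed)
    moreover have "c \<otimes> inv d \<in> T" using T_iff G cd(3) VG[OF G(2)] by simp
    ultimately have "c \<otimes> inv d = \<one>" using KT by blast
    then show ?thesis using G by (metis inv_equality inv_inv inv_closed)
  qed
  \<comment> \<open>As \<open>p\<close> does not divide \<open>e\<close>, the image
    \<open>V k = v [^] e\<close> still generates \<open>pcyc v\<close>. So \<open>V\<close> maps
    \<open>pcyc k\<close> onto enough of the image for every element to be corrected into
    \<open>T\<close>.\<close>
  have ve: "pcyc v \<subseteq> pcyc (v [^] e)"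
    using padic_generator_unit_pow[OF p pT] vG by (intro pcyc_mono) auto
  have Vimage: "pcyc (V a) \<subseteq> V ` pcyc a" if a: "a \<in> carrier G" for a
  proof (rule pcyc_least)
    show "subgroup (V ` pcyc a) G" by (rule V.subgroup_img_is_subgroup[OF subgroup_pcyc[OF a]])
    show "closedin \<tau> (V ` pcyc a)" by (rule closedin_image[OF Vcont closedin_pcyc])
  qed (use mem_pcyc_self[OF a] in blast)
  have decomp: "h \<in> ?K <#> T" if h: "h \<in> carrier G" for h
  proof -
    have "V h \<in> V ` ?K" using g(2)[OF h] ve Vimage[OF kG] unfolding Vk v_def[symmetric] by blast
    then obtain a where a: "a \<in> ?K" "V h = V a" by blast
    have aG: "a \<in> carrier G" using a pcyc_mem_carrier by blast
    have "inv a \<otimes> h \<in> T" using T_iff aG h a(2) VG[OF aG] by simp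
    moreover have "h = a \<otimes> (inv a \<otimes> h)" using aG h by (simp add: m_assoc[symmetric])
    ultimately show ?thesis using a(1) unfolding set_mult_def by blast
  qed
  have "torsion_free_pcyc k"
    unfolding torsion_free_pcyc_def
  proof (intro ballI allI impI)
    fix c and i :: nat assume c: "c \<in> ?K" "i > 0" "c [^] i = \<one>"
    have cG: "c \<in> carrier G" using c pcyc_mem_carrier by blast
    have "V c [^] i = \<one>" using V.hom_nat_pow[OF cG, of i] c(3) by simp
    then have "V c = \<one>" using tf[OF _ c(2)] VZ cG by blast
    then show "c = \<one>" using KT c(1) T_iff cG by blast
  qed
  moreover have "k \<noteq> \<one>"
  proof
    assume "k = \<one>"
    then have "v [^] e = \<one>" using Vk V.hom_one by simp
    then show False using tf[OF vZ e0] v1 by blast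
  qed
  ultimately obtain q where q: "padic_generator q k" using padic_generator_exists[OF kG] by blast
  \<comment> \<open>Otherwise \<open>v\<close> lies in \<open>pcyc (v [^] q)\<close>. Raising to the
    power \<open>e\<close> and pulling back along \<open>V\<close>, injective on
    \<open>pcyc k\<close>, would put \<open>k\<close> into \<open>pcyc (k [^] q)\<close>.\<close>
  have "q = p"
  proof (rule ccontr)
    assume "q \<noteq> p"
    then have "v \<in> pcyc (v [^] q)" using padic_generatorD(5)[OF p padic_generatorD(2)[OF q]] by blast
    then have "v [^] e \<in> pcyc (v [^] (q * e))" using pcyc_pow_mono[OF vG, of 1 q e] vG by simp
    also have "v [^] (q * e) = V (k [^] q)"
      using V.hom_nat_pow[OF kG, of q] Vk vG by (simp add: nat_pow_pow mult.commute)
    also have "pcyc (V (k [^] q)) \<subseteq> V ` pcyc (k [^] q)" using Vimage kG by simp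
    finally obtain a where a: "a \<in> pcyc (k [^] q)" "V k = V a" using Vk by auto
    have "a \<in> ?K" using a(1) kG pcyc_mono[OF kG nat_pow_mem_pcyc[OF kG]] by blast
    then have "k = a" using Vinj[OF mem_pcyc_self[OF kG] _ a(2)] by blast
    then show False using padic_generatorD(4)[OF q] a(1) by blast
  qed
  have "internal_semidirect_product G \<tau> ?K T"
    unfolding internal_semidirect_product_def
  proof (intro conjI K TN)
    show "closedin \<tau> T" using Tfin T_iff by (intro closedin_finite) auto
    show "?K <#> T = carrier G"
      using decomp set_mult_closed[OF subgroup.subset[OF K(1)] subgroup.subset[OF Tsub]] by blast
    show "?K \<inter> T = {\<one>}" using KT subgroup.one_closed[OF K(1)] subgroup.one_closed[OF Tsub] by blast
  qed
  then show ?thesis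
    using pp padic_generator_iso[OF q] \<open>q = p\<close> Tfin pT unfolding e_def by blast
qed

end

theorem theorem5p1:
  fixes G :: "('a, 'b) monoid_scheme" and \<tau> :: "'a topology"
  assumes "profinite_group G \<tau>" and "infinite (carrier G)"
  shows "(finite_width (closed_subgroup_lattice G \<tau>) \<longleftrightarrow> finite_width (open_subgroup_lattice G \<tau>)) \<and>
         (finite_width (open_subgroup_lattice G \<tau>) \<longleftrightarrow>
           (\<exists>p::nat. Factorial_Ring.prime p \<and>
             (\<exists>K T. internal_semidirect_product G \<tau> K T \<and>
               topologically_isomorphic (G\<lparr>carrier := K\<rparr>) (subtopology \<tau> K)
                 (padic_int_group p) (padic_int_topology p) \<and>
               finite T \<and> \<not> p dvd card T)))"
proof -
  interpret profinite_group G \<tau> by (rule assms(1))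
  have width: "finite_width (closed_subgroup_lattice G \<tau>) \<longleftrightarrow> finite_width (open_subgroup_lattice G \<tau>)"
    using finite_width_closed_imp_open finite_width_open_imp_closed by blast
  have "finite_width_profinite_group G \<tau>" if "finite_width (closed_subgroup_lattice G \<tau>)"
    using that by unfold_locales
  then show ?thesis
    using width finite_width_profinite_group.semidirect_product_exists[OF _ assms(2)]
      finite_width_semidirect_padic by blast
qed

end
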